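(* Let $\mathbb{K}=\mathbb{R}$ or $\mathbb{C}$. Let $\mathcal{G}$ and $\mathcal{H}$ be locally compact Hausdorff topological groupoids. For each $Z\in\{\mathcal{G},\mathcal{H}\}$, let $\lambda_Z$ be a fully supported (continuous left) Haar system on $Z$, and $\mu_Z$ a fully supported regular Borel measure on the unit space $Z^{(0)}$. Let $T\colon C_c(\mathcal{G})\to C_c(\mathcal{H})$ be an isomorphism of ($\mathbb{K}$-)algebras (with the convolution products given by $\lambda_{\mathcal{G}}$ and $\lambda_{\mathcal{H}}$) which is isometric with respect to the $L^1$-norms of the measures $\lambda_Z\circ\mu_Z$, $Z\in\{\mathcal{G},\mathcal{H}\}$. Then there are a topological groupoid isomorphism $\phi\colon\mathcal{H}\to\mathcal{G}$ and a continuous groupoid morphism $p\colon\mathcal{H}\to\mathbb{S}^1$ such that $$Tf(h)=p(h)\,D(\phi(h))\,f(\phi(h))\qquad\text{for all } f\in C_c(\mathcal{G}),\ h\in\mathcal{H},$$ where $D$ is a continuous instance of the Radon--Nikodym derivative $$D(a)=\frac{d\lambda_{\mathcal{G}}^{\mathfrak{r}(a)}}{d\big(\phi_*\lambda_{\mathcal{H}}^{\phi^{-1}(\mathfrak{r}(a))}\big)}(a),\qquad a\in\mathcal{G},$$ and in this case $\mu_{\mathcal{G}}=\phi_*\mu_{\mathcal{H}}$.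
   Context: A groupoid $\mathcal{G}$ is a small category with inverses; a topological groupoid carries a topology making product and inversion continuous. Put $\mathfrak{s}(a)=a^{-1}a$, $\mathfrak{r}(a)=aa^{-1}$, $\mathcal{G}^{(0)}=\mathfrak{s}(\mathcal{G})$ (unit space), $\mathcal{G}^x=\mathfrak{r}^{-1}(x)$ for $x\in\mathcal{G}^{(0)}$. A topological groupoid isomorphism is a groupoid isomorphism which is a homeomorphism. $\mathbb{S}^1$ is the circle group of complex numbers of modulus $1$. $C_c(\mathcal{G})$ is the space of continuous compactly supported functions $\mathcal{G}\to\mathbb{K}$. A Borel measure $\mu$ on a locally compact Hausdorff space is regular if it is locally finite, i.e. all compact sets have finite measure, $\mu(E)=\inf\{\mu(V):E\subseteq V,\ V\text{ open}\}$ for every Borel $E$, and $\mu(U)=\sup\{\mu(K):K\subseteq U,\ K\text{ compact}\}$ for every open $U$ with $\mu(U)<\infty$. Its support is the set of points all of whose neighbourhoods have positive measure; it is fully supported if its support is the whole space. A (continuous left) Haar system on $\mathcal{G}$ is a family $\lambda=\{\lambda^x:x\in\mathcal{G}^{(0)}\}$ of regular Borel measures on $\mathcal{G}$ such that: (i) the support of $\lambda^x$ is contained in $\mathcal{G}^x$; (ii) $\lambda^{\mathfrak{r}(a)}(aE)=\lambda^{\mathfrak{s}(a)}(E)$ for every $a\in\mathcal{G}$ and every compact $E\subseteq\mathcal{G}^{\mathfrak{s}(a)}$; (iii) for each $f\in C_c(\mathcal{G})$ the map $x\mapsto\int f\,d\lambda^x$ is continuous on $\mathcal{G}^{(0)}$.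 It is fully supported if the support of $\lambda^x$ is $\mathcal{G}^x$ for every $x$. The measure $\lambda^x$ is regarded indifferently as a measure on $\mathcal{G}$ or on $\mathcal{G}^x$. The convolution product on $C_c(\mathcal{G})$ is $(fg)(a)=\int f(s)g(s^{-1}a)\,d\lambda^{\mathfrak{r}(a)}(s)$. For a regular Borel measure $\mu$ on $\mathcal{G}^{(0)}$, $\lambda\circ\mu$ is the unique regular Borel measure on $\mathcal{G}$ with $(\lambda\circ\mu)(E)=\int_{\mathcal{G}^{(0)}}\lambda^x(E)\,d\mu(x)$ for every compact $E\subseteq\mathcal{G}$ (its existence being given by the Riesz--Markov--Kakutani Representation Theorem); its $L^1$-norm on $C_c(\mathcal{G})$ is $\|f\|=\int_{\mathcal G}|f|\,d(\lambda\circ\mu)=\int_{\mathcal{G}^{(0)}}\int|f|\,d\lambda^x\,d\mu(x)$. $\phi_*$ denotes push-forward of measures. That $D$ is a continuous instance of the displayed Radon--Nikodym derivative means: $D\colon\mathcal{G}\to[0,\infty)$ is continuous and for every $x\in\mathcal{G}^{(0)}$ the restriction $D|_{\mathcal{G}^x}$ is a density of $\lambda_{\mathcal{G}}^x$ with respect to $\phi_*\lambda_{\mathcal{H}}^{\phi^{-1}(x)}$, i.e. $\lambda_{\mathcal{G}}^x(E)=\int_E D\,d(\phi_*\lambda_{\mathcal{H}}^{\phi^{-1}(x)})$ for every Borel $E\subseteq\mathcal{G}^x$.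
   Formalization: Regular Borel measures are required to be inner regular on every open set, not only on open sets of finite measure; with the weaker condition λ∘μ is not unique and the claim μ_G = φ_*μ_H fails on some spaces that are not σ-compact. *)

theory Defs
  imports "HOL-Analysis.Analysis"
begin

section \<open>Groupoids\<close>

text \<open>
  Objects are identified with their identity arrows, so a groupoid is given by its arrows, a
  multiplication and an inversion.  Source and range are derived: \<open>s(a) = a\<inverse>a\<close> and
  \<open>r(a) = aa\<inverse>\<close>, and \<open>ab\<close> is meaningful exactly when \<open>s(a) = r(b)\<close>; the values of
  \<open>gmult\<close> on other pairs are irrelevant.
\<close>

record 'a groupoid =
  arrows :: "'a set"
  gmult :: "'a \<Rightarrow> 'a \<Rightarrow> 'a"
  ginv :: "'a \<Rightarrow> 'a"

definition src :: "('a, 'm) groupoid_scheme \<Rightarrow> 'a \<Rightarrow> 'a" where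
  "src G a = gmult G (ginv G a) a"

definition rng :: "('a, 'm) groupoid_scheme \<Rightarrow> 'a \<Rightarrow> 'a" where
  "rng G a = gmult G a (ginv G a)"

definition units :: "('a, 'm) groupoid_scheme \<Rightarrow> 'a set" where
  "units G = src G ` arrows G"

definition fiber :: "('a, 'm) groupoid_scheme \<Rightarrow> 'a \<Rightarrow> 'a set" where
  "fiber G x = {a \<in> arrows G. rng G a = x}"

definition composable :: "('a, 'm) groupoid_scheme \<Rightarrow> ('a \<times> 'a) set" where
  "composable G = {(a, b). a \<in> arrows G \<and> b \<in> arrows G \<and> src G a = rng G b}"

locale groupoid =
  fixes G :: "('a, 'm) groupoid_scheme"
  assumes ginv_closed: "a \<in> arrows G \<Longrightarrow> ginv G a \<in> arrows G"
    and src_ginv: "a \<in> arrows G \<Longrightarrow> src G (ginv G a) = rng G a"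
    and rng_ginv: "a \<in> arrows G \<Longrightarrow> rng G (ginv G a) = src G a"
    and gmult_closed: "(a, b) \<in> composable G \<Longrightarrow> gmult G a b \<in> arrows G"
    and src_gmult: "(a, b) \<in> composable G \<Longrightarrow> src G (gmult G a b) = src G b"
    and rng_gmult: "(a, b) \<in> composable G \<Longrightarrow> rng G (gmult G a b) = rng G a"
    and gmult_assoc: "\<lbrakk>(a, b) \<in> composable G; (b, c) \<in> composable G\<rbrakk> \<Longrightarrow>
          gmult G (gmult G a b) c = gmult G a (gmult G b c)"
    and rng_gmult_id: "a \<in> arrows G \<Longrightarrow> gmult G (rng G a) a = a"
    and gmult_src_id: "a \<in> arrows G \<Longrightarrow> gmult G a (src G a) = a"

definition groupoid_hom ::
    "('a, 'm) groupoid_scheme \<Rightarrow> ('b, 'n) groupoid_scheme \<Rightarrow> ('a \<Rightarrow> 'b) \<Rightarrow> bool" where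
  "groupoid_hom H G \<phi> \<longleftrightarrow>
     (\<forall>a \<in> arrows H. \<phi> a \<in> arrows G) \<and>
     (\<forall>(a, b) \<in> composable H.
        (\<phi> a, \<phi> b) \<in> composable G \<and> \<phi> (gmult H a b) = gmult G (\<phi> a) (\<phi> b))"


section \<open>Topological groupoids\<close>

record 'a top_groupoid = "'a groupoid" +
  gtop :: "'a topology"

locale topological_groupoid = groupoid G for G :: "'a top_groupoid" +
  assumes topspace_gtop: "topspace (gtop G) = arrows G"
    and continuous_gmult:
      "continuous_map (subtopology (prod_topology (gtop G) (gtop G)) (composable G)) (gtop G)
         (\<lambda>(a, b). gmult G a b)"
    and continuous_ginv: "continuous_map (gtop G) (gtop G) (ginv G)"

locale lc_hausdorff_groupoid = topological_groupoid G for G :: "'a top_groupoid" +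
  assumes locally_compact: "locally_compact_space (gtop G)"
    and Hausdorff: "Hausdorff_space (gtop G)"

definition unit_top :: "'a top_groupoid \<Rightarrow> 'a topology" where
  "unit_top G = subtopology (gtop G) (units G)"

definition top_groupoid_iso :: "'b top_groupoid \<Rightarrow> 'a top_groupoid \<Rightarrow> ('b \<Rightarrow> 'a) \<Rightarrow> bool" where
  \<comment> \<open>the inverse of a bijective groupoid morphism is automatically a groupoid morphism\<close>
  "top_groupoid_iso H G \<phi> \<longleftrightarrow>
     groupoid_hom H G \<phi> \<and> homeomorphic_map (gtop H) (gtop G) \<phi>"

definition circle_group :: "complex top_groupoid" where
  "circle_group =
     \<lparr>arrows = sphere 0 1, gmult = (*), ginv = inverse, gtop = top_of_set (sphere 0 1)\<rparr>"


section \<open>Regular Borel measures\<close>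

definition borel_of :: "'a topology \<Rightarrow> 'a measure" where
  "borel_of X = sigma (topspace X) {U. openin X U}"

text \<open>
  Inner regularity is required on all open sets, also those of infinite measure: this is the
  class of measures in which the representing measure of the Riesz--Markov--Kakutani theorem
  exists and is unique.  If open sets of infinite measure were exempted, two distinct fully
  supported measures could agree on all compact sets (and so define the same integral of
  continuous compactly supported functions) when the space is not \<open>\<sigma>\<close>-compact.
\<close>

definition regular_borel_measure :: "'a topology \<Rightarrow> 'a measure \<Rightarrow> bool" where
  "regular_borel_measure X M \<longleftrightarrow>
     sets M = sets (borel_of X) \<and>
     (\<forall>K. compactin X K \<longrightarrow> emeasure M K < \<infinity>) \<and>
     (\<forall>E \<in> sets M. emeasure M E = (INF V \<in> {V. openin X V \<and> E \<subseteq> V}. emeasure M V)) \<and>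
     (\<forall>U. openin X U \<longrightarrow> emeasure M U = (SUP K \<in> {K. compactin X K \<and> K \<subseteq> U}. emeasure M K))"

definition measure_support :: "'a topology \<Rightarrow> 'a measure \<Rightarrow> 'a set" where
  "measure_support X M = {x \<in> topspace X. \<forall>U. openin X U \<and> x \<in> U \<longrightarrow> emeasure M U > 0}"

definition fully_supported :: "'a topology \<Rightarrow> 'a measure \<Rightarrow> bool" where
  "fully_supported X M \<longleftrightarrow> measure_support X M = topspace X"


section \<open>Compactly supported functions and Haar systems\<close>

text \<open>
  The scalar field \<open>K\<close> is \<open>\<real>\<close> or all of \<open>\<complex>\<close>, as a subset of \<^typ>\<open>complex\<close>.  Functions on a
  space are represented by their extension by zero outside \<^term>\<open>topspace X\<close>, which makes
  equality of functions on the space the equality of HOL.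
\<close>

definition Cc :: "complex set \<Rightarrow> 'a topology \<Rightarrow> ('a \<Rightarrow> complex) set" where
  "Cc K X = {f. continuous_map X euclidean f \<and> f ` topspace X \<subseteq> K \<and>
                compactin X (X closure_of {x \<in> topspace X. f x \<noteq> 0}) \<and>
                (\<forall>x. x \<notin> topspace X \<longrightarrow> f x = 0)}"

text \<open>Only the values of the family \<open>\<lambda>\<close> at units matter.\<close>

definition haar_system :: "complex set \<Rightarrow> 'a top_groupoid \<Rightarrow> ('a \<Rightarrow> 'a measure) \<Rightarrow> bool" where
  "haar_system K G lam \<longleftrightarrow>
     (\<forall>x \<in> units G. regular_borel_measure (gtop G) (lam x)) \<and>
     (\<forall>x \<in> units G. measure_support (gtop G) (lam x) \<subseteq> fiber G x) \<and>
     (\<forall>a \<in> arrows G. \<forall>E. compactin (gtop G) E \<and> E \<subseteq> fiber G (src G a) \<longrightarrow>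
        emeasure (lam (rng G a)) (gmult G a ` E) = emeasure (lam (src G a)) E) \<and>
     (\<forall>f \<in> Cc K (gtop G). continuous_map (unit_top G) euclidean (\<lambda>x. \<integral>s. f s \<partial>lam x))"

definition fully_supported_haar :: "'a top_groupoid \<Rightarrow> ('a \<Rightarrow> 'a measure) \<Rightarrow> bool" where
  "fully_supported_haar G lam \<longleftrightarrow>
     (\<forall>x \<in> units G. measure_support (gtop G) (lam x) = fiber G x)"

text \<open>
  The integral is restricted to the fibre, which carries \<open>\<lambda>\<^sup>r\<^sup>(\<^sup>a\<^sup>)\<close>, because \<open>s\<inverse>a\<close> is
  meaningless for the other \<open>s\<close>.
\<close>

definition convolution ::
    "'a top_groupoid \<Rightarrow> ('a \<Rightarrow> 'a measure) \<Rightarrow> ('a \<Rightarrow> complex) \<Rightarrow> ('a \<Rightarrow> complex) \<Rightarrow> 'a \<Rightarrow> complex"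
  where
  "convolution G lam f g = (\<lambda>a.
     if a \<in> arrows G
     then set_lebesgue_integral (lam (rng G a)) (fiber G (rng G a))
            (\<lambda>s. f s * g (gmult G (ginv G s) a))
     else 0)"

text \<open>\<open>composition_measure G \<lambda> \<mu> \<nu>\<close> says that \<open>\<nu>\<close> is the measure \<open>\<lambda> \<circ> \<mu>\<close>.\<close>

definition composition_measure ::
    "'a top_groupoid \<Rightarrow> ('a \<Rightarrow> 'a measure) \<Rightarrow> 'a measure \<Rightarrow> 'a measure \<Rightarrow> bool" where
  "composition_measure G lam mu nu \<longleftrightarrow>
     regular_borel_measure (gtop G) nu \<and>
     (\<forall>E. compactin (gtop G) E \<longrightarrow> emeasure nu E = (\<integral>\<^sup>+ x. emeasure (lam x) E \<partial>mu))"

definition L1_norm :: "'a measure \<Rightarrow> ('a \<Rightarrow> complex) \<Rightarrow> real" where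
  "L1_norm nu f = (\<integral>a. cmod (f a) \<partial>nu)"

definition Cc_algebra_iso ::
    "complex set \<Rightarrow> 'a top_groupoid \<Rightarrow> ('a \<Rightarrow> 'a measure) \<Rightarrow> 'b top_groupoid \<Rightarrow> ('b \<Rightarrow> 'b measure) \<Rightarrow>
     (('a \<Rightarrow> complex) \<Rightarrow> ('b \<Rightarrow> complex)) \<Rightarrow> bool" where
  "Cc_algebra_iso K G lamG H lamH T \<longleftrightarrow>
     bij_betw T (Cc K (gtop G)) (Cc K (gtop H)) \<and>
     (\<forall>f \<in> Cc K (gtop G). \<forall>g \<in> Cc K (gtop G). T (\<lambda>a. f a + g a) = (\<lambda>h. T f h + T g h)) \<and>
     (\<forall>c \<in> K. \<forall>f \<in> Cc K (gtop G). T (\<lambda>a. c * f a) = (\<lambda>h. c * T f h)) \<and>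
     (\<forall>f \<in> Cc K (gtop G). \<forall>g \<in> Cc K (gtop G).
        T (convolution G lamG f g) = convolution H lamH (T f) (T g))"

text \<open>
  \<open>D\<close> is a continuous instance of the Radon--Nikodym derivative of \<open>\<lambda>\<^sub>G\<close> with respect to the
  family of push-forwards under \<open>\<phi>\<close> of the measures \<open>\<lambda>\<^sub>H\<close>, fibre by fibre.  Fibres are closed, so
  the Borel subsets of a fibre are the Borel sets of the groupoid contained in it.
\<close>

definition continuous_RN_derivative ::
    "'a top_groupoid \<Rightarrow> ('a \<Rightarrow> 'a measure) \<Rightarrow> 'b top_groupoid \<Rightarrow> ('b \<Rightarrow> 'b measure) \<Rightarrow>
     ('b \<Rightarrow> 'a) \<Rightarrow> ('a \<Rightarrow> real) \<Rightarrow> bool" where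
  "continuous_RN_derivative G lamG H lamH \<phi> D \<longleftrightarrow>
     continuous_map (gtop G) euclideanreal D \<and>
     (\<forall>a \<in> arrows G. 0 \<le> D a) \<and>
     (\<forall>x \<in> units G. \<forall>E \<in> sets (borel_of (gtop G)). E \<subseteq> fiber G x \<longrightarrow>
        emeasure (lamG x) E =
          (\<integral>\<^sup>+ a \<in> E. ennreal (D a)
             \<partial>distr (lamH (inv_into (arrows H) \<phi> x)) (borel_of (gtop G)) \<phi>))"

end

theory Submission
  imports Defs
begin

text \<open>
  Two functions satisfy \<open>f g = 0\<close> iff \<open>\<parallel>f + g\<parallel> = \<parallel>f - g\<parallel> = \<parallel>f\<parallel> + \<parallel>g\<parallel>\<close> in \<open>L\<^sup>1\<close>, so the isometry \<open>T\<close>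
  preserves disjointness in both directions.  The supports of the functions \<open>a\<close> with \<open>Ta(h) \<noteq> 0\<close>
  then have a common point \<open>\<phi>(h)\<close>, which gives a homeomorphism, and comparing \<open>L\<^sup>1\<close>-masses on small
  compact sets yields \<open>Tf = w \<cdot> (f \<circ> \<phi>)\<close> with \<open>w\<close> continuous and nowhere zero.

  Multiplicativity forces \<open>\<phi>\<close> to respect products, since the support of a convolution is contained in
  the product of the supports.  Testing the convolution identity on fibres gives
  \<open>w(t) w(k) = w(s(t)) w(tk)\<close> and shows that \<open>w \<circ> s\<close> is positive and is, transported by \<open>\<phi>\<close>, a density
  of \<open>\<lambda>\<^sub>G\<close> with respect to \<open>\<phi>\<^sub>*\<lambda>\<^sub>H\<close>; hence \<open>p = w / (w \<circ> s)\<close> is a morphism.  Disintegrating the isometry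
  gives \<open>\<integral>(\<integral>\<bar>p\<bar>F d\<lambda>\<^sub>H\<^sup>y) d\<mu>\<^sub>H(y) = \<integral>(\<integral>F d\<lambda>\<^sub>H\<^sup>y) d\<mu>'(y)\<close>, where \<open>\<mu>'\<close> is \<open>\<mu>\<^sub>G\<close> transported by \<open>\<phi>\<close>, for all
  \<open>F \<ge> 0\<close>.  Varying \<open>F\<close>, the function \<open>\<bar>p\<bar>\<close> is constant on fibres; it is \<open>1\<close> at units, so \<open>\<bar>p\<bar> = 1\<close> and \<open>\<mu>' = \<mu>\<^sub>H\<close>.
\<close>

section \<open>Continuous functions with compact support\<close>

text \<open>Neither \<sigma>-finiteness nor \<sigma>-compactness is available, so the classical
  Radon-Nikodym and Fubini theorems cannot be quoted, and the composed measure is given only by its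
  values on compact sets. Every statement about measures is therefore reduced to integrals of
  continuous functions with compact support and returns to Borel sets by regularity alone; full
  support turns almost-everywhere conclusions into pointwise ones. The weight \<open>w\<close> mixes
  a morphism with a density. The density depends on an arrow only through its source, and this is
  why dividing \<open>w\<close> by w \<circ> s leaves a morphism. Test functions are real and
  nonnegative, so that one argument serves both scalar fields, while \<open>w\<close> is treated as
  complex throughout.\<close>

lemma continuous_map_mult_algebra:
  fixes f g :: "'a \<Rightarrow> 'b::real_normed_algebra"
  shows "\<lbrakk>continuous_map X euclidean f; continuous_map X euclidean g\<rbrakk>
    \<Longrightarrow> continuous_map X euclidean (\<lambda>x. f x * g x)"
  by (simp add: continuous_map_atin tendsto_mult)

lemma continuous_map_divide_field:
  fixes f g :: "'a \<Rightarrow> 'b::real_normed_field"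
  shows "\<lbrakk>continuous_map X euclidean f; continuous_map X euclidean g;
      \<And>x. x \<in> topspace X \<Longrightarrow> g x \<noteq> 0\<rbrakk>
    \<Longrightarrow> continuous_map X euclidean (\<lambda>x. f x / g x)"
  by (simp add: continuous_map_atin tendsto_divide)

lemma continuous_map_of_real:
  "continuous_map X euclideanreal f
    \<Longrightarrow> continuous_map X euclidean (\<lambda>x. of_real (f x) :: 'b::real_normed_algebra_1)"
  by (simp add: continuous_map_atin tendsto_of_real)

lemma continuous_map_Re: "continuous_map X euclidean f \<Longrightarrow> continuous_map X euclideanreal (\<lambda>x. Re (f x))"
  and continuous_map_Im: "continuous_map X euclidean f \<Longrightarrow> continuous_map X euclideanreal (\<lambda>x. Im (f x))"
  by (simp_all add: continuous_map_atin tendsto_Re tendsto_Im)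

lemma continuous_map_euclidean_dist:
  fixes f :: "'a \<Rightarrow> 'b::metric_space"
  shows "continuous_map X euclidean f \<longleftrightarrow>
    (\<forall>x \<in> topspace X. \<forall>e>0. \<exists>U. openin X U \<and> x \<in> U \<and> (\<forall>y\<in>U. dist (f y) (f x) < e))"
  using Met_TC.continuous_map_to_metric[of X f] by (simp add: dist_commute)

lemma continuous_map_locally:
  assumes "\<And>x. x \<in> topspace X \<Longrightarrow>
    \<exists>U g. openin X U \<and> x \<in> U \<and> continuous_map X Y g \<and> (\<forall>y\<in>U. f y = g y)"
  shows "continuous_map X Y f"
  unfolding continuous_map_eq_topcontinuous_at
proof
  fix x assume "x \<in> topspace X"
  then obtain U g where U: "openin X U" "x \<in> U" and g: "continuous_map X Y g" "\<forall>y\<in>U. f y = g y"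
    using assms by blast
  show "topcontinuous_at X Y f x"
    unfolding topcontinuous_at_def
  proof (intro conjI allI impI)
    show "x \<in> topspace X" by fact
    show "f \<in> topspace X \<rightarrow> topspace Y"
    proof
      fix y assume "y \<in> topspace X"
      then obtain U g where "y \<in> U" "continuous_map X Y g" "\<forall>y\<in>U. f y = g y"
        using assms by blast
      then show "f y \<in> topspace Y"
        using \<open>y \<in> topspace X\<close> by (auto simp: continuous_map_def Pi_iff)
    qed
    fix V assume V: "openin Y V \<and> f x \<in> V"
    have "openin X (U \<inter> {y \<in> topspace X. g y \<in> V})"
      using U V g openin_continuous_map_preimage by blast
    moreover have "x \<in> U \<inter> {y \<in> topspace X. g y \<in> V}"
      using U V g \<open>x \<in> topspace X\<close> by auto
    ultimately show "\<exists>W. openin X W \<and> x \<in> W \<and> (\<forall>y\<in>W. f y \<in> V)"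
      using g(2) by (intro exI[of _ "U \<inter> {y \<in> topspace X. g y \<in> V}"]) auto
  qed
qed

text \<open>A variant of \<open>Cc\<close> with values in any normed space, so that real and complex
  functions share the same closure lemmas. Asking for some compact set outside which
  \<open>f\<close> vanishes avoids closures and already forces \<open>f\<close> to be zero off
  \<open>topspace X\<close>.\<close>

definition compact_supp :: "'a topology \<Rightarrow> ('a \<Rightarrow> 'b::real_normed_vector) \<Rightarrow> bool" where
  "compact_supp X f \<longleftrightarrow>
    continuous_map X euclidean f \<and> (\<exists>C. compactin X C \<and> (\<forall>x. x \<notin> C \<longrightarrow> f x = 0))"

lemma compact_suppE:
  assumes "compact_supp X f"
  obtains C where "continuous_map X euclidean f" "compactin X C" "\<And>x. x \<notin> C \<Longrightarrow> f x = 0"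
  using assms that unfolding compact_supp_def by auto

lemma compact_supp_outside: "compact_supp X f \<Longrightarrow> x \<notin> topspace X \<Longrightarrow> f x = 0"
  unfolding compact_supp_def using compactin_subset_topspace by blast

lemma compact_supp_continuous: "compact_supp X f \<Longrightarrow> continuous_map X euclidean f"
  unfolding compact_supp_def by blast

lemma compact_supp_bounded:
  assumes "compact_supp X f"
  obtains B where "0 < B" "\<And>x. norm (f x) \<le> B"
proof -
  obtain C where f: "continuous_map X euclidean f" "compactin X C" "\<And>x. x \<notin> C \<Longrightarrow> f x = 0"
    using assms compact_suppE by blast
  have "compact (f ` C)"
    using image_compactin f by (metis compactin_euclidean_iff)
  then obtain B where B: "\<And>x. x \<in> C \<Longrightarrow> norm (f x) \<le> B"
    by (metis bounded_iff compact_imp_bounded imageI)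
  have "norm (f x) \<le> max B 1" for x
    using B[of x] f(3)[of x] by (cases "x \<in> C") auto
  then show ?thesis
    using that[of "max B 1"] by simp
qed

lemma Cc_iff_compact_supp:
  assumes "Hausdorff_space X"
  shows "f \<in> Cc K X \<longleftrightarrow> compact_supp X f \<and> f ` topspace X \<subseteq> K"
proof
  assume "f \<in> Cc K X"
  then have f: "continuous_map X euclidean f" "f ` topspace X \<subseteq> K"
      "compactin X (X closure_of {x \<in> topspace X. f x \<noteq> 0})" "\<And>x. x \<notin> topspace X \<Longrightarrow> f x = 0"
    unfolding Cc_def by auto
  have "{x \<in> topspace X. f x \<noteq> 0} \<subseteq> X closure_of {x \<in> topspace X. f x \<noteq> 0}"
    by (rule closure_of_subset) auto
  then have "\<And>x. x \<notin> X closure_of {x \<in> topspace X. f x \<noteq> 0} \<Longrightarrow> f x = 0"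
    using f(4) by blast
  then show "compact_supp X f \<and> f ` topspace X \<subseteq> K"
    unfolding compact_supp_def using f by blast
next
  assume f: "compact_supp X f \<and> f ` topspace X \<subseteq> K"
  then obtain C where C: "continuous_map X euclidean f" "compactin X C" "\<And>x. x \<notin> C \<Longrightarrow> f x = 0"
    using compact_suppE by blast
  have "closedin X C"
    using C assms compactin_imp_closedin by blast
  then have "X closure_of {x \<in> topspace X. f x \<noteq> 0} \<subseteq> C"
    using C by (intro closure_of_minimal) auto
  then have "compactin X (X closure_of {x \<in> topspace X. f x \<noteq> 0})"
    using C closed_compactin closedin_closure_of by blast
  then show "f \<in> Cc K X"
    unfolding Cc_def using f C compact_supp_outside by auto
qed

lemma compact_supp_mult_right:
  fixes f g :: "'a \<Rightarrow> 'b::real_normed_algebra"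
  assumes "continuous_map X euclidean f" "compact_supp X g"
  shows "compact_supp X (\<lambda>x. f x * g x)" "compact_supp X (\<lambda>x. g x * f x)"
  using assms unfolding compact_supp_def by (auto intro: continuous_map_mult_algebra)

lemma compact_supp_const_mult:
  fixes g :: "'a \<Rightarrow> 'b::real_normed_algebra"
  assumes "compact_supp X g"
  shows "compact_supp X (\<lambda>x. c * g x)"
  using assms compact_supp_mult_right(1)[of X "\<lambda>_. c"] by simp

lemma compact_supp_add:
  assumes "compact_supp X f" "compact_supp X g"
  shows "compact_supp X (\<lambda>x. f x + g x)"
proof -
  obtain C where C: "continuous_map X euclidean f" "compactin X C" "\<And>x. x \<notin> C \<Longrightarrow> f x = 0"
    using assms(1) compact_suppE by blast
  obtain D where D: "continuous_map X euclidean g" "compactin X D" "\<And>x. x \<notin> D \<Longrightarrow> g x = 0"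
    using assms(2) compact_suppE by blast
  have "compactin X (C \<union> D)" "\<forall>x. x \<notin> C \<union> D \<longrightarrow> f x + g x = 0"
    using C D by (auto intro: compactin_Un)
  then show ?thesis
    unfolding compact_supp_def using C(1) D(1) by (blast intro: continuous_map_add)
qed

lemma compact_supp_comp_zero:
  assumes "compact_supp X f" "continuous_on UNIV h" "h 0 = 0"
  shows "compact_supp X (\<lambda>x. h (f x))"
proof -
  have "continuous_map X euclidean (h \<circ> f)"
    using assms by (intro continuous_map_compose) (auto simp: compact_supp_def)
  then show ?thesis
    using assms unfolding compact_supp_def comp_def by metis
qed

lemma compact_supp_diff:
  assumes "compact_supp X f" "compact_supp X g"
  shows "compact_supp X (\<lambda>x. f x - g x)"
  using compact_supp_add[OF assms(1) compact_supp_comp_zero[OF assms(2), of uminus]]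
  by (simp add: continuous_on_minus)

lemma compact_supp_norm: "compact_supp X f \<Longrightarrow> compact_supp X (\<lambda>x. norm (f x))"
  by (rule compact_supp_comp_zero) (auto intro: continuous_intros)

lemma compact_supp_of_real:
  "compact_supp X f \<Longrightarrow> compact_supp X (\<lambda>x. of_real (f x) :: 'b::real_normed_algebra_1)"
  by (rule compact_supp_comp_zero) (auto intro: continuous_intros)

lemma compact_supp_Re: "compact_supp X f \<Longrightarrow> compact_supp X (\<lambda>x. Re (f x))"
  and compact_supp_Im: "compact_supp X f \<Longrightarrow> compact_supp X (\<lambda>x. Im (f x))"
  by (rule compact_supp_comp_zero; auto intro: continuous_intros)+

lemma compact_supp_homeomorphic:
  assumes "compact_supp X f" "homeomorphic_maps X Y \<phi> \<psi>"
  shows "compact_supp Y (\<lambda>y. if y \<in> topspace Y then f (\<psi> y) else 0)"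
proof -
  obtain C where C: "continuous_map X euclidean f" "compactin X C" "\<And>x. x \<notin> C \<Longrightarrow> f x = 0"
    using assms(1) compact_suppE by blast
  have h: "continuous_map X Y \<phi>" "continuous_map Y X \<psi>" "\<And>y. y \<in> topspace Y \<Longrightarrow> \<phi> (\<psi> y) = y"
    using assms(2) unfolding homeomorphic_maps_def by auto
  have "continuous_map Y euclidean (f \<circ> \<psi>)"
    using h C continuous_map_compose by blast
  then have "continuous_map Y euclidean (\<lambda>y. if y \<in> topspace Y then f (\<psi> y) else 0)"
    by (rule continuous_map_eq) auto
  moreover have "compactin Y (\<phi> ` C)"
    using C h image_compactin by blast
  moreover have "(if y \<in> topspace Y then f (\<psi> y) else 0) = 0" if "y \<notin> \<phi> ` C" for y
    using that h(3) C(3) by (metis imageI)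
  ultimately show ?thesis
    unfolding compact_supp_def by blast
qed

text \<open>Two layers of compact neighbourhoods are interposed between \<open>C\<close> and
  \<open>U\<close> before Urysohn's lemma is applied; one layer would give \<open>u = 1\<close> only
  on \<open>C\<close>. The open set \<open>N\<close> is what lets a cutoff leave a function
  unchanged near a point.\<close>

lemma bump_function:
  assumes "locally_compact_space X" "Hausdorff_space X" "compactin X C" "openin X U" "C \<subseteq> U"
  obtains u :: "'a \<Rightarrow> real" and N L where "compact_supp X u" "\<And>x. 0 \<le> u x" "\<And>x. u x \<le> 1"
    "openin X N" "C \<subseteq> N" "\<And>x. x \<in> N \<Longrightarrow> u x = 1"
    "compactin X L" "L \<subseteq> U" "\<And>x. x \<notin> L \<Longrightarrow> u x = 0"
proof -
  have nbhd: "\<exists>N L. openin X N \<and> compactin X L \<and> C' \<subseteq> N \<and> N \<subseteq> L \<and> L \<subseteq> U"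
    if C': "compactin X C'" "C' \<subseteq> U" for C'
  proof -
    have lc: "locally_compact_space (subtopology X U)"
      using assms locally_compact_space_open_subset by blast
    have H: "Hausdorff_space (subtopology X U)"
      using assms Hausdorff_space_subtopology by blast
    have "compactin (subtopology X U) C'"
      using C' by (simp add: compactin_subtopology)
    then obtain N L where "openin (subtopology X U) N" "compactin (subtopology X U) L" "C' \<subseteq> N" "N \<subseteq> L"
      using locally_compact_space_compact_closed_compact[of "subtopology X U"] lc H by blast
    then show ?thesis
      using assms(4) by (meson compactin_subtopology openin_open_subtopology)
  qed
  obtain N L where NL: "openin X N" "compactin X L" "C \<subseteq> N" "N \<subseteq> L" "L \<subseteq> U"
    using nbhd[OF assms(3,5)] by blast
  obtain N' L' where NL': "openin X N'" "compactin X L'" "L \<subseteq> N'" "N' \<subseteq> L'" "L' \<subseteq> U"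
    using nbhd[OF NL(2,5)] by blast
  have "completely_regular_space X"
    using assms locally_compact_regular_imp_completely_regular_space by blast
  moreover have "closedin X (topspace X - N')" "disjnt L (topspace X - N')"
    using NL' by (auto simp: disjnt_def)
  ultimately obtain f where f: "continuous_map X (subtopology euclideanreal {0..1}) f"
      "f ` (topspace X - N') \<subseteq> {0}" "f ` L \<subseteq> {1}"
    using Urysohn_completely_regular_compact_closed[of 0 1 X L "topspace X - N'"] NL(2)
      Urysohn_completely_regular_closed_compact[of 0 1 X "topspace X - N'" L]
    by (metis disjnt_sym zero_le_one)
  define u where "u x = (if x \<in> topspace X then f x else 0)" for x
  have fc: "continuous_map X euclideanreal f" "\<And>x. x \<in> topspace X \<Longrightarrow> 0 \<le> f x \<and> f x \<le> 1"
    using f(1) by (auto simp: continuous_map_in_subtopology image_subset_iff Pi_iff)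
  have uc: "continuous_map X euclideanreal u"
    using fc(1) by (rule continuous_map_eq) (simp add: u_def)
  have u0: "\<And>x. x \<notin> L' \<Longrightarrow> u x = 0"
    using f(2) NL'(4) by (auto simp: u_def image_subset_iff)
  show ?thesis
  proof (rule that[of u N L'])
    show "compact_supp X u"
      unfolding compact_supp_def using uc u0 NL'(2) by blast
    show "\<And>x. 0 \<le> u x" "\<And>x. u x \<le> 1"
      using fc(2) by (auto simp: u_def)
    show "\<And>x. x \<in> N \<Longrightarrow> u x = 1"
      using f(3) NL openin_subset[OF NL(1)] by (auto simp: u_def)
  qed (use NL NL' u0 in auto)
qed

text \<open>Multiplying by a bump lets functions that are continuous only on a closed subset, such as a
  fibre, be treated as compactly supported functions on the whole space.\<close>

lemma Tietze_mult_real: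
  fixes e u :: "'a \<Rightarrow> real"
  assumes "locally_compact_space X" "Hausdorff_space X" "closedin X S"
    and e: "continuous_map (subtopology X S) euclideanreal e" and u: "compact_supp X u"
  obtains F where "compact_supp X F" "\<And>x. x \<in> S \<Longrightarrow> F x = e x * u x"
proof -
  obtain C where C: "continuous_map X euclidean u" "compactin X C" "\<And>x. x \<notin> C \<Longrightarrow> u x = 0"
    using u compact_suppE by blast
  have cr: "completely_regular_space X"
    using assms locally_compact_regular_imp_completely_regular_space by blast
  have "compactin X (S \<inter> C)"
    using closed_Int_compactin[OF assms(3) C(2)] .
  moreover have "continuous_map (subtopology X (S \<inter> C)) euclideanreal e"
    using e by (metis continuous_map_from_subtopology subtopology_subtopology)
  ultimately obtain g where g: "continuous_map X euclideanreal g" "\<And>x. x \<in> S \<inter> C \<Longrightarrow> g x = e x"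
    using Tietze_extension_completely_regular[of X "S \<inter> C" UNIV e] cr
    by (metis is_interval_univ subset_UNIV UNIV_not_empty)
  show ?thesis
  proof (rule that)
    show "compact_supp X (\<lambda>x. g x * u x)"
      using g(1) u by (rule compact_supp_mult_right)
    show "g x * u x = e x * u x" if "x \<in> S" for x
      using g(2) C(3) that by (cases "x \<in> C") auto
  qed
qed

lemma Tietze_mult_complex:
  fixes e u :: "'a \<Rightarrow> complex"
  assumes "locally_compact_space X" "Hausdorff_space X" "closedin X S"
    and e: "continuous_map (subtopology X S) euclidean e" and u: "compact_supp X u"
  obtains F where "compact_supp X F" "\<And>x. x \<in> S \<Longrightarrow> F x = e x * u x"
proof -
  obtain C where C: "continuous_map X euclidean u" "compactin X C" "\<And>x. x \<notin> C \<Longrightarrow> u x = 0"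
    using u compact_suppE by blast
  \<comment> \<open>The cutoff \<open>u\<close> is complex, so the real and imaginary parts of
    \<open>e\<close> are extended with a real cutoff \<open>v\<close> that is 1 on the support of
    \<open>u\<close>; the final factor \<open>u\<close> makes \<open>v\<close> disappear.\<close>
  obtain v :: "'a \<Rightarrow> real" and N where v: "compact_supp X v" "C \<subseteq> N" "\<And>x. x \<in> N \<Longrightarrow> v x = 1"
    using bump_function[OF assms(1,2) C(2) openin_topspace compactin_subset_topspace[OF C(2)]] by metis
  obtain F1 where F1: "compact_supp X F1" "\<And>x. x \<in> S \<Longrightarrow> F1 x = Re (e x) * v x"
    using Tietze_mult_real[OF assms(1-3) continuous_map_Re[OF e] v(1)] by blast
  obtain F2 where F2: "compact_supp X F2" "\<And>x. x \<in> S \<Longrightarrow> F2 x = Im (e x) * v x"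
    using Tietze_mult_real[OF assms(1-3) continuous_map_Im[OF e] v(1)] by blast
  show ?thesis
  proof (rule that)
    show "compact_supp X (\<lambda>x. (of_real (F1 x) + \<i> * of_real (F2 x)) * u x)"
      by (intro compact_supp_mult_right(2) compact_supp_mult_right(1) u compact_supp_continuous
          compact_supp_add compact_supp_of_real compact_supp_const_mult F1(1) F2(1))
    show "(of_real (F1 x) + \<i> * of_real (F2 x)) * u x = e x * u x" if "x \<in> S" for x
    proof (cases "x \<in> C")
      case True
      then have "v x = 1" using v by auto
      then show ?thesis using F1(2) F2(2) that complex_eq[of "e x"] by simp
    next
      case False
      then show ?thesis using C(3) by simp
    qed
  qed
qed

section \<open>Regular Borel measures\<close>

lemma sets_borel_of: "sets (borel_of X) = sigma_sets (topspace X) {U. openin X U}"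
  and space_borel_of: "space (borel_of X) = topspace X"
  unfolding borel_of_def by (auto dest: openin_subset intro!: sets_measure_of space_measure_of)

lemma openin_sets_borel_of: "openin X U \<Longrightarrow> U \<in> sets (borel_of X)"
  by (simp add: sets_borel_of)

lemma closedin_sets_borel_of:
  assumes "closedin X S"
  shows "S \<in> sets (borel_of X)"
proof -
  have "space (borel_of X) - (topspace X - S) \<in> sets (borel_of X)"
    using assms by (intro sets.compl_sets openin_sets_borel_of) (simp add: closedin_def)
  moreover have "space (borel_of X) - (topspace X - S) = S"
    using closedin_subset[OF assms] by (auto simp: space_borel_of)
  ultimately show ?thesis by simp
qed

lemma continuous_map_measurable:
  assumes "continuous_map X Y f"
  shows "f \<in> measurable (borel_of X) (borel_of Y)"
proof -
  have "f -` A \<inter> space (borel_of X) = {x \<in> topspace X. f x \<in> A}" for A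
    by (auto simp: space_borel_of)
  then show ?thesis
    using assms openin_continuous_map_preimage[OF assms]
    by (subst (2) borel_of_def, intro measurable_measure_of)
      (auto simp: space_borel_of continuous_map_def dest: openin_subset intro!: openin_sets_borel_of)
qed

lemma borel_of_euclidean: "borel_of euclidean = borel"
  by (simp add: borel_of_def borel_def)

lemma continuous_map_borel_measurable:
  "continuous_map X euclidean f \<Longrightarrow> f \<in> borel_measurable (borel_of X)"
  using continuous_map_measurable[of X euclidean f] by (simp add: borel_of_euclidean)

locale regular_measure =
  fixes X :: "'a topology" and M :: "'a measure"
  assumes lc: "locally_compact_space X" and Hausdorff: "Hausdorff_space X"
    and regular: "regular_borel_measure X M"
begin

lemma sets_eq: "sets M = sets (borel_of X)"
  using regular unfolding regular_borel_measure_def by blast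

lemma space_eq: "space M = topspace X"
  using sets_eq_imp_space_eq[OF sets_eq] by (simp add: space_borel_of)

lemma open_sets: "openin X U \<Longrightarrow> U \<in> sets M"
  by (simp add: sets_eq openin_sets_borel_of)

lemma closed_sets: "closedin X U \<Longrightarrow> U \<in> sets M"
  by (simp add: sets_eq closedin_sets_borel_of)

lemma compact_sets: "compactin X C \<Longrightarrow> C \<in> sets M"
  using closed_sets compactin_imp_closedin Hausdorff by blast

lemma compact_finite: "compactin X C \<Longrightarrow> emeasure M C < \<infinity>"
  using regular unfolding regular_borel_measure_def by blast

lemma outer_regular:
  "E \<in> sets M \<Longrightarrow> emeasure M E = (INF V \<in> {V. openin X V \<and> E \<subseteq> V}. emeasure M V)"
  using regular unfolding regular_borel_measure_def by blast

lemma inner_regular: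
  "openin X U \<Longrightarrow> emeasure M U = (SUP K \<in> {K. compactin X K \<and> K \<subseteq> U}. emeasure M K)"
  using regular unfolding regular_borel_measure_def by blast

lemma outer_approx:
  assumes "E \<in> sets M" "emeasure M E < \<infinity>" "0 < (e::real)"
  obtains V where "openin X V" "E \<subseteq> V" "emeasure M (V - E) \<le> ennreal e"
proof -
  have "emeasure M E < emeasure M E + ennreal e"
    using assms(2,3) ennreal_add_left_cancel_less[of "emeasure M E" 0 "ennreal e"] by simp
  then have "(INF V \<in> {V. openin X V \<and> E \<subseteq> V}. emeasure M V) < emeasure M E + ennreal e"
    using outer_regular[OF assms(1)] by metis
  then obtain V where V: "openin X V" "E \<subseteq> V" "emeasure M V < emeasure M E + ennreal e"
    unfolding INF_less_iff by blast
  have "emeasure M (V - E) = emeasure M V - emeasure M E"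
    using V assms open_sets by (intro emeasure_Diff) auto
  also have "\<dots> \<le> ennreal e"
    using less_imp_le[OF V(3)] assms(2) by (auto simp: ennreal_minus_le_iff add.commute)
  finally show ?thesis using that V by blast
qed

lemma inner_approx:
  assumes "openin X U" "emeasure M U < \<infinity>" "0 < (e::real)"
  obtains C where "compactin X C" "C \<subseteq> U" "emeasure M (U - C) \<le> ennreal e"
proof (cases "emeasure M U = 0")
  case True
  then show ?thesis using that[of "{}"] by simp
next
  case False
  have "emeasure M U - ennreal e < emeasure M U"
    using False assms by (intro ennreal_between) (auto simp: zero_less_iff_neq_zero)
  then have "emeasure M U - ennreal e < (SUP K \<in> {K. compactin X K \<and> K \<subseteq> U}. emeasure M K)"
    using inner_regular[OF assms(1)] by simp
  then obtain C where C: "compactin X C" "C \<subseteq> U" "emeasure M U - ennreal e < emeasure M C"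
    unfolding less_SUP_iff by blast
  have "emeasure M (U - C) = emeasure M U - emeasure M C"
    using C assms compact_sets open_sets compact_finite[OF C(1)] by (intro emeasure_Diff) auto
  also have "\<dots> \<le> ennreal e"
    using less_imp_le[OF C(3)] assms(2) by (auto simp: ennreal_minus_le_iff add.commute)
  finally show ?thesis using that C by blast
qed

lemma continuous_measurable: "continuous_map X euclidean f \<Longrightarrow> f \<in> borel_measurable M"
  using continuous_map_borel_measurable[of X f] measurable_cong_sets[OF sets_eq refl] by blast

lemma compact_supp_integrable:
  fixes f :: "'a \<Rightarrow> 'b::{banach, second_countable_topology}"
  assumes "compact_supp X f"
  shows "integrable M f"
proof -
  obtain C where C: "continuous_map X euclidean f" "compactin X C" "\<And>x. x \<notin> C \<Longrightarrow> f x = 0"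
    using assms compact_suppE by blast
  obtain B where B: "\<And>x. norm (f x) \<le> B"
    using assms compact_supp_bounded by blast
  show ?thesis
    using C B compact_sets compact_finite continuous_measurable[OF C(1)]
    by (intro integrableI_bounded_set[of C _ _ B]) auto
qed

lemma compact_supp_nn_integral:
  assumes "compact_supp X f" "\<And>x. 0 \<le> f x"
  shows "(\<integral>\<^sup>+x. ennreal (f x) \<partial>M) = ennreal (\<integral>x. f x \<partial>M)"
  using assms by (intro nn_integral_eq_integral compact_supp_integrable) auto

text \<open>Nonnegativity is asked only almost everywhere because an extension from a fibre has a
  controlled sign only on that fibre, which carries the measure.\<close>

lemma integral_pos_on_support:
  fixes f :: "'a \<Rightarrow> real"
  assumes f: "compact_supp X f" "AE y in M. 0 \<le> f y" and x: "x \<in> measure_support X M" "0 < f x"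
  shows "0 < (\<integral>y. f y \<partial>M)"
proof (rule ccontr)
  assume "\<not> 0 < (\<integral>y. f y \<partial>M)"
  moreover have "0 \<le> (\<integral>y. f y \<partial>M)"
    using f(2) by (rule integral_nonneg_AE)
  ultimately have "AE y in M. f y = 0"
    using integral_nonneg_eq_0_iff_AE[OF compact_supp_integrable[OF f(1)] f(2)] by linarith
  define U where "U = {y \<in> topspace X. f y \<in> {0<..}}"
  have "openin X U"
    unfolding U_def using compact_supp_continuous[OF f(1)]
    by (intro openin_continuous_map_preimage[of X euclidean]) auto
  moreover have "x \<in> U"
    using x unfolding U_def measure_support_def by auto
  ultimately have "0 < emeasure M U"
    using x(1) unfolding measure_support_def by blast
  moreover have "emeasure M U = 0"
    using \<open>AE y in M. f y = 0\<close> \<open>openin X U\<close> open_sets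
    by (subst AE_iff_measurable[symmetric, where P="\<lambda>y. y \<notin> U"]) (auto simp: U_def space_eq elim!: eventually_mono)
  ultimately show False by simp
qed

text \<open>The complement of \<open>S\<close> is a union of null open sets, possibly uncountable. A
  compact subset needs only finitely many of them, and inner regularity then makes the whole
  complement null.\<close>

lemma AE_in_support:
  assumes "measure_support X M \<subseteq> S" "closedin X S"
  shows "AE x in M. x \<in> S"
proof -
  have U: "openin X (topspace X - S)"
    using assms(2) by (simp add: closedin_def)
  have "emeasure M C = 0" if C: "compactin X C" "C \<subseteq> topspace X - S" for C
  proof -
    define \<U> where "\<U> = {V. openin X V \<and> emeasure M V = 0}"
    have "C \<subseteq> \<Union>\<U>"
    proof
      fix x assume "x \<in> C"
      then have "x \<in> topspace X" "x \<notin> measure_support X M"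
        using C assms by auto
      then show "x \<in> \<Union>\<U>"
        unfolding measure_support_def \<U>_def by (auto simp: zero_less_iff_neq_zero)
    qed
    then obtain \<F> where \<F>: "finite \<F>" "\<F> \<subseteq> \<U>" "C \<subseteq> \<Union>\<F>"
      using C(1) unfolding compactin_def \<U>_def by (metis (no_types, lifting) mem_Collect_eq)
    have "emeasure M (\<Union>V\<in>\<F>. V) \<le> (\<Sum>V\<in>\<F>. emeasure M V)"
      using \<F> by (intro emeasure_subadditive_finite) (auto simp: \<U>_def open_sets)
    also have "\<dots> = 0"
      using \<F> by (intro sum.neutral) (auto simp: \<U>_def)
    finally have "emeasure M (\<Union>\<F>) = 0" by simp
    moreover have "\<Union>\<F> \<in> sets M"
      using \<F> by (intro sets.finite_Union) (auto simp: \<U>_def open_sets)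
    ultimately show ?thesis
      using \<F>(3) emeasure_mono[of C "\<Union>\<F>" M] by simp
  qed
  then have "emeasure M (topspace X - S) = 0"
    by (subst inner_regular[OF U]) (simp add: SUP_eq_const bot_ennreal[symmetric] cong: SUP_cong)
  then show ?thesis
    using closed_sets[OF assms(2)] open_sets[OF U]
    by (subst AE_iff_measurable[of "topspace X - S"]) (auto simp: space_eq)
qed

lemma regular_measure_distr:
  assumes h: "homeomorphic_map X Y \<phi>"
  shows "regular_measure Y (distr M (borel_of Y) \<phi>)"
proof -
  obtain \<psi> where m: "homeomorphic_maps X Y \<phi> \<psi>"
    using h homeomorphic_map_maps by blast
  have c: "continuous_map X Y \<phi>" "continuous_map Y X \<psi>"
    and inv: "\<And>x. x \<in> topspace X \<Longrightarrow> \<psi> (\<phi> x) = x" "\<And>y. y \<in> topspace Y \<Longrightarrow> \<phi> (\<psi> y) = y"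
    using m unfolding homeomorphic_maps_def by auto
  have im: "\<And>x. x \<in> topspace X \<Longrightarrow> \<phi> x \<in> topspace Y" "\<And>y. y \<in> topspace Y \<Longrightarrow> \<psi> y \<in> topspace X"
    using c by (auto simp: continuous_map_def)
  define P where "P A = {x \<in> topspace X. \<phi> x \<in> A}" for A
  have meas: "\<phi> \<in> measurable M (borel_of Y)"
    using continuous_map_measurable[OF c(1)] measurable_cong_sets[OF sets_eq refl] by blast
  have e: "emeasure (distr M (borel_of Y) \<phi>) A = emeasure M (P A)" if "A \<in> sets (borel_of Y)" for A
    using that by (subst emeasure_distr[OF meas]) (auto simp: P_def space_eq intro!: arg_cong[of _ _ "emeasure M"])
  have comp: "compactin X (P C)" if "compactin Y C" for C
  proof -
    have "P C = \<psi> ` C"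
      using compactin_subset_topspace[OF that] inv im by (auto simp: P_def image_iff subset_iff) (metis inv(1))
    then show ?thesis using that c(2) image_compactin by metis
  qed
  have opn: "openin X (P V)" if "openin Y V" for V
    unfolding P_def using c(1) that openin_continuous_map_preimage by blast
  have pc: "compactin Y (\<phi> ` C)" "P (\<phi> ` C) = C" if "compactin X C" for C
  proof -
    show "compactin Y (\<phi> ` C)" using that c(1) image_compactin by blast
    show "P (\<phi> ` C) = C"
      using compactin_subset_topspace[OF that] inv(1) unfolding P_def
      by (auto simp: subset_iff) (metis inv(1))
  qed
  have po: "openin Y (\<phi> ` V)" "P (\<phi> ` V) = V" if "openin X V" for V
  proof -
    show "openin Y (\<phi> ` V)"
      using that h homeomorphic_map_openness_eq by blast
    show "P (\<phi> ` V) = V"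
      using openin_subset[OF that] inv(1) unfolding P_def
      by (auto simp: subset_iff) (metis inv(1))
  qed
  have lcY: "locally_compact_space Y" "Hausdorff_space Y"
    using lc Hausdorff h homeomorphic_locally_compact_space homeomorphic_Hausdorff_space
      homeomorphic_map_imp_homeomorphic_space by blast+
  have subs: "E \<subseteq> topspace Y" if "E \<in> sets (borel_of Y)" for E
    using sets.sets_into_space[OF that] by (simp add: space_borel_of)
  have csets: "C \<in> sets (borel_of Y)" if "compactin Y C" for C
    using that lcY compactin_imp_closedin closedin_sets_borel_of by blast
  have "regular_borel_measure Y (distr M (borel_of Y) \<phi>)"
    unfolding regular_borel_measure_def
  proof (intro conjI allI impI ballI)
    show "sets (distr M (borel_of Y) \<phi>) = sets (borel_of Y)" by simp
    show "emeasure (distr M (borel_of Y) \<phi>) C < \<infinity>" if "compactin Y C" for C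
      using e[OF csets[OF that]] compact_finite[OF comp[OF that]] by simp
    fix E assume E: "E \<in> sets (distr M (borel_of Y) \<phi>)"
    then have E': "E \<in> sets (borel_of Y)" by simp
    have "P E \<in> sets M"
      using measurable_sets[OF meas E'] by (simp add: P_def space_eq vimage_def Int_def conj_commute)
    then have "emeasure (distr M (borel_of Y) \<phi>) E = (INF V \<in> {V. openin X V \<and> P E \<subseteq> V}. emeasure M V)"
      using e[OF E'] outer_regular by simp
    also have "\<dots> = (INF V \<in> {V. openin Y V \<and> E \<subseteq> V}. emeasure (distr M (borel_of Y) \<phi>) V)"
    proof (rule INF_eq)
      fix V assume V: "V \<in> {V. openin Y V \<and> E \<subseteq> V}"
      then show "\<exists>W\<in>{V. openin X V \<and> P E \<subseteq> V}. emeasure M W \<le> emeasure (distr M (borel_of Y) \<phi>) V"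
        using opn[of V] e[of V] openin_sets_borel_of[of Y V] by (intro bexI[of _ "P V"]) (auto simp: P_def)
    next
      fix V assume V: "V \<in> {V. openin X V \<and> P E \<subseteq> V}"
      then have "E \<subseteq> \<phi> ` V"
        using subs[OF E'] inv im unfolding P_def by (auto simp: subset_iff image_iff) (metis)
      then show "\<exists>W\<in>{V. openin Y V \<and> E \<subseteq> V}. emeasure (distr M (borel_of Y) \<phi>) W \<le> emeasure M V"
        using V po[of V] e[of "\<phi> ` V"] openin_sets_borel_of[of Y "\<phi> ` V"] by (intro bexI[of _ "\<phi> ` V"]) auto
    qed
    finally show "emeasure (distr M (borel_of Y) \<phi>) E
      = (INF V \<in> {V. openin Y V \<and> E \<subseteq> V}. emeasure (distr M (borel_of Y) \<phi>) V)" .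
  next
    fix U assume U: "openin Y U"
    then have "emeasure (distr M (borel_of Y) \<phi>) U = (SUP K \<in> {K. compactin X K \<and> K \<subseteq> P U}. emeasure M K)"
      using e[of U] openin_sets_borel_of[of Y U] inner_regular[OF opn[OF U]] by simp
    also have "\<dots> = (SUP K \<in> {K. compactin Y K \<and> K \<subseteq> U}. emeasure (distr M (borel_of Y) \<phi>) K)"
    proof (rule SUP_eq)
      fix C assume C: "C \<in> {K. compactin Y K \<and> K \<subseteq> U}"
      then show "\<exists>D\<in>{K. compactin X K \<and> K \<subseteq> P U}. emeasure (distr M (borel_of Y) \<phi>) C \<le> emeasure M D"
        using comp[of C] e[of C] csets by (intro bexI[of _ "P C"]) (auto simp: P_def)
    next
      fix C assume C: "C \<in> {K. compactin X K \<and> K \<subseteq> P U}"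
      then show "\<exists>D\<in>{K. compactin Y K \<and> K \<subseteq> U}. emeasure M C \<le> emeasure (distr M (borel_of Y) \<phi>) D"
        using pc[of C] e[of "\<phi> ` C"] csets by (intro bexI[of _ "\<phi> ` C"]) (auto simp: P_def)
    qed
    finally show "emeasure (distr M (borel_of Y) \<phi>) U
      = (SUP K \<in> {K. compactin Y K \<and> K \<subseteq> U}. emeasure (distr M (borel_of Y) \<phi>) K)" .
  qed
  then show ?thesis
    using lcY by unfold_locales
qed

end

text \<open>A continuous density \<open>D\<close> need not be integrable and the measures need not be \<open>\<sigma>\<close>-finite.
  On the open sets \<open>{1/n < D < n}\<close> the two measures are comparable, so regularity passes
  from one to the other; these sets increase to the whole space.\<close>

theorem regular_eq_density:
  assumes M: "regular_measure X M" and N: "regular_measure X N"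
    and D: "continuous_map X euclideanreal D" "\<And>x. x \<in> topspace X \<Longrightarrow> 0 < D x"
    and eq: "\<And>F. compact_supp X F \<Longrightarrow> (\<And>x. 0 \<le> F x) \<Longrightarrow>
      (\<integral>\<^sup>+x. ennreal (F x) \<partial>N) = (\<integral>\<^sup>+x. ennreal (D x * F x) \<partial>M)"
    and E: "E \<in> sets (borel_of X)"
  shows "emeasure N E = (\<integral>\<^sup>+x \<in> E. ennreal (D x) \<partial>M)"
proof -
  interpret M: regular_measure X M by fact
  interpret N: regular_measure X N by fact
  have sets_eq: "sets N = sets M"
    using M.sets_eq N.sets_eq by simp
  have Dm: "(\<lambda>x. ennreal (D x)) \<in> borel_measurable M"
    using M.continuous_measurable[OF D(1)] by simp
  define R where "R = density M (\<lambda>x. ennreal (D x))"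
  have setsR: "sets R = sets M"
    by (simp add: R_def)
  have R: "emeasure R A = (\<integral>\<^sup>+x \<in> A. ennreal (D x) \<partial>M)" if "A \<in> sets M" for A
    using that Dm by (simp add: R_def emeasure_density)
  \<comment> \<open>A bump between \<open>C\<close> and \<open>U\<close> turns the equality of
    integrals into an exchange of the two measures, at the cost of passing from a compact set to a
    larger open one.\<close>
  have comp: "emeasure N C \<le> emeasure R U" "emeasure R C \<le> emeasure N U"
    if C: "compactin X C" "openin X U" "C \<subseteq> U" for C U
  proof -
    obtain u :: "'a \<Rightarrow> real" and O1 L where u: "compact_supp X u" "\<And>x. 0 \<le> u x" "\<And>x. u x \<le> 1"
        "C \<subseteq> O1" "\<And>x. x \<in> O1 \<Longrightarrow> u x = 1" "L \<subseteq> U" "\<And>x. x \<notin> L \<Longrightarrow> u x = 0"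
      using bump_function[OF M.lc M.Hausdorff C] by metis
    have u1: "indicator C x \<le> ennreal (u x)" "ennreal (u x) \<le> indicator U x" for x
    proof -
      have "x \<in> C \<Longrightarrow> u x = 1" "x \<notin> U \<Longrightarrow> u x = 0"
        using u by blast+
      then show "indicator C x \<le> ennreal (u x)" "ennreal (u x) \<le> indicator U x"
        using u(3)[of x] by (auto simp: indicator_def)
    qed
    have Du: "ennreal (D x) * indicator C x \<le> ennreal (D x * u x)"
      "ennreal (D x * u x) \<le> ennreal (D x) * indicator U x" if "x \<in> space M" for x
    proof -
      have "ennreal (D x * u x) = ennreal (D x) * ennreal (u x)"
        using D(2)[of x] that u(2)[of x] by (simp add: M.space_eq ennreal_mult)
      then show "ennreal (D x) * indicator C x \<le> ennreal (D x * u x)"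
          "ennreal (D x * u x) \<le> ennreal (D x) * indicator U x"
        using u1[of x] by (auto intro: mult_left_mono)
    qed
    have "emeasure N C = (\<integral>\<^sup>+x. indicator C x \<partial>N)"
      using N.compact_sets[OF C(1)] by simp
    also have "\<dots> \<le> (\<integral>\<^sup>+x. ennreal (u x) \<partial>N)"
      using u1 by (intro nn_integral_mono)
    also have "\<dots> = (\<integral>\<^sup>+x. ennreal (D x * u x) \<partial>M)"
      using eq u by blast
    also have "\<dots> \<le> (\<integral>\<^sup>+x. ennreal (D x) * indicator U x \<partial>M)"
      using Du by (intro nn_integral_mono)
    also have "\<dots> = emeasure R U"
      using R[OF M.open_sets[OF C(2)]] by simp
    finally show "emeasure N C \<le> emeasure R U" .
    have "emeasure R C = (\<integral>\<^sup>+x. ennreal (D x) * indicator C x \<partial>M)"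
      using R[OF M.compact_sets[OF C(1)]] by simp
    also have "\<dots> \<le> (\<integral>\<^sup>+x. ennreal (D x * u x) \<partial>M)"
      using Du by (intro nn_integral_mono)
    also have "\<dots> = (\<integral>\<^sup>+x. ennreal (u x) \<partial>N)"
      using eq u by simp
    also have "\<dots> \<le> (\<integral>\<^sup>+x. indicator U x \<partial>N)"
      using u1 by (intro nn_integral_mono)
    also have "\<dots> = emeasure N U"
      using N.open_sets[OF C(2)] by simp
    finally show "emeasure R C \<le> emeasure N U" .
  qed
  define V where "V n = {x \<in> topspace X. D x \<in> {1 / (real n + 1) <..< real n + 1}}" for n :: nat
  have V_open: "openin X (V n)" for n
    unfolding V_def by (intro openin_continuous_map_preimage[OF D(1)]) auto
  have V_sets: "V n \<in> sets M" for n
    using M.open_sets V_open by blast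
  have R_upper: "emeasure R A \<le> ennreal (real n + 1) * emeasure M A"
    if A: "A \<in> sets M" "A \<subseteq> V n" for A n
  proof -
    have "(\<integral>\<^sup>+x \<in> A. ennreal (D x) \<partial>M) \<le> (\<integral>\<^sup>+x. ennreal (real n + 1) * indicator A x \<partial>M)"
      using A(2) by (intro nn_integral_mono) (auto simp: indicator_def V_def simp del: ennreal_plus intro!: ennreal_leI)
    then show ?thesis
      using A by (simp add: R nn_integral_cmult_indicator)
  qed
  have R_lower: "ennreal (1 / (real n + 1)) * emeasure M A \<le> emeasure R A"
    if A: "A \<in> sets M" "A \<subseteq> V n" for A n
  proof -
    have "(\<integral>\<^sup>+x. ennreal (1 / (real n + 1)) * indicator A x \<partial>M) \<le> (\<integral>\<^sup>+x \<in> A. ennreal (D x) \<partial>M)"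
      using A(2) by (intro nn_integral_mono) (auto simp: indicator_def V_def simp del: ennreal_plus intro!: ennreal_leI)
    then show ?thesis
      using A by (simp add: R nn_integral_cmult_indicator)
  qed
  have small: "emeasure R A \<le> ennreal e"
    if A: "A \<in> sets M" "A \<subseteq> V n" "emeasure M A \<le> ennreal (e / (real n + 1))" "0 < e" for A n e
  proof -
    have "emeasure R A \<le> ennreal (real n + 1) * ennreal (e / (real n + 1))"
      using R_upper[OF A(1,2)] A(3) by (meson mult_left_mono order_trans zero_le)
    also have "\<dots> = ennreal ((real n + 1) * (e / (real n + 1)))"
      using A(4) by (intro ennreal_mult[symmetric]) auto
    also have "(real n + 1) * (e / (real n + 1)) = e"
      by (simp add: add_pos_nonneg field_simps)
    finally show ?thesis .
  qed
  \<comment> \<open>This direction needs only inner regularity of \<open>N\<close>. For the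
    converse, \<open>R\<close> has to be approximated from inside by compact sets, which is
    inherited from \<open>M\<close> only within some \<open>V n\<close>.\<close>
  have NR_open: "emeasure N U \<le> emeasure R U" if U: "openin X U" for U
    using comp(1)[OF _ U] by (subst N.inner_regular[OF U]) (auto intro: SUP_least)
  have open_eq: "emeasure N U = emeasure R U" if U: "openin X U" "U \<subseteq> V n" for U n
  proof (rule antisym[OF NR_open[OF U(1)]])
    have Um: "U \<in> sets M" using M.open_sets U by blast
    show "emeasure R U \<le> emeasure N U"
    proof (cases "emeasure M U < \<infinity>")
      case True
      show ?thesis
      proof (rule ennreal_le_epsilon)
        fix e :: real assume e: "0 < e"
        then obtain C where C: "compactin X C" "C \<subseteq> U" "emeasure M (U - C) \<le> ennreal (e / (real n + 1))"
          using M.inner_approx[OF U(1) True, of "e / (real n + 1)"]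
          by (metis divide_pos_pos add_nonneg_pos of_nat_0_le_iff zero_less_one)
        have Cm: "C \<in> sets M" using M.compact_sets C by blast
        have "emeasure R U = emeasure R C + emeasure R (U - C)"
          using Cm Um C(2) setsR by (metis plus_emeasure Diff_disjoint Un_Diff_cancel sets.Diff sup.absorb2)
        also have "\<dots> \<le> emeasure N U + ennreal e"
          using comp(2)[OF C(1) U(1) C(2)] small[of "U - C" n e] C(3) Um Cm U(2) e by (intro add_mono) auto
        finally show "emeasure R U \<le> emeasure N U + ennreal e" .
      qed
    next
      case False
      \<comment> \<open>When \<open>M\<close> is infinite on \<open>U\<close>, no compact subset
        leaves a small remainder; the lower bound on \<open>D\<close> in \<open>V n\<close> instead
        forces \<open>N\<close> to be infinite on \<open>U\<close>.\<close>
      have "ennreal (1 / (real n + 1)) * emeasure M U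
        = (SUP C \<in> {C. compactin X C \<and> C \<subseteq> U}. ennreal (1 / (real n + 1)) * emeasure M C)"
        by (subst M.inner_regular[OF U(1)]) (simp add: SUP_mult_left_ennreal)
      also have "\<dots> \<le> emeasure N U"
      proof (rule SUP_least)
        fix C assume C: "C \<in> {C. compactin X C \<and> C \<subseteq> U}"
        then have "ennreal (1 / (real n + 1)) * emeasure M C \<le> emeasure R C"
          using R_lower[of C n] M.compact_sets U(2) by blast
        also have "\<dots> \<le> emeasure N U"
          using comp(2)[OF _ U(1)] C by blast
        finally show "ennreal (1 / (real n + 1)) * emeasure M C \<le> emeasure N U" .
      qed
      finally have "emeasure N U = \<infinity>"
        using False by (auto simp: ennreal_mult_top top_unique not_less)
      then show ?thesis by simp
    qed
  qed
  have V_eq: "emeasure N A = emeasure R A" if A: "A \<in> sets M" "A \<subseteq> V n" for A n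
  proof (rule antisym)
    have An: "A \<in> sets N" using A sets_eq by simp
    show "emeasure R A \<le> emeasure N A"
      unfolding N.outer_regular[OF An]
    proof (rule INF_greatest)
      fix W assume W: "W \<in> {V. openin X V \<and> A \<subseteq> V}"
      then have o: "openin X (W \<inter> V n)" using V_open by blast
      have "emeasure R A \<le> emeasure R (W \<inter> V n)"
        using W A setsR M.open_sets[OF o] by (intro emeasure_mono) auto
      also have "\<dots> = emeasure N (W \<inter> V n)"
        using open_eq[OF o, of n] by simp
      also have "\<dots> \<le> emeasure N W"
        using W N.open_sets by (intro emeasure_mono) auto
      finally show "emeasure R A \<le> emeasure N W" .
    qed
    show "emeasure N A \<le> emeasure R A"
    proof (cases "emeasure M A < \<infinity>")
      case True
      show ?thesis
      proof (rule ennreal_le_epsilon)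
        fix e :: real assume e: "0 < e"
        then obtain W where W: "openin X W" "A \<subseteq> W" "emeasure M (W - A) \<le> ennreal (e / (real n + 1))"
          using M.outer_approx[OF A(1) True, of "e / (real n + 1)"]
          by (metis divide_pos_pos add_nonneg_pos of_nat_0_le_iff zero_less_one)
        \<comment> \<open>Cutting \<open>W\<close> down to \<open>V n\<close> keeps the bound on
          \<open>D\<close>, hence the smallness of the \<open>R\<close>-mass of
          \<open>U - A\<close>.\<close>
        define U where "U = W \<inter> V n"
        have U: "openin X U" "U \<subseteq> V n" "A \<subseteq> U" "U \<in> sets M"
          using W V_open A M.open_sets by (auto simp: U_def)
        have "emeasure M (U - A) \<le> ennreal (e / (real n + 1))"
          using W(3) M.open_sets[OF W(1)] A(1)
          by (intro order_trans[OF emeasure_mono W(3)]) (auto simp: U_def)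
        then have s: "emeasure R (U - A) \<le> ennreal e"
          using small[of "U - A" n e] U A e by blast
        have "emeasure N A \<le> emeasure N U"
          using U sets_eq by (intro emeasure_mono) auto
        also have "\<dots> = emeasure R U" using open_eq U by blast
        also have "\<dots> = emeasure R A + emeasure R (U - A)"
          using A(1) U setsR by (metis plus_emeasure Diff_disjoint Un_Diff_cancel sets.Diff sup.absorb2)
        also have "\<dots> \<le> emeasure R A + ennreal e"
          using s by (intro add_left_mono)
        finally show "emeasure N A \<le> emeasure R A + ennreal e" .
      qed
    next
      case False
      then have "emeasure R A = \<infinity>"
        using R_lower[OF A] by (auto simp: ennreal_mult_top top_unique not_less)
      then show ?thesis by simp
    qed
  qed
  have Em: "E \<in> sets M" using E M.sets_eq by simp
  have inc: "incseq (\<lambda>n. E \<inter> V n)"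
  proof (rule incseq_SucI)
    fix n
    have "1 / (real (Suc n) + 1) \<le> 1 / (real n + 1)"
      by (intro divide_left_mono) auto
    then show "E \<inter> V n \<subseteq> E \<inter> V (Suc n)"
      by (auto simp: V_def)
  qed
  have un: "(\<Union>n. E \<inter> V n) = E"
  proof -
    have "\<exists>n. x \<in> V n" if x: "x \<in> topspace X" for x
    proof -
      obtain n where n: "max (D x) (1 / D x) < real n"
        using reals_Archimedean2 by blast
      have "1 < D x * real n"
        using n D(2)[OF x] by (simp add: field_simps)
      also have "\<dots> \<le> D x * (real n + 1)"
        using D(2)[OF x] by (intro mult_left_mono) auto
      finally have "1 / (real n + 1) < D x"
        by (simp add: field_simps)
      then show ?thesis
        using x n by (intro exI[of _ n]) (auto simp: V_def)
    qed
    moreover have "E \<subseteq> topspace X"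
      using sets.sets_into_space[OF Em] by (simp add: M.space_eq)
    ultimately show ?thesis
      by fastforce
  qed
  have EV: "range (\<lambda>n. E \<inter> V n) \<subseteq> sets M"
    using Em V_sets by auto
  have "emeasure N E = (SUP n. emeasure N (E \<inter> V n))"
    using SUP_emeasure_incseq[of "\<lambda>n. E \<inter> V n" N] inc un EV sets_eq by simp
  also have "\<dots> = (SUP n. emeasure R (E \<inter> V n))"
    using V_eq[of "E \<inter> V n" n for n] Em V_sets by simp
  also have "\<dots> = emeasure R E"
    using SUP_emeasure_incseq[of "\<lambda>n. E \<inter> V n" R] inc un EV setsR by simp
  also have "\<dots> = (\<integral>\<^sup>+x \<in> E. ennreal (D x) \<partial>M)"
    using R[OF Em] .
  finally show ?thesis .
qed

corollary regular_measure_eqI: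
  assumes M: "regular_measure X M" and N: "regular_measure X N"
    and eq: "\<And>F. compact_supp X F \<Longrightarrow> (\<And>x. 0 \<le> F x) \<Longrightarrow>
      (\<integral>\<^sup>+x. ennreal (F x) \<partial>N) = (\<integral>\<^sup>+x. ennreal (F x) \<partial>M)"
  shows "N = M"
proof (rule measure_eqI)
  interpret M: regular_measure X M by fact
  interpret N: regular_measure X N by fact
  show "sets N = sets M" using M.sets_eq N.sets_eq by simp
  fix E assume "E \<in> sets N"
  then have E: "E \<in> sets (borel_of X)" using N.sets_eq by simp
  have "emeasure N E = (\<integral>\<^sup>+x \<in> E. ennreal 1 \<partial>M)"
    using regular_eq_density[OF M N _ _ _ E, of "\<lambda>_. 1"] eq by simp
  also have "\<dots> = emeasure M E"
    using E M.sets_eq by simp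
  finally show "emeasure N E = emeasure M E" .
qed

section \<open>Isometries for the \<open>L\<^sup>1\<close>-norm are weighted composition operators\<close>

lemma (in regular_measure) vanishes_if_integral_zero:
  fixes f :: "'a \<Rightarrow> real"
  assumes "fully_supported X M" "compact_supp X f" "\<And>x. 0 \<le> f x" "(\<integral>x. f x \<partial>M) = 0"
  shows "f x = 0"
proof (rule ccontr)
  assume "f x \<noteq> 0"
  then have "x \<in> measure_support X M" "0 < f x"
    using assms compact_supp_outside[OF assms(2)] unfolding fully_supported_def
    by (metis, metis less_eq_real_def)
  then have "0 < (\<integral>x. f x \<partial>M)"
    using assms(2,3) by (intro integral_pos_on_support) auto
  then show False using assms(4) by simp
qed

text \<open>By the parallelogram law the squares of the two left sides add up to 2|a|^2 + 2|b|^2,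
  whereas the hypotheses make this sum 2(|a| + |b|)^2. With one sign alone, \<open>a\<close> and
  \<open>b\<close> could be nonzero real multiples of each other.\<close>

lemma cmod_add_diff_imp_zero:
  assumes "cmod (a + b) = cmod a + cmod b" "cmod (a - b) = cmod a + cmod b"
  shows "a * b = 0"
proof -
  have "(cmod (a + b))\<^sup>2 + (cmod (a - b))\<^sup>2 = 2 * (cmod a)\<^sup>2 + 2 * (cmod b)\<^sup>2"
    unfolding cmod_power2 by (simp add: power2_eq_square algebra_simps)
  then have "cmod a * cmod b = 0"
    unfolding assms by (simp add: power2_eq_square algebra_simps)
  then show ?thesis by simp
qed

abbreviation csupp :: "'a topology \<Rightarrow> ('a \<Rightarrow> complex) \<Rightarrow> 'a set" where
  "csupp X f \<equiv> X closure_of {x \<in> topspace X. f x \<noteq> 0}"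

lemma csupp_subset:
  assumes "Hausdorff_space X" "compactin X L" "\<And>x. x \<notin> L \<Longrightarrow> f x = 0"
  shows "csupp X f \<subseteq> L"
  using assms compactin_imp_closedin by (intro closure_of_minimal) auto

lemma not_in_csupp:
  assumes "openin X U" "x \<in> U" "\<And>y. y \<in> U \<Longrightarrow> f y = 0"
  shows "x \<notin> csupp X f"
  using assms by (auto simp: in_closure_of)

lemma not_in_csuppE:
  assumes "x \<in> topspace X" "x \<notin> csupp X f"
  obtains U where "openin X U" "x \<in> U" "\<And>y. y \<in> U \<Longrightarrow> f y = 0"
proof -
  obtain U where "openin X U" "x \<in> U" "\<And>y. y \<in> U \<Longrightarrow> \<not> (y \<in> topspace X \<and> f y \<noteq> 0)"
    using assms by (auto simp: in_closure_of)
  then show ?thesis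
    using that openin_subset by blast
qed

locale scalar_field =
  fixes K :: "complex set"
  assumes K: "K = \<real> \<or> K = UNIV"
begin

lemma K_closed:
  "of_real r \<in> K" "0 \<in> K" "1 \<in> K" "-1 \<in> K"
  "a \<in> K \<Longrightarrow> b \<in> K \<Longrightarrow> a + b \<in> K" "a \<in> K \<Longrightarrow> b \<in> K \<Longrightarrow> a - b \<in> K"
  "a \<in> K \<Longrightarrow> b \<in> K \<Longrightarrow> a * b \<in> K" "a \<in> K \<Longrightarrow> - a \<in> K"
  using K by auto

lemma Cc_ops:
  assumes "Hausdorff_space X"
  shows "f \<in> Cc K X \<Longrightarrow> g \<in> Cc K X \<Longrightarrow> (\<lambda>x. f x + g x) \<in> Cc K X"
    and "f \<in> Cc K X \<Longrightarrow> g \<in> Cc K X \<Longrightarrow> (\<lambda>x. f x - g x) \<in> Cc K X"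
    and "c \<in> K \<Longrightarrow> f \<in> Cc K X \<Longrightarrow> (\<lambda>x. c * f x) \<in> Cc K X"
    and "f \<in> Cc K X \<Longrightarrow> g \<in> Cc K X \<Longrightarrow> (\<lambda>x. f x * g x) \<in> Cc K X"
    and "compact_supp X u \<Longrightarrow> (\<lambda>x. complex_of_real (u x)) \<in> Cc K X"
  using K_closed unfolding Cc_iff_compact_supp[OF assms]
  by (auto simp: image_subset_iff intro: compact_supp_add compact_supp_diff compact_supp_const_mult
      compact_supp_of_real compact_supp_mult_right compact_supp_continuous)

end

text \<open>The inverse \<open>S\<close> is a parameter so that the locale is symmetric:
  \<open>inverse\<close> instantiates it with the roles of \<open>T\<close> and \<open>S\<close>
  exchanged, and every result about \<open>T\<close> becomes one about \<open>S\<close>.\<close>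

locale L1_isometry = scalar_field K + X: regular_measure X M + Y: regular_measure Y N
  for K :: "complex set" and X :: "'a topology" and M and Y :: "'b topology" and N +
  fixes T :: "('a \<Rightarrow> complex) \<Rightarrow> 'b \<Rightarrow> complex" and S :: "('b \<Rightarrow> complex) \<Rightarrow> 'a \<Rightarrow> complex"
  assumes full: "fully_supported X M" "fully_supported Y N"
    and T_in: "f \<in> Cc K X \<Longrightarrow> T f \<in> Cc K Y" and S_in: "k \<in> Cc K Y \<Longrightarrow> S k \<in> Cc K X"
    and ST: "f \<in> Cc K X \<Longrightarrow> S (T f) = f" and TS: "k \<in> Cc K Y \<Longrightarrow> T (S k) = k"
    and T_add: "\<lbrakk>f \<in> Cc K X; g \<in> Cc K X\<rbrakk> \<Longrightarrow> T (\<lambda>x. f x + g x) = (\<lambda>y. T f y + T g y)"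
    and T_scale: "\<lbrakk>c \<in> K; f \<in> Cc K X\<rbrakk> \<Longrightarrow> T (\<lambda>x. c * f x) = (\<lambda>y. c * T f y)"
    and T_norm: "f \<in> Cc K X \<Longrightarrow> L1_norm N (T f) = L1_norm M f"
begin

lemmas CcX = Cc_ops[OF X.Hausdorff] and CcY = Cc_ops[OF Y.Hausdorff]

lemma T_diff:
  assumes "f \<in> Cc K X" "g \<in> Cc K X"
  shows "T (\<lambda>x. f x - g x) = (\<lambda>y. T f y - T g y)"
  using T_add[OF assms(1) CcX(3)[OF K_closed(4) assms(2)]] T_scale[OF K_closed(4) assms(2)] by simp

lemma inverse: "L1_isometry K Y N X M S T"
proof unfold_locales
  show "S (\<lambda>x. f x + g x) = (\<lambda>y. S f y + S g y)" if "f \<in> Cc K Y" "g \<in> Cc K Y" for f g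
    using that ST[OF CcX(1)[OF S_in S_in], of f g] T_add[OF S_in S_in, of f g] TS by metis
  show "S (\<lambda>x. c * f x) = (\<lambda>y. c * S f y)" if "c \<in> K" "f \<in> Cc K Y" for c f
    using that ST[OF CcX(3)[OF _ S_in], of c f] T_scale[OF _ S_in, of c f] TS by metis
  show "L1_norm M (S f) = L1_norm N f" if "f \<in> Cc K Y" for f
    using that T_norm[OF S_in] TS by metis
qed (use full T_in S_in TS ST in auto)

lemma disjoint:
  assumes f: "f \<in> Cc K X" and g: "g \<in> Cc K X" and fg: "\<And>x. f x * g x = 0"
  shows "T f y * T g y = 0"
proof -
  have cs: "compact_supp X f" "compact_supp X g" "compact_supp Y (T f)" "compact_supp Y (T g)"
    using f g T_in Cc_iff_compact_supp X.Hausdorff Y.Hausdorff by blast+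
  have iX: "integrable M (\<lambda>x. cmod (f x))" "integrable M (\<lambda>x. cmod (g x))"
    by (intro X.compact_supp_integrable compact_supp_norm cs)+
  have iY: "integrable N (\<lambda>x. cmod (T f x))" "integrable N (\<lambda>x. cmod (T g x))"
    "integrable N (\<lambda>x. cmod (T f x + T g x))" "integrable N (\<lambda>x. cmod (T f x - T g x))"
    by (intro Y.compact_supp_integrable compact_supp_norm compact_supp_add compact_supp_diff cs)+
  have pw: "cmod (f x + g x) = cmod (f x) + cmod (g x)" "cmod (f x - g x) = cmod (f x) + cmod (g x)" for x
    using fg[of x] by auto
  have "(\<integral>y. cmod (T f y + T g y) \<partial>N) = (\<integral>x. cmod (f x + g x) \<partial>M)"
    using T_norm[OF CcX(1)[OF f g]] T_add[OF f g] by (simp add: L1_norm_def)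
  also have "\<dots> = (\<integral>y. cmod (T f y) \<partial>N) + (\<integral>y. cmod (T g y) \<partial>N)"
    using T_norm[OF f] T_norm[OF g] iX by (simp add: L1_norm_def pw)
  finally have "(\<integral>y. cmod (T f y) + cmod (T g y) - cmod (T f y + T g y) \<partial>N) = 0"
    using iY by simp
  \<comment> \<open>The integrand is nonnegative by the triangle inequality, continuous and of
    integral zero, so full support makes it vanish at every point.\<close>
  then have sum: "cmod (T f y) + cmod (T g y) - cmod (T f y + T g y) = 0"
    by (rule Y.vanishes_if_integral_zero[OF full(2), rotated 2])
      (auto intro!: compact_supp_diff compact_supp_add compact_supp_norm cs norm_triangle_ineq)
  have "(\<integral>y. cmod (T f y - T g y) \<partial>N) = (\<integral>x. cmod (f x - g x) \<partial>M)"
    using T_norm[OF CcX(2)[OF f g]] T_diff[OF f g] by (simp add: L1_norm_def)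
  also have "\<dots> = (\<integral>y. cmod (T f y) \<partial>N) + (\<integral>y. cmod (T g y) \<partial>N)"
    using T_norm[OF f] T_norm[OF g] iX by (simp add: L1_norm_def pw)
  finally have "(\<integral>y. cmod (T f y) + cmod (T g y) - cmod (T f y - T g y) \<partial>N) = 0"
    using iY by simp
  then have "cmod (T f y) + cmod (T g y) - cmod (T f y - T g y) = 0"
    by (rule Y.vanishes_if_integral_zero[OF full(2), rotated 2])
      (auto intro!: compact_supp_diff compact_supp_add compact_supp_norm cs norm_triangle_ineq4)
  then show ?thesis
    using sum by (intro cmod_add_diff_imp_zero) auto
qed

lemma bumpX:
  assumes "openin X U" "x \<in> U"
  obtains g O1 L where "g \<in> Cc K X" "\<And>y. cmod (g y) \<le> 1" "openin X O1" "x \<in> O1" "\<And>y. y \<in> O1 \<Longrightarrow> g y = 1"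
    "compactin X L" "L \<subseteq> U" "\<And>y. y \<notin> L \<Longrightarrow> g y = 0"
proof -
  have x: "compactin X {x}" "{x} \<subseteq> U"
    using assms openin_subset by fastforce+
  obtain u :: "'a \<Rightarrow> real" and O1 L where u: "compact_supp X u" "\<And>y. 0 \<le> u y" "\<And>y. u y \<le> 1"
    "openin X O1" "{x} \<subseteq> O1" "\<And>y. y \<in> O1 \<Longrightarrow> u y = 1"
    "compactin X L" "L \<subseteq> U" "\<And>y. y \<notin> L \<Longrightarrow> u y = 0"
    using bump_function[OF X.lc X.Hausdorff x(1) assms(1) x(2)] by metis
  show ?thesis
    using u by (intro that[of "\<lambda>x. of_real (u x)" O1 L] CcX(5)) auto
qed

text \<open>A bump \<open>g\<close> at a point outside the support of \<open>a\<close> is disjoint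
  from \<open>a\<close>, hence \<open>T g\<close> is disjoint from \<open>T a\<close> and so from
  \<open>T b\<close>. Applying \<open>S\<close> would give \<open>g x * b x = 0\<close>, although
  both factors are nonzero.\<close>

lemma T_nonzero_subset:
  assumes a: "a \<in> Cc K X" and b: "b \<in> Cc K X" and ab: "\<And>y. T a y = 0 \<Longrightarrow> T b y = 0" and x: "b x \<noteq> 0"
  shows "x \<in> csupp X a"
proof (rule ccontr)
  interpret inv: L1_isometry K Y N X M S T by (rule inverse)
  assume "x \<notin> csupp X a"
  moreover have "x \<in> topspace X"
    using x b compact_supp_outside Cc_iff_compact_supp X.Hausdorff by metis
  ultimately obtain U where U: "openin X U" "x \<in> U" "\<And>y. y \<in> U \<Longrightarrow> a y = 0"
    using not_in_csuppE by metis
  obtain g O1 L where g: "g \<in> Cc K X" "x \<in> O1" "\<And>y. y \<in> O1 \<Longrightarrow> g y = 1" "L \<subseteq> U" "\<And>y. y \<notin> L \<Longrightarrow> g y = 0"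
    using bumpX[OF U(1,2)] by metis
  have "g y * a y = 0" for y
    using g U by (cases "y \<in> L") auto
  then have "T g y * T a y = 0" for y
    using disjoint g a by blast
  then have "T g y * T b y = 0" for y
    using ab by (metis mult_eq_0_iff)
  then have "S (T g) x * S (T b) x = 0"
    using inv.disjoint T_in g b by blast
  then show False
    using ST g b x by simp
qed

text \<open>Finitely many of these supports always meet: the corresponding images are multiplied
  pointwise on the \<open>Y\<close> side and pulled back by \<open>S\<close>, and
  \<open>T_nonzero_subset\<close> places the result inside each support. Compactness of one support
  then yields a point common to all.\<close>

lemma phi_exists:
  assumes h: "h \<in> topspace Y"
  shows "\<exists>x \<in> topspace X. \<forall>a \<in> Cc K X. T a h \<noteq> 0 \<longrightarrow> x \<in> csupp X a"
proof -
  interpret inv: L1_isometry K Y N X M S T by (rule inverse)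
  define A where "A = {a \<in> Cc K X. T a h \<noteq> 0}"
  obtain b where b: "b \<in> Cc K Y" "b h = 1"
    using inv.bumpX[OF openin_topspace h] by metis
  then have a0: "S b \<in> A"
    unfolding A_def using S_in TS by simp
  have dir: "\<exists>c \<in> A. \<forall>a \<in> \<F>. {x. c x \<noteq> 0} \<subseteq> csupp X a" if "finite \<F>" "\<F> \<subseteq> A" for \<F>
  proof -
    have "\<exists>c \<in> A. \<forall>a \<in> \<F>. \<forall>y. T a y = 0 \<longrightarrow> T c y = 0"
      using that
    proof (induction rule: finite_induct)
      case empty
      then show ?case using a0 by auto
    next
      case (insert a \<F>)
      then obtain c where c: "c \<in> A" "\<forall>a \<in> \<F>. \<forall>y. T a y = 0 \<longrightarrow> T c y = 0"
        by auto
      have m: "(\<lambda>y. T a y * T c y) \<in> Cc K Y"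
        using insert c CcY(4) T_in unfolding A_def by auto
      have "S (\<lambda>y. T a y * T c y) \<in> A"
        using m S_in TS insert c unfolding A_def by auto
      moreover have "T (S (\<lambda>y. T a y * T c y)) = (\<lambda>y. T a y * T c y)"
        using m TS by blast
      ultimately show ?case
        using c by (intro bexI[of _ "S (\<lambda>y. T a y * T c y)"]) auto
    qed
    then obtain c where c: "c \<in> A" "\<forall>a \<in> \<F>. \<forall>y. T a y = 0 \<longrightarrow> T c y = 0"
      by blast
    then have "\<forall>a \<in> \<F>. {x. c x \<noteq> 0} \<subseteq> csupp X a"
      using that T_nonzero_subset[of _ c] unfolding A_def by blast
    then show ?thesis using c by blast
  qed
  have nz: "\<exists>x. c x \<noteq> 0" if "c \<in> A" for c
  proof (rule ccontr)
    assume "\<not> (\<exists>x. c x \<noteq> 0)"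
    then have "(\<lambda>x. 0 * c x) = c" by auto
    then have "T c = (\<lambda>y. 0)"
      using T_scale[OF K_closed(2), of c] that unfolding A_def by auto
    then show False using that unfolding A_def by simp
  qed
  define \<U> where "\<U> = csupp X ` A"
  have "compactin X (csupp X (S b))"
    using a0 unfolding A_def Cc_def by auto
  moreover have "\<forall>C\<in>\<U>. closedin X C"
    unfolding \<U>_def by auto
  moreover have "csupp X (S b) \<inter> \<Inter>\<V> \<noteq> {}" if "finite \<V>" "\<V> \<subseteq> \<U>" for \<V>
  proof -
    obtain \<F> where \<F>: "finite \<F>" "\<F> \<subseteq> A" "\<V> = csupp X ` \<F>"
      using \<open>finite \<V>\<close> \<open>\<V> \<subseteq> \<U>\<close> unfolding \<U>_def by (meson finite_subset_image)
    then obtain c where c: "c \<in> A" "\<forall>a \<in> insert (S b) \<F>. {x. c x \<noteq> 0} \<subseteq> csupp X a"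
      using dir[of "insert (S b) \<F>"] a0 by auto
    obtain x where "c x \<noteq> 0" using nz c by blast
    then have "x \<in> csupp X (S b) \<inter> \<Inter>\<V>"
      using c \<F> by auto
    then show ?thesis by blast
  qed
  ultimately have "csupp X (S b) \<inter> \<Inter>\<U> \<noteq> {}"
    using compactin_fip[of X "csupp X (S b)"] by blast
  then obtain x where "x \<in> csupp X (S b)" "\<forall>a \<in> A. x \<in> csupp X a"
    unfolding \<U>_def by blast
  moreover from this have "x \<in> topspace X"
    using closure_of_subset_topspace by (metis subsetD)
  ultimately show ?thesis
    unfolding A_def by auto
qed

section \<open>The point map and its inverse\<close>

definition phi :: "'b \<Rightarrow> 'a" where
  "phi h = (SOME x. x \<in> topspace X \<and> (\<forall>a \<in> Cc K X. T a h \<noteq> 0 \<longrightarrow> x \<in> csupp X a))"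

lemma phi:
  assumes "h \<in> topspace Y"
  shows phi_in: "phi h \<in> topspace X"
    and phi_csupp: "a \<in> Cc K X \<Longrightarrow> T a h \<noteq> 0 \<Longrightarrow> phi h \<in> csupp X a"
proof -
  have "phi h \<in> topspace X \<and> (\<forall>a \<in> Cc K X. T a h \<noteq> 0 \<longrightarrow> phi h \<in> csupp X a)"
    unfolding phi_def by (rule someI_ex) (use phi_exists[OF assms] in blast)
  then show "phi h \<in> topspace X" "a \<in> Cc K X \<Longrightarrow> T a h \<noteq> 0 \<Longrightarrow> phi h \<in> csupp X a"
    by blast+
qed

text \<open>A difference that vanishes near \<open>phi h\<close> does not have \<open>phi h\<close>
  in its support, so its image vanishes at \<open>h\<close> by the choice of \<open>phi\<close>.
  This locality lets functions be cut off freely.\<close>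

lemma T_cong_near:
  assumes "f \<in> Cc K X" "g \<in> Cc K X" "h \<in> topspace Y" "openin X U" "phi h \<in> U" "\<And>x. x \<in> U \<Longrightarrow> f x = g x"
  shows "T f h = T g h"
proof (rule ccontr)
  assume "T f h \<noteq> T g h"
  then have "T (\<lambda>x. f x - g x) h \<noteq> 0"
    using T_diff[OF assms(1,2)] by simp
  then have "phi h \<in> csupp X (\<lambda>x. f x - g x)"
    using phi_csupp[OF assms(3) CcX(2)[OF assms(1,2)]] by blast
  moreover have "phi h \<notin> csupp X (\<lambda>x. f x - g x)"
    using assms(4-6) by (intro not_in_csupp) auto
  ultimately show False by blast
qed

lemma T_nonzero_at:
  assumes h: "h \<in> topspace Y" and U: "openin X U" "phi h \<in> U"
  obtains a L where "a \<in> Cc K X" "T a h \<noteq> 0" "compactin X L" "L \<subseteq> U" "\<And>x. x \<notin> L \<Longrightarrow> a x = 0"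
proof -
  interpret inv: L1_isometry K Y N X M S T by (rule inverse)
  obtain b where b: "b \<in> Cc K Y" "b h = 1"
    using inv.bumpX[OF openin_topspace h] by metis
  obtain g O1 L where g: "g \<in> Cc K X" "openin X O1" "phi h \<in> O1" "\<And>y. y \<in> O1 \<Longrightarrow> g y = 1"
      "compactin X L" "L \<subseteq> U" "\<And>y. y \<notin> L \<Longrightarrow> g y = 0"
    using bumpX[OF U] by metis
  have "T (\<lambda>x. S b x * g x) h = T (S b) h"
    by (rule T_cong_near[OF CcX(4)[OF S_in[OF b(1)] g(1)] S_in[OF b(1)] h g(2,3)]) (simp add: g(4))
  then have "T (\<lambda>x. S b x * g x) h \<noteq> 0"
    using b TS by simp
  then show ?thesis
    using that[OF CcX(4)[OF S_in[OF b(1)] g(1)] _ g(5,6)] g(7) by simp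
qed

text \<open>A function \<open>a\<close> supported in \<open>U\<close> with
  \<open>T a h \<noteq> 0\<close> provides the neighbourhood: \<open>phi\<close> maps the open set
  where \<open>T a\<close> does not vanish into the support of \<open>a\<close>.\<close>

lemma phi_continuous: "continuous_map Y X phi"
  unfolding continuous_map_eq_topcontinuous_at topcontinuous_at_def
proof (intro ballI conjI allI impI)
  show "phi \<in> topspace Y \<rightarrow> topspace X" using phi_in by blast
  fix h U assume h: "h \<in> topspace Y" and U: "openin X U \<and> phi h \<in> U"
  then obtain a L where a: "a \<in> Cc K X" "T a h \<noteq> 0" "compactin X L" "L \<subseteq> U" "\<And>x. x \<notin> L \<Longrightarrow> a x = 0"
    using T_nonzero_at by metis
  define W where "W = {y \<in> topspace Y. T a y \<in> - {0}}"
  have "continuous_map Y euclidean (T a)"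
    using T_in[OF a(1)] unfolding Cc_def by blast
  then have "openin Y W"
    unfolding W_def by (rule openin_continuous_map_preimage) auto
  moreover have "phi y \<in> U" if "y \<in> W" for y
  proof -
    have "phi y \<in> csupp X a"
      using that phi_csupp a(1) unfolding W_def by auto
    then show ?thesis
      using csupp_subset[of X L a] X.Hausdorff a by auto
  qed
  ultimately show "\<exists>W. openin Y W \<and> h \<in> W \<and> (\<forall>y\<in>W. phi y \<in> U)"
    using h a(2) unfolding W_def by blast
qed

end

text \<open>If the returned point differed from \<open>h\<close>, take a bump \<open>b\<close> near
  \<open>h\<close> and away from that point; then \<open>phi h\<close> lies in the support of
  \<open>S b\<close>. Yet for \<open>x\<close> near \<open>phi h\<close> continuity keeps the image
  of \<open>x\<close> under the other point map away from the support of \<open>b\<close>, so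
  \<open>S b x = 0\<close> there.\<close>

lemma (in L1_isometry) phi_left_inverse:
  assumes h: "h \<in> topspace Y"
  shows "L1_isometry.phi K Y S (phi h) = h"
proof (rule ccontr)
  interpret inv: L1_isometry K Y N X M S T by (rule inverse)
  let ?y = "inv.phi (phi h)"
  assume ne: "?y \<noteq> h"
  have y: "?y \<in> topspace Y"
    using inv.phi_in phi_in h by blast
  obtain U V where UV: "openin Y U" "openin Y V" "?y \<in> U" "h \<in> V" "disjnt U V"
    using Y.Hausdorff y h ne unfolding Hausdorff_space_def by metis
  obtain b O1 L where b: "b \<in> Cc K Y" "h \<in> O1" "\<And>y. y \<in> O1 \<Longrightarrow> b y = 1" "L \<subseteq> V" "compactin Y L" "\<And>y. y \<notin> L \<Longrightarrow> b y = 0"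
    using inv.bumpX[OF UV(2,4)] by metis
  have "phi h \<in> csupp X (S b)"
    using phi_csupp[OF h S_in[OF b(1)]] TS[OF b(1)] b(2,3) by simp
  define W where "W = {x \<in> topspace X. inv.phi x \<in> U}"
  have "openin X W"
    unfolding W_def using inv.phi_continuous UV(1) by (rule openin_continuous_map_preimage)
  moreover have "phi h \<in> W"
    unfolding W_def using phi_in[OF h] UV by simp
  moreover have "S b x = 0" if "x \<in> W" for x
  proof (rule ccontr)
    assume "S b x \<noteq> 0"
    then have "inv.phi x \<in> csupp Y b"
      using inv.phi_csupp b(1) that unfolding W_def by simp
    then have "inv.phi x \<in> V"
      using csupp_subset[of Y L b] Y.Hausdorff b by auto
    then show False
      using that UV(5) unfolding W_def disjnt_def by auto
  qed
  ultimately have "phi h \<notin> csupp X (S b)"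
    by (intro not_in_csupp) auto
  then show False using \<open>phi h \<in> csupp X (S b)\<close> by blast
qed

context L1_isometry
begin

abbreviation psi :: "'a \<Rightarrow> 'b" where "psi \<equiv> L1_isometry.phi K Y S"

lemma phi_psi_homeomorphic: "homeomorphic_maps Y X phi psi"
proof -
  interpret inv: L1_isometry K Y N X M S T by (rule inverse)
  show ?thesis
    unfolding homeomorphic_maps_def
    using phi_continuous inv.phi_continuous phi_left_inverse inv.phi_left_inverse by blast
qed

text \<open>The isometry is made local by cutting \<open>f\<close> off close to the image of
  \<open>C\<close>. This leaves \<open>T f\<close> unchanged on \<open>C\<close>, and outer
  regularity makes the mass of \<open>f\<close> outside that image as small as desired.\<close>

lemma integral_compact_le:
  assumes f: "f \<in> Cc K X" and C: "compactin Y C"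
  shows "(\<integral>\<^sup>+y \<in> C. cmod (T f y) \<partial>N) \<le> (\<integral>\<^sup>+x \<in> phi ` C. cmod (f x) \<partial>M)"
proof (rule ennreal_le_epsilon)
  fix e :: real assume e: "0 < e"
  have cs: "compact_supp X f" using f Cc_iff_compact_supp X.Hausdorff by blast
  obtain B where B: "0 < B" "\<And>x. cmod (f x) \<le> B"
    using compact_supp_bounded[OF cs] by metis
  have PC: "compactin X (phi ` C)"
    using image_compactin[OF C phi_continuous] .
  \<comment> \<open>On the remainder the cut-off function is bounded by \<open>B\<close>, so its
    contribution is at most \<open>B * (e / B) = e\<close>.\<close>
  obtain V where V: "openin X V" "phi ` C \<subseteq> V" "emeasure M (V - phi ` C) \<le> ennreal (e / B)"
    using X.outer_approx[OF X.compact_sets[OF PC] X.compact_finite[OF PC], of "e / B"] e B by auto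
  obtain u :: "'a \<Rightarrow> real" and O1 L where u: "compact_supp X u" "\<And>y. 0 \<le> u y" "\<And>y. u y \<le> 1"
    "openin X O1" "phi ` C \<subseteq> O1" "\<And>y. y \<in> O1 \<Longrightarrow> u y = 1"
    "compactin X L" "L \<subseteq> V" "\<And>y. y \<notin> L \<Longrightarrow> u y = 0"
    using bump_function[OF X.lc X.Hausdorff PC V(1,2)] by metis
  define a where "a x = f x * of_real (u x)" for x
  have a: "a \<in> Cc K X"
    unfolding a_def using f CcX(4,5) u(1) by blast
  have "T f y = T a y" if "y \<in> C" for y
    using that u(5,6) compactin_subset_topspace[OF C]
    by (intro T_cong_near[OF f a _ u(4)]) (auto simp: a_def)
  then have "(\<integral>\<^sup>+y \<in> C. cmod (T f y) \<partial>N) \<le> (\<integral>\<^sup>+y. cmod (T a y) \<partial>N)"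
    by (intro nn_integral_mono) (auto simp: indicator_def)
  also have "\<dots> = ennreal (L1_norm N (T a))"
    unfolding L1_norm_def using T_in[OF a] Cc_iff_compact_supp Y.Hausdorff
    by (intro Y.compact_supp_nn_integral compact_supp_norm) auto
  also have "\<dots> = ennreal (L1_norm M a)"
    using T_norm[OF a] by simp
  also have "\<dots> = (\<integral>\<^sup>+x. cmod (a x) \<partial>M)"
    unfolding L1_norm_def using a Cc_iff_compact_supp X.Hausdorff
    by (intro X.compact_supp_nn_integral[symmetric] compact_supp_norm) auto
  also have "\<dots> \<le> (\<integral>\<^sup>+x. ennreal (cmod (f x)) * indicator (phi ` C) x + ennreal B * indicator (V - phi ` C) x \<partial>M)"
  proof (intro nn_integral_mono)
    fix x
    have "cmod (a x) \<le> cmod (f x)"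
      unfolding a_def using u(2,3)[of x] by (simp add: norm_mult mult_left_le)
    moreover have "x \<notin> V \<Longrightarrow> a x = 0"
      unfolding a_def using u(8,9) by auto
    ultimately show "ennreal (cmod (a x)) \<le> ennreal (cmod (f x)) * indicator (phi ` C) x + ennreal B * indicator (V - phi ` C) x"
      using B(2)[of x] by (auto simp: indicator_def intro!: ennreal_leI)
  qed
  also have "\<dots> = (\<integral>\<^sup>+x \<in> phi ` C. cmod (f x) \<partial>M) + ennreal B * emeasure M (V - phi ` C)"
    using X.continuous_measurable[OF compact_supp_continuous[OF cs]] X.compact_sets[OF PC] X.open_sets[OF V(1)]
    by (subst nn_integral_add) (auto simp: nn_integral_cmult_indicator)
  also have "\<dots> \<le> (\<integral>\<^sup>+x \<in> phi ` C. cmod (f x) \<partial>M) + ennreal B * ennreal (e / B)"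
    using V(3) by (intro add_left_mono mult_left_mono) auto
  also have "ennreal B * ennreal (e / B) = ennreal e"
    using B(1) e by (simp add: ennreal_mult[symmetric])
  finally show "(\<integral>\<^sup>+y \<in> C. cmod (T f y) \<partial>N) \<le> (\<integral>\<^sup>+x \<in> phi ` C. cmod (f x) \<partial>M) + ennreal e" .
qed

text \<open>If \<open>f\<close> vanishes at \<open>phi h\<close> but \<open>T f h \<noteq> 0\<close>, then on a small neighbourhood \<open>C\<close> of \<open>h\<close> the
  mass of \<open>T f\<close> is at least of order \<open>N C\<close>, while comparison with a bump \<open>g\<close> shows that the mass of
  \<open>f\<close> on \<open>phi C\<close> is an arbitrarily small multiple of it.\<close>

lemma T_zero_at:
  assumes f: "f \<in> Cc K X" and h: "h \<in> topspace Y" and f0: "f (phi h) = 0"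
  shows "T f h = 0"
proof (rule ccontr)
  interpret inv: L1_isometry K Y N X M S T by (rule inverse)
  assume nz: "T f h \<noteq> 0"
  define c where "c = cmod (T f h)"
  have c: "0 < c" using nz c_def by simp
  obtain g O1 where g: "g \<in> Cc K X" "openin X O1" "phi h \<in> O1" "\<And>y. y \<in> O1 \<Longrightarrow> g y = 1"
    using bumpX[OF openin_topspace phi_in[OF h]] by metis
  define m where "m = cmod (T g h) + 1"
  have m: "0 < m" unfolding m_def by (simp add: add_nonneg_pos)
  \<comment> \<open>Chosen so that \<open>\<epsilon> * m < c / 2\<close>: the mass of
    \<open>T f\<close> on \<open>C\<close> is at least \<open>c / 2\<close> times
    \<open>N C\<close>, while that of \<open>f\<close> on the image of \<open>C\<close> is at most
    \<open>\<epsilon> * m\<close> times \<open>N C\<close>.\<close>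
  define \<epsilon> where "\<epsilon> = c / (4 * m)"
  have \<epsilon>: "0 < \<epsilon>" "\<epsilon> * m < c / 2" using c m by (auto simp: \<epsilon>_def)
  have cont: "continuous_map Y euclideanreal (\<lambda>y. cmod (T f y))" "continuous_map Y euclideanreal (\<lambda>y. cmod (T g y))"
      "continuous_map X euclideanreal (\<lambda>x. cmod (f x))"
    using T_in f g unfolding Cc_def by (auto intro: continuous_map_norm)
  define W where "W = {y \<in> topspace Y. cmod (T f y) \<in> {c/2<..}} \<inter> {y \<in> topspace Y. cmod (T g y) \<in> {..<m}}
     \<inter> {y \<in> topspace Y. phi y \<in> O1 \<inter> {x \<in> topspace X. cmod (f x) \<in> {..<\<epsilon>}}}"
  have "openin Y W"
    unfolding W_def using cont g(2)
    by (intro openin_Int openin_continuous_map_preimage[OF phi_continuous]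
        openin_continuous_map_preimage[OF cont(1)] openin_continuous_map_preimage[OF cont(2)]
        openin_continuous_map_preimage[OF cont(3)]) auto
  moreover have "h \<in> W"
    unfolding W_def using h c g(3) f0 \<epsilon> phi_in[OF h] by (auto simp: c_def m_def)
  ultimately obtain b O2 C where b: "openin Y O2" "h \<in> O2" "\<And>y. y \<in> O2 \<Longrightarrow> b y = (1::complex)"
    "compactin Y C" "C \<subseteq> W" "\<And>y. y \<notin> C \<Longrightarrow> b y = 0"
    using inv.bumpX[of W h] by metis
  have "O2 \<subseteq> C" using b by force
  have Cm: "C \<in> sets N" using Y.compact_sets b by blast
  have PC: "compactin X (phi ` C)" using image_compactin[OF b(4) phi_continuous] .
  have "0 < emeasure N O2"
    using full(2) b h unfolding fully_supported_def measure_support_def by auto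
  then have posC: "0 < emeasure N C"
    using \<open>O2 \<subseteq> C\<close> Cm by (meson emeasure_mono less_le_trans)
  have finC: "emeasure N C < \<infinity>" using Y.compact_finite b by blast
  have im: "psi ` phi ` C = C"
    using compactin_subset_topspace[OF b(4)] phi_left_inverse by (force simp: image_image)
  have "ennreal (c/2) * emeasure N C = (\<integral>\<^sup>+y. ennreal (c/2) * indicator C y \<partial>N)"
    using Cm by (simp add: nn_integral_cmult_indicator)
  also have "\<dots> \<le> (\<integral>\<^sup>+y \<in> C. cmod (T f y) \<partial>N)"
    using b(5) unfolding W_def by (intro nn_integral_mono) (auto simp: indicator_def intro!: ennreal_leI)
  also have "\<dots> \<le> (\<integral>\<^sup>+x \<in> phi ` C. cmod (f x) \<partial>M)"
    by (rule integral_compact_le[OF f b(4)])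
  also have "\<dots> \<le> (\<integral>\<^sup>+x. ennreal \<epsilon> * (ennreal (cmod (g x)) * indicator (phi ` C) x) \<partial>M)"
    using b(5) g(4) unfolding W_def
    by (intro nn_integral_mono) (fastforce simp: indicator_def intro!: ennreal_leI)
  \<comment> \<open>Writing \<open>g\<close> as \<open>S (T g)\<close> makes the local comparison
    available in the reverse direction, from the image of \<open>C\<close> back to
    \<open>C\<close>.\<close>
  also have "\<dots> = ennreal \<epsilon> * (\<integral>\<^sup>+x \<in> phi ` C. cmod (S (T g) x) \<partial>M)"
    using X.compact_sets[OF PC] X.continuous_measurable[of g] g(1) ST[OF g(1)] unfolding Cc_def
    by (subst nn_integral_cmult) auto
  also have "\<dots> \<le> ennreal \<epsilon> * (\<integral>\<^sup>+y \<in> C. cmod (T g y) \<partial>N)"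
    using inv.integral_compact_le[OF T_in[OF g(1)] PC] im by (intro mult_left_mono) auto
  also have "\<dots> \<le> ennreal \<epsilon> * (\<integral>\<^sup>+y. ennreal m * indicator C y \<partial>N)"
    using b(5) unfolding W_def
    by (intro mult_left_mono nn_integral_mono) (auto simp: indicator_def intro!: ennreal_leI)
  also have "\<dots> = ennreal (\<epsilon> * m) * emeasure N C"
    using Cm \<epsilon>(1) m by (simp add: nn_integral_cmult_indicator ennreal_mult mult.assoc)
  finally have "ennreal (c/2) * emeasure N C \<le> ennreal (\<epsilon> * m) * emeasure N C" .
  moreover have "ennreal (\<epsilon> * m) * emeasure N C < ennreal (c/2) * emeasure N C"
    using \<epsilon> m c posC finC by (intro ennreal_mult_strict_right_mono) (auto simp: ennreal_less_iff)
  ultimately show False by simp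
qed

text \<open>Subtracting from \<open>f\<close> the right multiple of a function with value 1 at
  \<open>phi h\<close> gives a function vanishing there, so \<open>T_zero_at\<close> makes
  \<open>T f h\<close> proportional to \<open>f (phi h)\<close>. The factor is nonzero since
  \<open>T\<close> is onto, and continuous because near each point it equals the image of a single
  bump.\<close>

theorem weighted_composition:
  obtains w where "continuous_map Y euclidean w" "\<And>h. h \<in> topspace Y \<Longrightarrow> w h \<noteq> 0"
    "\<And>f h. f \<in> Cc K X \<Longrightarrow> h \<in> topspace Y \<Longrightarrow> T f h = w h * f (phi h)"
proof -
  interpret inv: L1_isometry K Y N X M S T by (rule inverse)
  have "\<exists>g \<in> Cc K X. g (phi h) = 1" if "h \<in> topspace Y" for h
    using bumpX[OF openin_topspace phi_in[OF that]] by metis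
  then obtain g where g: "\<And>h. h \<in> topspace Y \<Longrightarrow> g h \<in> Cc K X \<and> g h (phi h) = 1"
    by metis
  define w where "w h = T (g h) h" for h
  have T: "T f h = w h * f (phi h)" if f: "f \<in> Cc K X" and h: "h \<in> topspace Y" for f h
  proof -
    have k: "f (phi h) \<in> K"
      using f phi_in[OF h] unfolding Cc_def by auto
    have s: "(\<lambda>x. f (phi h) * g h x) \<in> Cc K X"
      using CcX(3) k g[OF h] by blast
    have "T (\<lambda>x. f x - f (phi h) * g h x) h = 0"
      using T_zero_at[OF CcX(2)[OF f s] h] g[OF h] by simp
    then show ?thesis
      using T_diff[OF f s] T_scale[OF k, of "g h"] g[OF h] by (simp add: w_def)
  qed
  moreover have "w h \<noteq> 0" if h: "h \<in> topspace Y" for h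
  proof
    assume "w h = 0"
    obtain b where b: "b \<in> Cc K Y" "b h = 1"
      using inv.bumpX[OF openin_topspace h] by metis
    then show False
      using T[OF S_in[OF b(1)] h] TS[OF b(1)] \<open>w h = 0\<close> by simp
  qed
  moreover have "continuous_map Y euclidean w"
  proof (rule continuous_map_locally)
    fix h assume h: "h \<in> topspace Y"
    obtain k O1 where k: "k \<in> Cc K X" "openin X O1" "phi h \<in> O1" "\<And>y. y \<in> O1 \<Longrightarrow> k y = 1"
      using bumpX[OF openin_topspace phi_in[OF h]] by metis
    have "openin Y {y \<in> topspace Y. phi y \<in> O1}"
      using phi_continuous k(2) by (rule openin_continuous_map_preimage)
    moreover have "continuous_map Y euclidean (T k)"
      using T_in[OF k(1)] unfolding Cc_def by blast
    ultimately show "\<exists>U g. openin Y U \<and> h \<in> U \<and> continuous_map Y euclidean g \<and> (\<forall>y\<in>U. w y = g y)"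
      using h k T[OF k(1)] by (intro exI[of _ "{y \<in> topspace Y. phi y \<in> O1}"] exI[of _ "T k"]) auto
  qed
  ultimately show ?thesis using that by blast
qed

end

section \<open>Haar systems and convolution\<close>

context groupoid
begin

lemma composable_iff: "(a, b) \<in> composable G \<longleftrightarrow> a \<in> arrows G \<and> b \<in> arrows G \<and> src G a = rng G b"
  by (simp add: composable_def)

lemma src_closed: "a \<in> arrows G \<Longrightarrow> src G a \<in> arrows G"
  unfolding src_def using gmult_closed[of "ginv G a" a]
  by (simp add: composable_iff ginv_closed src_ginv)

lemma src_src: "a \<in> arrows G \<Longrightarrow> src G (src G a) = src G a"
  using src_gmult[of "ginv G a" a] by (simp add: composable_iff ginv_closed src_ginv) (simp add: src_def)

lemma rng_src: "a \<in> arrows G \<Longrightarrow> rng G (src G a) = src G a"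
  using rng_gmult[of "ginv G a" a]
  by (simp add: composable_iff ginv_closed src_ginv rng_ginv) (simp add: src_def)

lemma units_iff: "x \<in> units G \<longleftrightarrow> x \<in> arrows G \<and> src G x = x"
  unfolding units_def using src_closed src_src by (auto simp: image_iff) metis

lemma unit_arrow: "x \<in> units G \<Longrightarrow> x \<in> arrows G"
  and src_unit: "x \<in> units G \<Longrightarrow> src G x = x"
  and rng_unit: "x \<in> units G \<Longrightarrow> rng G x = x"
  using units_iff rng_src by metis+

lemma src_in_units: "a \<in> arrows G \<Longrightarrow> src G a \<in> units G"
  unfolding units_def by blast

lemma rng_in_units: "a \<in> arrows G \<Longrightarrow> rng G a \<in> units G"
  using src_in_units[OF ginv_closed] src_ginv by metis

lemma unit_in_fiber: "x \<in> units G \<Longrightarrow> x \<in> fiber G x"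
  by (simp add: fiber_def unit_arrow rng_unit)

lemma ginv_comp: "a \<in> arrows G \<Longrightarrow> b \<in> arrows G \<Longrightarrow> rng G a = rng G b \<Longrightarrow> (ginv G a, b) \<in> composable G"
  by (simp add: composable_iff ginv_closed src_ginv)

lemma
  assumes "a \<in> arrows G" "b \<in> arrows G" "rng G a = rng G b"
  shows gdiv_closed: "gmult G (ginv G a) b \<in> arrows G"
    and rng_gdiv: "rng G (gmult G (ginv G a) b) = src G a"
  using gmult_closed[OF ginv_comp[OF assms]] rng_gmult[OF ginv_comp[OF assms]] assms by (simp_all add: rng_ginv)

lemma gmult_gdiv:
  assumes "a \<in> arrows G" "b \<in> arrows G" "rng G a = rng G b"
  shows "(a, gmult G (ginv G a) b) \<in> composable G" "gmult G a (gmult G (ginv G a) b) = b"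
proof -
  show "(a, gmult G (ginv G a) b) \<in> composable G"
    using assms by (simp add: composable_iff gdiv_closed rng_gdiv)
  have "gmult G a (gmult G (ginv G a) b) = gmult G (gmult G a (ginv G a)) b"
    using assms by (intro gmult_assoc[symmetric] ginv_comp) (auto simp: composable_iff ginv_closed rng_ginv)
  also have "\<dots> = b"
    using rng_gmult_id[of b] assms by (simp add: rng_def[symmetric])
  finally show "gmult G a (gmult G (ginv G a) b) = b" .
qed

lemma gdiv_gmult:
  assumes "(a, b) \<in> composable G"
  shows "gmult G (ginv G a) (gmult G a b) = b"
proof -
  have ab: "a \<in> arrows G" "b \<in> arrows G" "src G a = rng G b"
    using assms by (auto simp: composable_iff)
  have "gmult G (ginv G a) (gmult G a b) = gmult G (gmult G (ginv G a) a) b"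
    using assms ab by (intro gmult_assoc[symmetric] ginv_comp) auto
  also have "\<dots> = b"
    using rng_gmult_id[of b] ab by (simp add: src_def[symmetric])
  finally show ?thesis .
qed

end

section \<open>Continuous structure maps and closed subsets\<close>

context topological_groupoid
begin

lemma continuous_map_gmult:
  assumes "continuous_map X (gtop G) f" "continuous_map X (gtop G) g"
    "\<And>x. x \<in> topspace X \<Longrightarrow> (f x, g x) \<in> composable G"
  shows "continuous_map X (gtop G) (\<lambda>x. gmult G (f x) (g x))"
proof -
  have "continuous_map X (subtopology (prod_topology (gtop G) (gtop G)) (composable G)) (\<lambda>x. (f x, g x))"
    using assms by (auto simp: continuous_map_in_subtopology continuous_map_paired)
  from continuous_map_compose[OF this continuous_gmult] show ?thesis
    by (simp add: comp_def)
qed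

lemma continuous_map_ginv:
  "continuous_map X (gtop G) f \<Longrightarrow> continuous_map X (gtop G) (\<lambda>x. ginv G (f x))"
  using continuous_map_compose[OF _ continuous_ginv, of X f] by (simp add: comp_def)

lemma continuous_rng: "continuous_map (gtop G) (gtop G) (rng G)"
  unfolding rng_def
  by (intro continuous_map_gmult continuous_ginv)
    (auto simp: composable_iff topspace_gtop ginv_closed rng_ginv simp flip: id_def)

lemma continuous_src: "continuous_map (gtop G) (gtop G) (src G)"
  unfolding src_def
  by (intro continuous_map_gmult continuous_ginv)
    (auto simp: composable_iff topspace_gtop ginv_closed src_ginv simp flip: id_def)

lemma topspace_unit_top: "topspace (unit_top G) = units G"
  unfolding unit_top_def by (auto simp: topspace_gtop unit_arrow)

lemma continuous_rng_unit: "continuous_map (gtop G) (unit_top G) (rng G)"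
  unfolding unit_top_def
  by (auto simp: continuous_map_in_subtopology continuous_rng topspace_gtop rng_in_units)

lemma fiber_subset: "fiber G x \<subseteq> arrows G"
  by (auto simp: fiber_def)

end

context lc_hausdorff_groupoid
begin

lemma fiber_closed:
  assumes "x \<in> units G"
  shows "closedin (gtop G) (fiber G x)"
proof -
  have "closedin (gtop G) {a \<in> topspace (gtop G). rng G a = x}"
    using assms unit_arrow
    by (intro closedin_continuous_maps_eq[OF Hausdorff continuous_rng]) (auto simp: topspace_gtop)
  then show ?thesis
    by (simp add: fiber_def topspace_gtop)
qed

lemma units_closed: "closedin (gtop G) (units G)"
proof -
  have "closedin (gtop G) {a \<in> topspace (gtop G). src G a = a}"
    by (intro closedin_continuous_maps_eq[OF Hausdorff continuous_src]) (auto simp flip: id_def)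
  moreover have "units G = {a \<in> topspace (gtop G). src G a = a}"
    using units_iff by (auto simp: topspace_gtop)
  ultimately show ?thesis by simp
qed

lemma unit_top_lc: "locally_compact_space (unit_top G)" "Hausdorff_space (unit_top G)"
  unfolding unit_top_def
  using locally_compact_space_closed_subset[OF locally_compact units_closed]
    Hausdorff_space_subtopology[OF Hausdorff] by blast+

lemma closed_pairs_eq:
  assumes "continuous_map (gtop G) (gtop G) f" "continuous_map (gtop G) (gtop G) g"
  shows "closedin (prod_topology (gtop G) (gtop G))
    {(a, b). a \<in> arrows G \<and> b \<in> arrows G \<and> f a = g b}"
proof -
  have "closedin (prod_topology (gtop G) (gtop G))
    {z \<in> topspace (prod_topology (gtop G) (gtop G)). (f \<circ> fst) z = (g \<circ> snd) z}"
    by (intro closedin_continuous_maps_eq[OF Hausdorff] continuous_map_compose[OF continuous_map_fst assms(1)]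
        continuous_map_compose[OF continuous_map_snd assms(2)])
  moreover have "{z \<in> topspace (prod_topology (gtop G) (gtop G)). (f \<circ> fst) z = (g \<circ> snd) z}
    = {(a, b). a \<in> arrows G \<and> b \<in> arrows G \<and> f a = g b}"
    by (auto simp: topspace_gtop)
  ultimately show ?thesis by simp
qed

lemma composable_closed: "closedin (prod_topology (gtop G) (gtop G)) (composable G)"
  using closed_pairs_eq[OF continuous_src continuous_rng] by (simp add: composable_def)

lemma continuous_gdiv_fiber:
  assumes "h \<in> arrows G"
  shows "continuous_map (subtopology (gtop G) (fiber G (rng G h))) (gtop G) (\<lambda>s. gmult G (ginv G s) h)"
  using assms
  by (intro continuous_map_gmult continuous_map_ginv)
    (auto simp: topspace_gtop fiber_def composable_iff ginv_closed src_ginv continuous_map_from_subtopology)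

end

section \<open>Integration along the fibres of a Haar system\<close>

locale haar_groupoid = scalar_field K + lc_hausdorff_groupoid G
  for K :: "complex set" and G :: "'a top_groupoid" +
  fixes lam :: "'a \<Rightarrow> 'a measure"
  assumes haar: "haar_system K G lam" and full: "fully_supported_haar G lam"
begin

lemma lam_regular: "x \<in> units G \<Longrightarrow> regular_measure (gtop G) (lam x)"
  using haar locally_compact Hausdorff unfolding haar_system_def by unfold_locales blast+

lemma lam_support: "x \<in> units G \<Longrightarrow> measure_support (gtop G) (lam x) = fiber G x"
  using full unfolding fully_supported_haar_def by blast

lemma AE_fiber: "x \<in> units G \<Longrightarrow> AE s in lam x. s \<in> fiber G x"
  using regular_measure.AE_in_support[OF lam_regular] lam_support fiber_closed by blast

lemmas Cc_G = Cc_ops[OF Hausdorff]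

text \<open>Integrands such as s \<mapsto> g(s\<inverse>a) make sense only on a fibre. Since the
  fibre carries the measure, any globally continuous extension with compact support computes the
  same integral.\<close>

lemma fiber_integral:
  fixes F e :: "'a \<Rightarrow> 'b::{banach, second_countable_topology}"
  assumes x: "x \<in> units G" and F: "compact_supp (gtop G) F" and e: "\<And>s. s \<in> fiber G x \<Longrightarrow> e s = F s"
  shows "set_lebesgue_integral (lam x) (fiber G x) e = (\<integral>s. F s \<partial>lam x)"
proof -
  interpret R: regular_measure "gtop G" "lam x" using lam_regular[OF x] .
  have "set_lebesgue_integral (lam x) (fiber G x) e = (\<integral>s. indicator (fiber G x) s *\<^sub>R F s \<partial>lam x)"
    unfolding set_lebesgue_integral_def using e by (intro Bochner_Integration.integral_cong) (auto simp: indicator_def)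
  also have "\<dots> = (\<integral>s. F s \<partial>lam x)"
  proof (rule integral_cong_AE)
    show m: "F \<in> borel_measurable (lam x)"
      using R.continuous_measurable compact_supp_continuous[OF F] by blast
    show "(\<lambda>s. indicat_real (fiber G x) s *\<^sub>R F s) \<in> borel_measurable (lam x)"
      using m R.closed_sets[OF fiber_closed[OF x]] by simp
    show "AE s in lam x. indicat_real (fiber G x) s *\<^sub>R F s = F s"
      using AE_fiber[OF x] by eventually_elim simp
  qed
  finally show ?thesis .
qed

lemma integral_pos_fiber:
  fixes F :: "'a \<Rightarrow> real"
  assumes x: "x \<in> units G" and F: "compact_supp (gtop G) F" "\<And>s. s \<in> fiber G x \<Longrightarrow> 0 \<le> F s"
    and t: "t \<in> fiber G x" "0 < F t"
  shows "0 < (\<integral>s. F s \<partial>lam x)"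
proof (rule regular_measure.integral_pos_on_support[OF lam_regular[OF x] F(1)])
  show "AE s in lam x. 0 \<le> F s"
    using AE_fiber[OF x] by eventually_elim (simp add: F(2))
  show "t \<in> measure_support (gtop G) (lam x)"
    using t lam_support[OF x] by simp
qed (rule t)

lemma haar_continuous_real:
  fixes F :: "'a \<Rightarrow> real"
  assumes F: "compact_supp (gtop G) F"
  shows "continuous_map (unit_top G) euclideanreal (\<lambda>x. \<integral>s. F s \<partial>lam x)"
proof -
  have "continuous_map (unit_top G) euclidean (\<lambda>x. \<integral>s. complex_of_real (F s) \<partial>lam x)"
    using haar Cc_G(5)[OF F] unfolding haar_system_def by blast
  from continuous_map_Re[OF this] show ?thesis by simp
qed

text \<open>The Haar condition speaks of functions with values in \<open>K\<close>; for
  \<open>K = \<real>\<close> a complex integrand is reached only through its real and imaginary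
  parts.\<close>

lemma haar_continuous:
  fixes F :: "'a \<Rightarrow> complex"
  assumes F: "compact_supp (gtop G) F"
  shows "continuous_map (unit_top G) euclidean (\<lambda>x. \<integral>s. F s \<partial>lam x)"
proof (rule continuous_map_eq)
  show "continuous_map (unit_top G) euclidean
      (\<lambda>x. complex_of_real (\<integral>s. Re (F s) \<partial>lam x) + \<i> * complex_of_real (\<integral>s. Im (F s) \<partial>lam x))"
    by (intro continuous_map_add continuous_map_mult_algebra continuous_map_of_real
        haar_continuous_real compact_supp_Re compact_supp_Im F continuous_map_canonical_const)
  fix x assume "x \<in> topspace (unit_top G)"
  then have "integrable (lam x) F"
    using regular_measure.compact_supp_integrable[OF lam_regular F] by (simp add: topspace_unit_top)
  then show "complex_of_real (\<integral>s. Re (F s) \<partial>lam x) + \<i> * complex_of_real (\<integral>s. Im (F s) \<partial>lam x) = (\<integral>s. F s \<partial>lam x)"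
    by (simp add: complex_eq_iff)
qed

lemma haar_continuous_rng:
  fixes F :: "'a \<Rightarrow> complex"
  assumes "compact_supp (gtop G) F"
  shows "continuous_map (gtop G) euclidean (\<lambda>a. \<integral>s. F s \<partial>lam (rng G a))"
  using continuous_map_compose[OF continuous_rng_unit haar_continuous[OF assms]] by (simp add: comp_def)

lemma fiber_extension:
  fixes e u :: "'a \<Rightarrow> complex"
  assumes x: "x \<in> units G" and e: "continuous_map (subtopology (gtop G) (fiber G x)) euclidean e"
    and u: "compact_supp (gtop G) u"
  obtains F where "compact_supp (gtop G) F" "\<And>s. s \<in> fiber G x \<Longrightarrow> F s = e s * u s"
    "set_lebesgue_integral (lam x) (fiber G x) (\<lambda>s. e s * u s) = (\<integral>s. F s \<partial>lam x)"
proof -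
  obtain F where F: "compact_supp (gtop G) F" "\<And>s. s \<in> fiber G x \<Longrightarrow> F s = e s * u s"
    using Tietze_mult_complex[OF locally_compact Hausdorff fiber_closed[OF x] e u] by blast
  then show ?thesis
    using that fiber_integral[OF x F(1), of "\<lambda>s. e s * u s"] by simp
qed

section \<open>Convolution of continuous functions with compact support\<close>

lemma convolution_extension:
  assumes f: "compact_supp (gtop G) f" and g: "compact_supp (gtop G) g" and a: "a \<in> arrows G"
  obtains F where "compact_supp (gtop G) F"
    "\<And>s. s \<in> fiber G (rng G a) \<Longrightarrow> F s = f s * g (gmult G (ginv G s) a)"
    "convolution G lam f g a = (\<integral>s. F s \<partial>lam (rng G a))"
proof -
  have "continuous_map (subtopology (gtop G) (fiber G (rng G a))) euclidean (\<lambda>s. g (gmult G (ginv G s) a))"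
    using continuous_map_compose[OF continuous_gdiv_fiber[OF a] compact_supp_continuous[OF g]]
    by (simp add: comp_def)
  then obtain F where "compact_supp (gtop G) F"
    "\<And>s. s \<in> fiber G (rng G a) \<Longrightarrow> F s = g (gmult G (ginv G s) a) * f s"
    "set_lebesgue_integral (lam (rng G a)) (fiber G (rng G a)) (\<lambda>s. g (gmult G (ginv G s) a) * f s)
      = (\<integral>s. F s \<partial>lam (rng G a))"
    by (rule fiber_extension[OF rng_in_units[OF a] _ f]) (rule that)
  then show ?thesis
    using that[of F] a by (simp add: convolution_def mult.commute)
qed

lemma convolution_nonzeroD:
  assumes "convolution G lam f g a \<noteq> 0"
  obtains s where "a \<in> arrows G" "s \<in> arrows G" "rng G s = rng G a" "f s \<noteq> 0" "g (gmult G (ginv G s) a) \<noteq> 0"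
proof -
  have a: "a \<in> arrows G"
    using assms by (auto simp: convolution_def split: if_splits)
  have "\<exists>s \<in> fiber G (rng G a). f s * g (gmult G (ginv G s) a) \<noteq> 0"
  proof (rule ccontr)
    assume "\<not> ?thesis"
    then have "set_lebesgue_integral (lam (rng G a)) (fiber G (rng G a)) (\<lambda>s. f s * g (gmult G (ginv G s) a)) = 0"
      unfolding set_lebesgue_integral_def
      by (intro integral_eq_zero_AE AE_I2) (auto simp: indicator_def)
    then show False
      using assms a by (simp add: convolution_def)
  qed
  then show ?thesis
    using that a by (auto simp: fiber_def)
qed

text \<open>Composability is a closed condition, so the composable pairs in the product of the two
  compact sets form a compact set, whose image under multiplication contains every point where the
  convolution is nonzero.\<close>

lemma convolution_compact:
  assumes f: "compact_supp (gtop G) f" and g: "compact_supp (gtop G) g"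
  shows "\<exists>C. compactin (gtop G) C \<and> (\<forall>x. x \<notin> C \<longrightarrow> convolution G lam f g x = 0)"
proof -
  obtain Cf where Cf: "compactin (gtop G) Cf" "\<And>x. x \<notin> Cf \<Longrightarrow> f x = 0"
    using f compact_suppE by blast
  obtain Cg where Cg: "compactin (gtop G) Cg" "\<And>x. x \<notin> Cg \<Longrightarrow> g x = 0"
    using g compact_suppE by blast
  define P where "P = composable G \<inter> (Cf \<times> Cg)"
  have "compactin (prod_topology (gtop G) (gtop G)) P"
    unfolding P_def using Cf Cg
    by (intro closed_Int_compactin composable_closed) (simp add: compactin_Times)
  then have "compactin (subtopology (prod_topology (gtop G) (gtop G)) (composable G)) P"
    by (simp add: compactin_subtopology P_def)
  then have "compactin (gtop G) ((\<lambda>(a, b). gmult G a b) ` P)"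
    using image_compactin continuous_gmult by blast
  moreover have "x \<in> (\<lambda>(a, b). gmult G a b) ` P" if nz: "convolution G lam f g x \<noteq> 0" for x
  proof -
    obtain s where s: "x \<in> arrows G" "s \<in> arrows G" "rng G s = rng G x" "f s \<noteq> 0" "g (gmult G (ginv G s) x) \<noteq> 0"
      using convolution_nonzeroD[OF nz] .
    then have "(s, gmult G (ginv G s) x) \<in> P"
      using gmult_gdiv(1)[of s x] Cf(2) Cg(2) unfolding P_def by blast
    moreover have "x = (\<lambda>(a, b). gmult G a b) (s, gmult G (ginv G s) x)"
      using gmult_gdiv(2)[of s x] s by simp
    ultimately show ?thesis
      by (rule rev_image_eqI)
  qed
  ultimately show ?thesis by blast
qed

text \<open>Near \<open>a\<close> the integrand \<open>f s * g (s\<inverse> b)\<close> is compared with a fixed compactly supported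
  extension \<open>F\<close> of \<open>s \<mapsto> f s * g (s\<inverse> a)\<close>; projecting along a compact set shows that the difference
  is uniformly small on the fibres near \<open>a\<close>.\<close>

lemma convolution_continuous:
  assumes f: "compact_supp (gtop G) f" and g: "compact_supp (gtop G) g"
  shows "continuous_map (gtop G) euclidean (convolution G lam f g)"
  unfolding continuous_map_euclidean_dist
proof (intro ballI allI impI)
  fix a and e :: real
  assume "a \<in> topspace (gtop G)" and e: "0 < e"
  then have a: "a \<in> arrows G" by (simp add: topspace_gtop)
  obtain F where F: "compact_supp (gtop G) F"
    "\<And>s. s \<in> fiber G (rng G a) \<Longrightarrow> F s = f s * g (gmult G (ginv G s) a)"
    "convolution G lam f g a = (\<integral>s. F s \<partial>lam (rng G a))"
    using convolution_extension[OF f g a] by metis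
  obtain Cf where Cf: "compactin (gtop G) Cf" "\<And>x. x \<notin> Cf \<Longrightarrow> f x = 0"
    using f compact_suppE by blast
  obtain CF where CF: "compactin (gtop G) CF" "\<And>x. x \<notin> CF \<Longrightarrow> F x = 0"
    using F(1) compact_suppE by blast
  define L where "L = Cf \<union> CF"
  have L: "compactin (gtop G) L" unfolding L_def using Cf CF compactin_Un by blast
  obtain u :: "'a \<Rightarrow> real" and N where u: "compact_supp (gtop G) u" "\<And>x. 0 \<le> u x" "L \<subseteq> N" "\<And>x. x \<in> N \<Longrightarrow> u x = 1"
    using bump_function[OF locally_compact Hausdorff L openin_topspace compactin_subset_topspace[OF L]] by metis
  define m where "m b = (\<integral>s. u s \<partial>lam (rng G b))" for b
  have mc: "continuous_map (gtop G) euclideanreal m"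
    using continuous_map_compose[OF continuous_rng_unit haar_continuous_real[OF u(1)]]
    by (simp add: comp_def m_def[abs_def])
  have m0: "0 \<le> m b" for b
    unfolding m_def using u(2) by (intro integral_nonneg_AE) auto
  \<comment> \<open>\<open>m b\<close> dominates the mass of \<open>L\<close> over the fibre of
    \<open>rng G b\<close> and stays below \<open>m a + 1\<close> near \<open>a\<close>, so
    replacing the integrand by \<open>F\<close> costs less than \<open>e / 2\<close>. The other half
    pays for the variation of the integral of \<open>F\<close>.\<close>
  define \<epsilon> where "\<epsilon> = e / (2 * (m a + 1))"
  have \<epsilon>: "0 < \<epsilon>" "\<epsilon> * (m a + 1) = e / 2"
    using e m0[of a] by (auto simp: \<epsilon>_def divide_simps)
  define P where "P = {(s, b). s \<in> arrows G \<and> b \<in> arrows G \<and> rng G s = rng G b}"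
  define \<Delta> where "\<Delta> = (\<lambda>(s, b). f s * g (gmult G (ginv G s) b) - F s)"
  let ?GG = "prod_topology (gtop G) (gtop G)"
  have Pc: "closedin ?GG P"
    unfolding P_def by (rule closed_pairs_eq[OF continuous_rng continuous_rng])
  have fst_c: "continuous_map (subtopology ?GG P) (gtop G) fst"
    and snd_c: "continuous_map (subtopology ?GG P) (gtop G) snd"
    by (auto intro: continuous_map_from_subtopology continuous_map_fst continuous_map_snd)
  have div_c: "continuous_map (subtopology ?GG P) (gtop G) (\<lambda>z. gmult G (ginv G (fst z)) (snd z))"
    by (intro continuous_map_gmult continuous_map_ginv fst_c snd_c) (auto simp: P_def intro: ginv_comp)
  have "continuous_map (subtopology ?GG P) euclidean (\<lambda>z. f (fst z) * g (gmult G (ginv G (fst z)) (snd z)) - F (fst z))"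
    using continuous_map_compose[OF fst_c compact_supp_continuous[OF f]]
      continuous_map_compose[OF fst_c compact_supp_continuous[OF F(1)]]
      continuous_map_compose[OF div_c compact_supp_continuous[OF g]]
    by (intro continuous_map_diff continuous_map_mult_algebra) (auto simp: comp_def)
  then have \<Delta>c: "continuous_map (subtopology ?GG P) euclideanreal (\<lambda>z. cmod (\<Delta> z))"
    unfolding \<Delta>_def by (intro continuous_map_norm) (simp add: case_prod_unfold)
  \<comment> \<open>The pairs at which the error is too large. Over \<open>L\<close> their
    projection is closed because \<open>L\<close> is compact, and it misses \<open>a\<close>, where
    the error is zero.\<close>
  define Z where "Z = {z \<in> topspace (subtopology ?GG P). cmod (\<Delta> z) \<in> {\<epsilon>..}}"
  have "closedin (subtopology ?GG P) Z"
    unfolding Z_def by (intro closedin_continuous_map_preimage[OF \<Delta>c]) auto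
  then have "closedin ?GG Z"
    using Pc closedin_closed_subtopology by blast
  then have "closedin (subtopology ?GG (L \<times> arrows G)) (Z \<inter> (L \<times> arrows G))"
    using closedin_subtopology by blast
  moreover have "subtopology ?GG (L \<times> arrows G) = prod_topology (subtopology (gtop G) L) (gtop G)"
    using subtopology_Times[of "gtop G" "gtop G" L "arrows G"] by (simp flip: topspace_gtop)
  moreover have "compact_space (subtopology (gtop G) L)"
    using L compact_space_subtopology by blast
  ultimately have "closedin (gtop G) (snd ` (Z \<inter> (L \<times> arrows G)))"
    using closed_map_snd unfolding closed_map_def by metis
  then have O1: "openin (gtop G) (arrows G - snd ` (Z \<inter> (L \<times> arrows G)))"
    by (metis openin_diff openin_topspace topspace_gtop)
  define W where "W = (arrows G - snd ` (Z \<inter> (L \<times> arrows G))) \<inter> {b \<in> topspace (gtop G). m b \<in> {..<m a + 1}}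
    \<inter> {b \<in> topspace (gtop G). (\<integral>s. F s \<partial>lam (rng G b)) \<in> ball (convolution G lam f g a) (e/2)}"
  have "openin (gtop G) W"
    unfolding W_def using O1
    by (intro openin_Int openin_continuous_map_preimage[OF mc]
        openin_continuous_map_preimage[OF haar_continuous_rng[OF F(1)]]) auto
  moreover have "a \<in> W"
  proof -
    have "a \<notin> snd ` (Z \<inter> (L \<times> arrows G))"
    proof
      assume "a \<in> snd ` (Z \<inter> (L \<times> arrows G))"
      then obtain s where "(s, a) \<in> Z" by auto
      then have "s \<in> fiber G (rng G a)" "\<epsilon> \<le> cmod (\<Delta> (s, a))"
        unfolding Z_def P_def fiber_def by auto
      then show False
        using F(2) \<epsilon>(1) unfolding \<Delta>_def by simp
    qed
    then show ?thesis
      unfolding W_def using a e F(3) by (simp add: topspace_gtop)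
  qed
  moreover have "dist (convolution G lam f g b) (convolution G lam f g a) < e" if "b \<in> W" for b
  proof -
    have b: "b \<in> arrows G" "m b < m a + 1" "b \<notin> snd ` (Z \<inter> (L \<times> arrows G))"
      "dist (convolution G lam f g a) (\<integral>s. F s \<partial>lam (rng G b)) < e / 2"
      using that unfolding W_def by (auto simp: topspace_gtop)
    obtain F' where F': "compact_supp (gtop G) F'"
      "\<And>s. s \<in> fiber G (rng G b) \<Longrightarrow> F' s = f s * g (gmult G (ginv G s) b)"
      "convolution G lam f g b = (\<integral>s. F' s \<partial>lam (rng G b))"
      using convolution_extension[OF f g b(1)] by metis
    interpret R: regular_measure "gtop G" "lam (rng G b)"
      using lam_regular[OF rng_in_units[OF b(1)]] .
    have int: "integrable (lam (rng G b)) F" "integrable (lam (rng G b)) F'" "integrable (lam (rng G b)) u"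
      using R.compact_supp_integrable F(1) F'(1) u(1) by blast+
    have bd: "cmod (F' s - F s) \<le> \<epsilon> * u s" if s: "s \<in> fiber G (rng G b)" for s
    proof (cases "s \<in> L")
      case True
      then have "(s, b) \<notin> Z"
        using b(1,3) by (metis IntI SigmaI image_eqI snd_conv)
      then have "cmod (\<Delta> (s, b)) < \<epsilon>"
        using s b(1) unfolding Z_def P_def fiber_def by (auto simp: topspace_gtop)
      then show ?thesis
        using F'(2)[OF s] True u(3,4) by (auto simp: \<Delta>_def)
    next
      case False
      then have "f s = 0" "F s = 0"
        using Cf(2) CF(2) by (auto simp: L_def)
      then show ?thesis
        using F'(2)[OF s] \<epsilon> u(2)[of s] by simp
    qed
    have "cmod (convolution G lam f g b - (\<integral>s. F s \<partial>lam (rng G b))) = cmod (\<integral>s. F' s - F s \<partial>lam (rng G b))"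
      using int F'(3) by simp
    also have "\<dots> \<le> (\<integral>s. cmod (F' s - F s) \<partial>lam (rng G b))"
      by (rule integral_norm_bound)
    also have "\<dots> \<le> (\<integral>s. \<epsilon> * u s \<partial>lam (rng G b))"
    proof (rule integral_mono_AE)
      show "AE s in lam (rng G b). cmod (F' s - F s) \<le> \<epsilon> * u s"
        using AE_fiber[OF rng_in_units[OF b(1)]] by eventually_elim (rule bd)
    qed (use int in auto)
    also have "\<dots> = \<epsilon> * m b"
      by (simp add: m_def)
    also have "\<dots> < \<epsilon> * (m a + 1)"
      using b(2) \<epsilon>(1) by simp
    finally have "dist (convolution G lam f g b) (\<integral>s. F s \<partial>lam (rng G b)) < e / 2"
      using \<epsilon>(2) by (simp add: dist_norm)
    then show ?thesis
      using b(4) dist_triangle_half_l dist_commute by metis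
  qed
  ultimately show "\<exists>U. openin (gtop G) U \<and> a \<in> U \<and>
      (\<forall>y\<in>U. dist (convolution G lam f g y) (convolution G lam f g a) < e)"
    by blast
qed

lemma convolution_in_K:
  assumes f: "f \<in> Cc K (gtop G)" and g: "g \<in> Cc K (gtop G)"
  shows "convolution G lam f g a \<in> K"
proof (cases "K = UNIV")
  case False
  then have KR: "K = \<real>" using K by blast
  then have r: "f s \<in> \<real>" "g s \<in> \<real>" for s
    using f g unfolding Cc_def by (cases "s \<in> topspace (gtop G)"; auto)+
  obtain f' g' where fg: "f = (\<lambda>s. complex_of_real (f' s))" "g = (\<lambda>s. complex_of_real (g' s))"
  proof -
    have "f = (\<lambda>s. complex_of_real (Re (f s)))" "g = (\<lambda>s. complex_of_real (Re (g s)))"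
      using r by auto
    then show ?thesis by (rule that)
  qed
  have "set_lebesgue_integral M A (\<lambda>s. f s * g (t s))
      = complex_of_real (set_lebesgue_integral M A (\<lambda>s. f' s * g' (t s)))" for M A t
    unfolding fg by (simp flip: set_integral_complex_of_real)
  then show ?thesis
    unfolding convolution_def KR by auto
qed simp

lemma convolution_in_Cc:
  assumes "f \<in> Cc K (gtop G)" "g \<in> Cc K (gtop G)"
  shows "convolution G lam f g \<in> Cc K (gtop G)"
proof -
  have "compact_supp (gtop G) f" "compact_supp (gtop G) g"
    using assms Cc_iff_compact_supp[OF Hausdorff] by blast+
  then show ?thesis
    unfolding Cc_iff_compact_supp[OF Hausdorff] compact_supp_def[of _ "convolution G lam f g"]
    using convolution_continuous convolution_compact convolution_in_K[OF assms] by blast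
qed

section \<open>Testing a function on a fibre by integrals\<close>

lemma fiber_test_nonpos:
  fixes e :: "'a \<Rightarrow> real"
  assumes x: "x \<in> units G" and e: "continuous_map (subtopology (gtop G) (fiber G x)) euclideanreal e"
    and test: "\<And>F. compact_supp (gtop G) F \<Longrightarrow> (\<And>s. 0 \<le> F s) \<Longrightarrow>
      set_lebesgue_integral (lam x) (fiber G x) (\<lambda>s. e s * F s) \<le> 0"
    and t: "t \<in> fiber G x"
  shows "e t \<le> 0"
proof (rule ccontr)
  assume "\<not> e t \<le> 0"
  have tt: "compactin (gtop G) {t}" "{t} \<subseteq> topspace (gtop G)"
    using t fiber_subset topspace_gtop by auto
  obtain u :: "'a \<Rightarrow> real" and N where u: "compact_supp (gtop G) u" "\<And>x. 0 \<le> u x" "{t} \<subseteq> N" "\<And>x. x \<in> N \<Longrightarrow> u x = 1"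
    using bump_function[OF locally_compact Hausdorff tt(1) openin_topspace tt(2)] by metis
  \<comment> \<open>Testing \<open>e\<close> against its own positive part times a bump makes the
    integrand nonnegative on the fibre and positive at \<open>t\<close>.\<close>
  have "continuous_map (subtopology (gtop G) (fiber G x)) euclideanreal (\<lambda>s. max 0 (e s))"
    using e by (intro continuous_intros)
  then obtain F0 where F0: "compact_supp (gtop G) F0" "\<And>s. s \<in> fiber G x \<Longrightarrow> F0 s = max 0 (e s) * u s"
    using Tietze_mult_real[OF locally_compact Hausdorff fiber_closed[OF x] _ u(1)] by blast
  \<comment> \<open>\<open>F0\<close> is known to be nonnegative on the fibre only, whereas test
    functions must be nonnegative everywhere; the norm repairs this without changing values on the
    fibre.\<close>
  define F where "F s = norm (F0 s)" for s
  have F: "compact_supp (gtop G) F" "\<And>s. 0 \<le> F s" "\<And>s. s \<in> fiber G x \<Longrightarrow> F s = max 0 (e s) * u s"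
    unfolding F_def using F0 u(2) by (auto intro: compact_supp_norm[OF F0(1), simplified])
  obtain F1 where F1: "compact_supp (gtop G) F1" "\<And>s. s \<in> fiber G x \<Longrightarrow> F1 s = e s * F s"
    using Tietze_mult_real[OF locally_compact Hausdorff fiber_closed[OF x] e F(1)] by blast
  have "0 < (\<integral>s. F1 s \<partial>lam x)"
  proof (rule integral_pos_fiber[OF x F1(1) _ t])
    show "0 \<le> F1 s" if "s \<in> fiber G x" for s
      using F1(2) F(3) that u(2)[of s] by (auto simp: max_def zero_le_mult_iff)
    show "0 < F1 t"
      using F1(2)[OF t] F(3)[OF t] u(3,4) \<open>\<not> e t \<le> 0\<close> by auto
  qed
  also have "\<dots> = set_lebesgue_integral (lam x) (fiber G x) (\<lambda>s. e s * F s)"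
    using fiber_integral[OF x F1(1), of "\<lambda>s. e s * F s"] F1(2) by simp
  also have "\<dots> \<le> 0"
    using test F by blast
  finally show False by simp
qed

lemma fiber_test_zero:
  fixes e :: "'a \<Rightarrow> real"
  assumes x: "x \<in> units G" and e: "continuous_map (subtopology (gtop G) (fiber G x)) euclideanreal e"
    and test: "\<And>F. compact_supp (gtop G) F \<Longrightarrow> (\<And>s. 0 \<le> F s) \<Longrightarrow>
      set_lebesgue_integral (lam x) (fiber G x) (\<lambda>s. e s * F s) = 0"
    and t: "t \<in> fiber G x"
  shows "e t = 0"
proof (rule antisym)
  show "e t \<le> 0"
    using fiber_test_nonpos[OF x e _ t] test by simp
  have "- e t \<le> 0"
    using fiber_test_nonpos[OF x continuous_map_minus[OF e] _ t] test
    by (simp add: set_lebesgue_integral_def)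
  then show "0 \<le> e t" by simp
qed

lemma fiber_test_complex:
  fixes e :: "'a \<Rightarrow> complex"
  assumes x: "x \<in> units G" and e: "continuous_map (subtopology (gtop G) (fiber G x)) euclidean e"
    and test: "\<And>F. compact_supp (gtop G) F \<Longrightarrow> (\<And>s. 0 \<le> F s) \<Longrightarrow>
      set_lebesgue_integral (lam x) (fiber G x) (\<lambda>s. e s * complex_of_real (F s)) = 0"
    and t: "t \<in> fiber G x"
  shows "e t = 0"
proof (rule complex_eqI)
  have parts: "set_lebesgue_integral (lam x) (fiber G x) (\<lambda>s. Re (e s) * F s) = 0"
      "set_lebesgue_integral (lam x) (fiber G x) (\<lambda>s. Im (e s) * F s) = 0"
    if F: "compact_supp (gtop G) F" "\<And>s. 0 \<le> F s" for F
  proof -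
    obtain F1 where F1: "compact_supp (gtop G) F1" "\<And>s. s \<in> fiber G x \<Longrightarrow> F1 s = e s * complex_of_real (F s)"
      "set_lebesgue_integral (lam x) (fiber G x) (\<lambda>s. e s * complex_of_real (F s)) = (\<integral>s. F1 s \<partial>lam x)"
      using fiber_extension[OF x e compact_supp_of_real[OF F(1)]] by metis
    have int: "integrable (lam x) F1"
      using regular_measure.compact_supp_integrable[OF lam_regular[OF x] F1(1)] .
    have 0: "(\<integral>s. F1 s \<partial>lam x) = 0"
      using test[OF F] F1(3) by simp
    show "set_lebesgue_integral (lam x) (fiber G x) (\<lambda>s. Re (e s) * F s) = 0"
      using fiber_integral[OF x compact_supp_Re[OF F1(1)], of "\<lambda>s. Re (e s) * F s"] F1(2) 0 int by simp
    show "set_lebesgue_integral (lam x) (fiber G x) (\<lambda>s. Im (e s) * F s) = 0"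
      using fiber_integral[OF x compact_supp_Im[OF F1(1)], of "\<lambda>s. Im (e s) * F s"] F1(2) 0 int by simp
  qed
  show "Re (e t) = Re 0"
    using fiber_test_zero[OF x continuous_map_Re[OF e] _ t] parts(1) by simp
  show "Im (e t) = Im 0"
    using fiber_test_zero[OF x continuous_map_Im[OF e] _ t] parts(2) by simp
qed

end

section \<open>Integration against the composed measure\<close>

text \<open>\<open>q\<close> is the layer-cake form of \<lfloor>t n\<rfloor> / n: each k \<ge> 1
  with k/n \<le> t contributes 1/n. For t = F s the layers are indicators of superlevel sets of
  \<open>F\<close>, whose composed measure is known.\<close>

lemma step_function_approx:
  fixes t :: real and n m :: nat
  assumes "0 \<le> t" "t * real n \<le> real m" "0 < n"
  defines "q \<equiv> (\<Sum>k\<in>{1..m}. (1 / real n) * (if real k / real n \<le> t then 1 else 0))"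
  shows "q \<le> t" "t \<le> q + 1 / real n"
proof -
  have e: "{k \<in> {1..m}. real k / real n \<le> t} = {1..nat \<lfloor>t * real n\<rfloor>}"
  proof -
    have iff: "real k / real n \<le> t \<longleftrightarrow> k \<le> nat \<lfloor>t * real n\<rfloor>" for k
      using assms(1,3) by (simp add: divide_le_eq le_nat_iff le_floor_iff)
    have "nat \<lfloor>t * real n\<rfloor> \<le> m"
      using assms(2) by linarith
    then show ?thesis
      unfolding iff by auto
  qed
  have "q = (1 / real n) * real (card {k \<in> {1..m}. real k / real n \<le> t})"
    unfolding q_def sum_distrib_left[symmetric] by (simp flip: sum.inter_filter)
  also have "\<dots> = real (nat \<lfloor>t * real n\<rfloor>) / real n"
    unfolding e by simp
  also have "\<dots> = real_of_int \<lfloor>t * real n\<rfloor> / real n"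
    using assms(1) by simp
  finally have q: "q = real_of_int \<lfloor>t * real n\<rfloor> / real n" .
  show "q \<le> t"
    unfolding q using assms(3) by (simp add: divide_le_eq)
  have "t * real n \<le> real_of_int \<lfloor>t * real n\<rfloor> + 1"
    by linarith
  then show "t \<le> q + 1 / real n"
    unfolding q using assms(3) by (simp add: field_simps)
qed

locale haar_composition = haar_groupoid K G lam
  for K :: "complex set" and G :: "'a top_groupoid" and lam +
  fixes mu nu :: "'a measure"
  assumes mu: "regular_borel_measure (unit_top G) mu" "fully_supported (unit_top G) mu"
    and nu: "composition_measure G lam mu nu"
begin

sublocale mu: regular_measure "unit_top G" mu
  using mu unit_top_lc by unfold_locales

sublocale nu: regular_measure "gtop G" nu
  using nu locally_compact Hausdorff by unfold_locales (auto simp: composition_measure_def)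

lemma nu_compact: "compactin (gtop G) E \<Longrightarrow> emeasure nu E = (\<integral>\<^sup>+ x. emeasure (lam x) E \<partial>mu)"
  using nu unfolding composition_measure_def by blast

lemma space_mu: "space mu = units G"
  using mu.space_eq by (simp add: topspace_unit_top)

text \<open>The function is upper semicontinuous: outer regularity of \<open>lam x\<close> and a
  bump over \<open>E\<close> give a continuous fibre integral that dominates the mass of
  \<open>E\<close> for every unit and is still below \<open>c\<close> at \<open>x\<close>, hence
  near \<open>x\<close>.\<close>

lemma lam_compact_measurable:
  assumes E: "compactin (gtop G) E"
  shows "(\<lambda>x. emeasure (lam x) E) \<in> borel_measurable mu"
proof (rule borel_measurableI_less)
  fix c :: ennreal
  have "openin (unit_top G) {x \<in> space mu. emeasure (lam x) E < c}"
  proof (subst openin_subopen, intro ballI)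
    fix x assume "x \<in> {x \<in> space mu. emeasure (lam x) E < c}"
    then have x: "x \<in> units G" "emeasure (lam x) E < c" by (auto simp: space_mu)
    interpret R: regular_measure "gtop G" "lam x" using lam_regular[OF x(1)] .
    obtain V where V: "openin (gtop G) V" "E \<subseteq> V" "emeasure (lam x) V < c"
      using x(2) R.outer_regular[OF R.compact_sets[OF E]] by (auto simp: INF_less_iff)
    obtain u :: "'a \<Rightarrow> real" and N L where u: "compact_supp (gtop G) u" "\<And>y. 0 \<le> u y" "\<And>y. u y \<le> 1"
      "E \<subseteq> N" "\<And>y. y \<in> N \<Longrightarrow> u y = 1" "L \<subseteq> V" "\<And>y. y \<notin> L \<Longrightarrow> u y = 0"
      using bump_function[OF locally_compact Hausdorff E V(1,2)] by metis
    have u_int: "ennreal (\<integral>s. u s \<partial>lam y) = (\<integral>\<^sup>+s. ennreal (u s) \<partial>lam y)" if "y \<in> units G" for y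
      using regular_measure.compact_supp_nn_integral[OF lam_regular[OF that] u(1,2)] by simp
    have E_le: "emeasure (lam y) E \<le> ennreal (\<integral>s. u s \<partial>lam y)" if y: "y \<in> units G" for y
    proof -
      have "emeasure (lam y) E = (\<integral>\<^sup>+s. indicator E s \<partial>lam y)"
        using regular_measure.compact_sets[OF lam_regular[OF y] E] by simp
      also have "\<dots> \<le> (\<integral>\<^sup>+s. ennreal (u s) \<partial>lam y)"
        using u(4,5) by (intro nn_integral_mono) (auto simp: indicator_def)
      finally show ?thesis using u_int[OF y] by simp
    qed
    have "ennreal (\<integral>s. u s \<partial>lam x) \<le> emeasure (lam x) V"
    proof -
      have "(\<integral>\<^sup>+s. ennreal (u s) \<partial>lam x) \<le> (\<integral>\<^sup>+s. indicator V s \<partial>lam x)"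
      proof (intro nn_integral_mono)
        fix s show "ennreal (u s) \<le> indicator V s"
          using u(3)[of s] subsetD[OF u(6), of s] u(7)[of s] by (cases "s \<in> L") auto
      qed
      then show ?thesis using u_int[OF x(1)] R.open_sets[OF V(1)] by simp
    qed
    then have lt: "ennreal (\<integral>s. u s \<partial>lam x) < c" using V(3) by simp
    define T where "T = {y \<in> topspace (unit_top G). (\<integral>s. u s \<partial>lam y) \<in> {r. ennreal r < c}}"
    have "open {r. ennreal r < c}"
      by (rule open_Collect_less[OF continuous_on_ennreal[OF continuous_on_id] continuous_on_const, unfolded id_def])
    then have "openin (unit_top G) T"
      unfolding T_def by (intro openin_continuous_map_preimage[OF haar_continuous_real[OF u(1)]]) simp
    moreover have "x \<in> T"
      using x lt by (simp add: T_def topspace_unit_top)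
    moreover have "T \<subseteq> {x \<in> space mu. emeasure (lam x) E < c}"
      using E_le unfolding T_def by (auto simp: space_mu topspace_unit_top intro: le_less_trans)
    ultimately show "\<exists>T. openin (unit_top G) T \<and> x \<in> T \<and> T \<subseteq> {x \<in> space mu. emeasure (lam x) E < c}"
      by blast
  qed
  then show "{x \<in> space mu. emeasure (lam x) E < c} \<in> sets mu"
    by (rule mu.open_sets)
qed

text \<open>The defining identity of \<open>nu\<close> concerns compact sets only, so
  \<open>F\<close> is squeezed between step functions over compact superlevel sets. The error is 1/n
  times the indicator of a compact \<open>C\<close>, which has finite
  \<open>nu\<close>-mass.\<close>

theorem nn_integral_composition:
  assumes F: "compact_supp (gtop G) F" "\<And>s. 0 \<le> F s"
  shows "(\<integral>\<^sup>+s. ennreal (F s) \<partial>nu) = (\<integral>\<^sup>+x. (\<integral>\<^sup>+s. ennreal (F s) \<partial>lam x) \<partial>mu)"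
proof -
  obtain C where C: "compactin (gtop G) C" "\<And>x. x \<notin> C \<Longrightarrow> F x = 0"
    using F(1) compact_suppE by blast
  obtain B where B: "\<And>x. norm (F x) \<le> B" using compact_supp_bounded[OF F(1)] by metis
  have Fm: "(\<lambda>s. ennreal (F s)) \<in> borel_measurable (lam x)" if "x \<in> units G" for x
    using regular_measure.continuous_measurable[OF lam_regular[OF that] compact_supp_continuous[OF F(1)]] by simp
  have Cm: "C \<in> sets (lam x)" if "x \<in> units G" for x
    using regular_measure.compact_sets[OF lam_regular[OF that] C(1)] .
  have key: "(\<integral>\<^sup>+s. ennreal (F s) \<partial>nu) \<le> (\<integral>\<^sup>+x. (\<integral>\<^sup>+s. ennreal (F s) \<partial>lam x) \<partial>mu) + ennreal (1 / real n) * emeasure nu C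
    \<and> (\<integral>\<^sup>+x. (\<integral>\<^sup>+s. ennreal (F s) \<partial>lam x) \<partial>mu) \<le> (\<integral>\<^sup>+s. ennreal (F s) \<partial>nu) + ennreal (1 / real n) * emeasure nu C"
    if n: "0 < n" for n :: nat
  proof -
    define m where "m = nat \<lceil>B * real n\<rceil>"
    \<comment> \<open>Only indices k \<ge> 1 are summed: for them \<open>F\<close> is positive on
      \<open>E k\<close>, so \<open>E k\<close> lies in \<open>C\<close> and is compact, while
      \<open>E 0\<close> would be the whole space.\<close>
    define E where "E k = {s \<in> topspace (gtop G). F s \<in> {real k / real n..}}" for k :: nat
    have E: "compactin (gtop G) (E k)" if "k \<in> {1..m}" for k
    proof -
      have "closedin (gtop G) (E k)"
        unfolding E_def by (intro closedin_continuous_map_preimage[OF compact_supp_continuous[OF F(1)]]) auto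
      moreover have "E k \<subseteq> C"
      proof
        fix s assume "s \<in> E k"
        then have "0 < F s" using that n unfolding E_def by (auto intro: less_le_trans[of 0 "real k / real n"])
        then show "s \<in> C" using C(2) by force
      qed
      ultimately show ?thesis using C(1) closed_compactin by blast
    qed
    define q where "q s = (\<Sum>k\<in>{1..m}. ennreal (1 / real n) * indicator (E k) s)" for s
    have q: "q s \<le> ennreal (F s)" "ennreal (F s) \<le> q s + ennreal (1 / real n) * indicator C s"
      if s: "s \<in> topspace (gtop G)" for s
    proof -
      have "q s = (\<Sum>k\<in>{1..m}. ennreal ((1 / real n) * (if real k / real n \<le> F s then 1 else 0)))"
        unfolding q_def using s by (intro sum.cong) (auto simp: E_def indicator_def)
      also have "\<dots> = ennreal (\<Sum>k\<in>{1..m}. (1 / real n) * (if real k / real n \<le> F s then 1 else 0))"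
        by (rule sum_ennreal) auto
      finally have qs: "q s = ennreal (\<Sum>k\<in>{1..m}. (1 / real n) * (if real k / real n \<le> F s then 1 else 0))" .
      have "F s * real n \<le> real m"
      proof -
        have "F s * real n \<le> B * real n" using B[of s] by (intro mult_right_mono) auto
        also have "\<dots> \<le> real m" unfolding m_def by linarith
        finally show ?thesis .
      qed
      note a = step_function_approx[OF F(2)[of s] this n]
      show "q s \<le> ennreal (F s)"
        unfolding qs by (rule ennreal_leI[OF a(1)])
      show "ennreal (F s) \<le> q s + ennreal (1 / real n) * indicator C s"
      proof (cases "s \<in> C")
        case True
        have "ennreal (F s) \<le> ennreal ((\<Sum>k\<in>{1..m}. (1 / real n) * (if real k / real n \<le> F s then 1 else 0)) + 1 / real n)"
          by (rule ennreal_leI[OF a(2)])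
        also have "\<dots> = q s + ennreal (1 / real n)"
          unfolding qs by (intro ennreal_plus sum_nonneg) auto
        finally show ?thesis using True by simp
      qed (simp add: C(2))
    qed
    have Em: "E k \<in> sets (lam x)" if "x \<in> units G" "k \<in> {1..m}" for x k
      using regular_measure.compact_sets[OF lam_regular[OF that(1)] E[OF that(2)]] .
    have qm: "q \<in> borel_measurable (lam x)" if "x \<in> units G" for x
      unfolding q_def[abs_def] using Em[OF that] by (intro borel_measurable_sum) auto
    have qnu: "q \<in> borel_measurable nu"
      unfolding q_def[abs_def] using E nu.compact_sets by (intro borel_measurable_sum) auto
    have q_lam: "(\<integral>\<^sup>+s. q s \<partial>lam x) = (\<Sum>k\<in>{1..m}. ennreal (1 / real n) * emeasure (lam x) (E k))"
      if "x \<in> units G" for x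
      unfolding q_def using Em[OF that] by (subst nn_integral_sum) (auto simp: nn_integral_cmult_indicator)
    have q_eq: "(\<integral>\<^sup>+s. q s \<partial>nu) = (\<integral>\<^sup>+x. (\<integral>\<^sup>+s. q s \<partial>lam x) \<partial>mu)"
    proof -
      have "(\<integral>\<^sup>+s. q s \<partial>nu) = (\<Sum>k\<in>{1..m}. ennreal (1 / real n) * emeasure nu (E k))"
        unfolding q_def using E nu.compact_sets by (subst nn_integral_sum) (auto simp: nn_integral_cmult_indicator)
      also have "\<dots> = (\<Sum>k\<in>{1..m}. \<integral>\<^sup>+x. ennreal (1 / real n) * emeasure (lam x) (E k) \<partial>mu)"
        using E by (intro sum.cong) (auto simp: nu_compact lam_compact_measurable nn_integral_cmult)
      also have "\<dots> = (\<integral>\<^sup>+x. (\<Sum>k\<in>{1..m}. ennreal (1 / real n) * emeasure (lam x) (E k)) \<partial>mu)"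
        using E lam_compact_measurable by (intro nn_integral_sum[symmetric]) auto
      also have "\<dots> = (\<integral>\<^sup>+x. (\<integral>\<^sup>+s. q s \<partial>lam x) \<partial>mu)"
        by (intro nn_integral_cong) (simp add: q_lam space_mu)
      finally show ?thesis .
    qed
    have q_lam_m: "(\<lambda>x. \<integral>\<^sup>+s. q s \<partial>lam x) \<in> borel_measurable mu"
    proof (subst measurable_cong)
      show "(\<integral>\<^sup>+s. q s \<partial>lam x) = (\<Sum>k\<in>{1..m}. ennreal (1 / real n) * emeasure (lam x) (E k))"
        if "x \<in> space mu" for x
        using q_lam that by (simp add: space_mu)
      show "(\<lambda>x. \<Sum>k\<in>{1..m}. ennreal (1 / real n) * emeasure (lam x) (E k)) \<in> borel_measurable mu"
        using E lam_compact_measurable by (intro borel_measurable_sum) auto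
    qed
    have sp: "space (lam x) = topspace (gtop G)" if "x \<in> units G" for x
      using regular_measure.space_eq[OF lam_regular[OF that]] .
    have lam_lower: "(\<integral>\<^sup>+s. q s \<partial>lam x) \<le> (\<integral>\<^sup>+s. ennreal (F s) \<partial>lam x)" if "x \<in> units G" for x
      using q(1) sp[OF that] by (intro nn_integral_mono) auto
    have lam_upper: "(\<integral>\<^sup>+s. ennreal (F s) \<partial>lam x) \<le> (\<integral>\<^sup>+s. q s \<partial>lam x) + ennreal (1 / real n) * emeasure (lam x) C"
      if x: "x \<in> units G" for x
    proof -
      have "(\<integral>\<^sup>+s. ennreal (F s) \<partial>lam x) \<le> (\<integral>\<^sup>+s. q s + ennreal (1 / real n) * indicator C s \<partial>lam x)"
        using q(2) sp[OF that] by (intro nn_integral_mono) auto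
      also have "\<dots> = (\<integral>\<^sup>+s. q s \<partial>lam x) + ennreal (1 / real n) * emeasure (lam x) C"
        using qm[OF x] Cm[OF x] by (subst nn_integral_add) (auto simp: nn_integral_cmult_indicator)
      finally show ?thesis .
    qed
    have "(\<integral>\<^sup>+s. ennreal (F s) \<partial>nu) \<le> (\<integral>\<^sup>+s. q s + ennreal (1 / real n) * indicator C s \<partial>nu)"
      using q(2) nu.space_eq by (intro nn_integral_mono) auto
    also have "\<dots> = (\<integral>\<^sup>+s. q s \<partial>nu) + ennreal (1 / real n) * emeasure nu C"
      using qnu nu.compact_sets[OF C(1)] by (subst nn_integral_add) (auto simp: nn_integral_cmult_indicator)
    also have "(\<integral>\<^sup>+s. q s \<partial>nu) \<le> (\<integral>\<^sup>+x. (\<integral>\<^sup>+s. ennreal (F s) \<partial>lam x) \<partial>mu)"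
      unfolding q_eq by (rule nn_integral_mono) (simp add: space_mu lam_lower)
    finally have 1: "(\<integral>\<^sup>+s. ennreal (F s) \<partial>nu)
      \<le> (\<integral>\<^sup>+x. (\<integral>\<^sup>+s. ennreal (F s) \<partial>lam x) \<partial>mu) + ennreal (1 / real n) * emeasure nu C"
      by (simp add: add_right_mono)
    have "(\<integral>\<^sup>+x. (\<integral>\<^sup>+s. ennreal (F s) \<partial>lam x) \<partial>mu)
      \<le> (\<integral>\<^sup>+x. (\<integral>\<^sup>+s. q s \<partial>lam x) + ennreal (1 / real n) * emeasure (lam x) C \<partial>mu)"
      using lam_upper by (intro nn_integral_mono) (simp add: space_mu)
    also have "\<dots> = (\<integral>\<^sup>+s. q s \<partial>nu) + ennreal (1 / real n) * emeasure nu C"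
      using q_lam_m lam_compact_measurable[OF C(1)]
      by (subst nn_integral_add) (auto simp: q_eq nu_compact[OF C(1)] nn_integral_cmult)
    also have "(\<integral>\<^sup>+s. q s \<partial>nu) \<le> (\<integral>\<^sup>+s. ennreal (F s) \<partial>nu)"
      using q(1) nu.space_eq by (intro nn_integral_mono) auto
    finally have 2: "(\<integral>\<^sup>+x. (\<integral>\<^sup>+s. ennreal (F s) \<partial>lam x) \<partial>mu)
      \<le> (\<integral>\<^sup>+s. ennreal (F s) \<partial>nu) + ennreal (1 / real n) * emeasure nu C"
      by (simp add: add_right_mono)
    show ?thesis using 1 2 by blast
  qed
  have small: "\<exists>n::nat. 0 < n \<and> ennreal (1 / real n) * emeasure nu C \<le> ennreal e" if e: "0 < e" for e :: real
  proof -
    obtain r where r: "emeasure nu C = ennreal r" "0 \<le> r"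
      using nu.compact_finite[OF C(1)] by (cases "emeasure nu C") auto
    obtain n :: nat where n: "r / e < real n" using reals_Archimedean2 by blast
    then have "0 < real n" using r e by (meson divide_nonneg_pos le_less_trans)
    then have "1 / real n * r \<le> e"
      using n e by (simp add: field_simps)
    then show ?thesis
      using r \<open>0 < real n\<close> by (intro exI[of _ n]) (auto simp: ennreal_mult[symmetric] intro!: ennreal_leI)
  qed
  show ?thesis
  proof (rule antisym; rule ennreal_le_epsilon)
    fix e :: real assume "0 < e"
    then obtain n :: nat where n: "0 < n" "ennreal (1 / real n) * emeasure nu C \<le> ennreal e"
      using small by blast
    show "(\<integral>\<^sup>+s. ennreal (F s) \<partial>nu) \<le> (\<integral>\<^sup>+x. (\<integral>\<^sup>+s. ennreal (F s) \<partial>lam x) \<partial>mu) + ennreal e"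
      "(\<integral>\<^sup>+x. (\<integral>\<^sup>+s. ennreal (F s) \<partial>lam x) \<partial>mu) \<le> (\<integral>\<^sup>+s. ennreal (F s) \<partial>nu) + ennreal e"
      using key[OF n(1)] n(2) by (meson add_left_mono order_trans)+
  qed
qed

corollary nn_integral_composition':
  assumes F: "compact_supp (gtop G) F" "\<And>s. 0 \<le> F s"
  shows "(\<integral>\<^sup>+s. ennreal (F s) \<partial>nu) = (\<integral>\<^sup>+x. ennreal (\<integral>s. F s \<partial>lam x) \<partial>mu)"
  unfolding nn_integral_composition[OF F]
  by (intro nn_integral_cong regular_measure.compact_supp_nn_integral[OF lam_regular])
    (auto simp: space_mu F)

text \<open>The integral of a bump at \<open>h\<close> over the fibre of \<open>rng G h\<close> is
  positive. By continuity it exceeds half that value over a neighbourhood of \<open>rng G h\<close>,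
  to which \<open>mu\<close> gives positive mass.\<close>

lemma nu_fully_supported: "fully_supported (gtop G) nu"
  unfolding fully_supported_def measure_support_def
proof (intro equalityI subsetI CollectI conjI allI impI)
  fix h U assume h: "h \<in> topspace (gtop G)" and U: "openin (gtop G) U \<and> h \<in> U"
  have hU: "compactin (gtop G) {h}" "{h} \<subseteq> U" using h U by auto
  obtain u :: "'a \<Rightarrow> real" and N L where u: "compact_supp (gtop G) u" "\<And>y. 0 \<le> u y" "\<And>y. u y \<le> 1"
    "{h} \<subseteq> N" "\<And>y. y \<in> N \<Longrightarrow> u y = 1" "L \<subseteq> U" "\<And>y. y \<notin> L \<Longrightarrow> u y = 0"
    using bump_function[OF locally_compact Hausdorff hU(1) _ hU(2)] U by metis
  define c where "c = (\<integral>s. u s \<partial>lam (rng G h)) / 2"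
  have ha: "h \<in> arrows G" using h topspace_gtop by simp
  have c: "0 < c"
    unfolding c_def using ha u
    by (intro half_gt_zero integral_pos_fiber[OF rng_in_units[OF ha] u(1), of h]) (auto simp: fiber_def)
  define W where "W = {x \<in> topspace (unit_top G). (\<integral>s. u s \<partial>lam x) \<in> {c<..}}"
  have W: "openin (unit_top G) W"
    unfolding W_def using openin_continuous_map_preimage[OF haar_continuous_real[OF u(1)], of "{c<..}"] by simp
  have "rng G h \<in> W"
    unfolding W_def using ha c by (simp add: topspace_unit_top rng_in_units c_def)
  then have "0 < emeasure mu W"
    using mu(2) W openin_subset[OF W] unfolding fully_supported_def measure_support_def by blast
  then have "0 < ennreal c * emeasure mu W"
    using c by (simp add: ennreal_zero_less_mult_iff)
  also have "\<dots> = (\<integral>\<^sup>+x. ennreal c * indicator W x \<partial>mu)"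
    using mu.open_sets[OF W] by (simp add: nn_integral_cmult_indicator)
  also have "\<dots> \<le> (\<integral>\<^sup>+x. ennreal (\<integral>s. u s \<partial>lam x) \<partial>mu)"
    by (intro nn_integral_mono) (auto simp: W_def indicator_def intro!: ennreal_leI)
  also have "\<dots> = (\<integral>\<^sup>+s. ennreal (u s) \<partial>nu)"
    using nn_integral_composition'[OF u(1,2)] by simp
  also have "\<dots> \<le> (\<integral>\<^sup>+s. indicator U s \<partial>nu)"
  proof (intro nn_integral_mono)
    fix s show "ennreal (u s) \<le> indicator U s"
      using u(3)[of s] subsetD[OF u(6), of s] u(7)[of s] by (cases "s \<in> L") auto
  qed
  also have "\<dots> = emeasure nu U"
    using U nu.open_sets by simp
  finally show "0 < emeasure nu U" .
qed auto

end

section \<open>Isometric isomorphisms of convolution algebras\<close>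

lemma (in groupoid) idempotent_is_unit:
  assumes "(a, a) \<in> composable G" "gmult G a a = a"
  shows "src G a = a"
  using gdiv_gmult[OF assms(1)] assms(2) by (simp add: src_def)

locale groupoid_morphism = G: groupoid G + H: groupoid H
  for G :: "('a, 'm) groupoid_scheme" and H :: "('b, 'n) groupoid_scheme" +
  fixes \<phi> :: "'b \<Rightarrow> 'a"
  assumes hom: "groupoid_hom H G \<phi>"
begin

lemma hom_arrow: "a \<in> arrows H \<Longrightarrow> \<phi> a \<in> arrows G"
  and hom_comp: "(a, b) \<in> composable H \<Longrightarrow> (\<phi> a, \<phi> b) \<in> composable G"
  and hom_mult: "(a, b) \<in> composable H \<Longrightarrow> \<phi> (gmult H a b) = gmult G (\<phi> a) (\<phi> b)"
  using hom unfolding groupoid_hom_def by blast+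

text \<open>\<open>groupoid_hom\<close> speaks only of products. Units are idempotent, products keep
  them so, and an idempotent arrow is a unit.\<close>

lemma hom_unit:
  assumes "u \<in> units H"
  shows "\<phi> u \<in> units G"
proof -
  have u: "u \<in> arrows H" "src H u = u" "rng H u = u"
    using assms H.unit_arrow H.src_unit H.rng_unit by auto
  then have c: "(u, u) \<in> composable H" by (simp add: H.composable_iff)
  have "gmult H u u = u" using H.gmult_src_id[OF u(1)] u(2) by simp
  then show ?thesis
    using G.idempotent_is_unit[OF hom_comp[OF c]] hom_mult[OF c] hom_arrow[OF u(1)]
    by (simp add: G.units_iff)
qed

lemma hom_rng:
  assumes "a \<in> arrows H"
  shows "\<phi> (rng H a) = rng G (\<phi> a)"
proof -
  have "(rng H a, a) \<in> composable H"
    using assms H.rng_in_units H.unit_arrow H.src_unit by (simp add: H.composable_iff)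
  then show ?thesis
    using hom_comp G.src_unit[OF hom_unit[OF H.rng_in_units[OF assms]]] by (auto simp: G.composable_iff)
qed

lemma hom_gdiv:
  assumes "a \<in> arrows H" "b \<in> arrows H" "rng H a = rng H b"
  shows "\<phi> (gmult H (ginv H a) b) = gmult G (ginv G (\<phi> a)) (\<phi> b)"
  using G.gdiv_gmult[OF hom_comp[OF H.gmult_gdiv(1)[OF assms]]] hom_mult[OF H.gmult_gdiv(1)[OF assms]]
    H.gmult_gdiv(2)[OF assms] by simp

end

context haar_groupoid
begin

text \<open>The integrand is nonnegative on the fibre and equals \<open>f a * g b\<close> at the
  point \<open>a\<close>, so full support makes the integral positive.\<close>

lemma convolution_pos:
  assumes f: "compact_supp (gtop G) f" "\<And>s. 0 \<le> f s" and g: "compact_supp (gtop G) g" "\<And>s. 0 \<le> g s"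
    and c: "(a, b) \<in> composable G" and pos: "0 < f a" "0 < g b"
  shows "convolution G lam (\<lambda>s. complex_of_real (f s)) (\<lambda>s. complex_of_real (g s)) (gmult G a b) \<noteq> 0"
proof -
  have ab: "gmult G a b \<in> arrows G" "rng G (gmult G a b) = rng G a" "a \<in> arrows G"
    using gmult_closed[OF c] rng_gmult[OF c] c by (auto simp: composable_iff)
  obtain F where F: "compact_supp (gtop G) F"
    "\<And>s. s \<in> fiber G (rng G (gmult G a b)) \<Longrightarrow>
      F s = complex_of_real (f s) * complex_of_real (g (gmult G (ginv G s) (gmult G a b)))"
    "convolution G lam (\<lambda>s. complex_of_real (f s)) (\<lambda>s. complex_of_real (g s)) (gmult G a b)
      = (\<integral>s. F s \<partial>lam (rng G (gmult G a b)))"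
    using convolution_extension[OF compact_supp_of_real[OF f(1)] compact_supp_of_real[OF g(1)] ab(1)] by metis
  have u: "rng G (gmult G a b) \<in> units G" using rng_in_units[OF ab(1)] .
  have a: "a \<in> fiber G (rng G (gmult G a b))" using ab by (simp add: fiber_def)
  have "0 < (\<integral>s. Re (F s) \<partial>lam (rng G (gmult G a b)))"
    using F(2) f(2) g(2) pos gdiv_gmult[OF c] a
    by (intro integral_pos_fiber[OF u compact_supp_Re[OF F(1)] _ a]) auto
  also have "\<dots> = Re (\<integral>s. F s \<partial>lam (rng G (gmult G a b)))"
    using regular_measure.compact_supp_integrable[OF lam_regular[OF u] F(1)] by simp
  finally show ?thesis
    using F(3) by auto
qed

text \<open>The value 0 off the units lets this count as a compactly supported function on the unit
  space, since \<open>compact_supp\<close> demands vanishing outside the space.\<close>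

definition fiber_int :: "('a \<Rightarrow> real) \<Rightarrow> 'a \<Rightarrow> real" where
  "fiber_int F x = (if x \<in> units G then \<integral>s. F s \<partial>lam x else 0)"

lemma compact_supp_fiber_int:
  assumes "compact_supp (gtop G) F"
  shows "compact_supp (unit_top G) (fiber_int F)"
proof -
  obtain C where C: "compactin (gtop G) C" "\<And>x. x \<notin> C \<Longrightarrow> F x = 0"
    using assms compact_suppE by blast
  have "continuous_map (unit_top G) euclideanreal (fiber_int F)"
    by (rule continuous_map_eq[OF haar_continuous_real[OF assms]]) (simp add: fiber_int_def topspace_unit_top)
  moreover have "compactin (unit_top G) (rng G ` C)"
    using image_compactin[OF C(1) continuous_rng_unit] .
  moreover have "fiber_int F x = 0" if "x \<notin> rng G ` C" for x
  proof (cases "x \<in> units G")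
    case True
    have "(\<integral>s. F s \<partial>lam x) = 0"
    proof (rule integral_eq_zero_AE)
      show "AE s in lam x. F s = 0"
        using AE_fiber[OF True] by eventually_elim (use that C(2) in \<open>auto simp: fiber_def\<close>)
    qed
    then show ?thesis by (simp add: fiber_int_def)
  qed (simp add: fiber_int_def)
  ultimately show ?thesis
    unfolding compact_supp_def by blast
qed

lemma fiber_int_nonneg: "(\<And>s. 0 \<le> F s) \<Longrightarrow> 0 \<le> fiber_int F x"
  unfolding fiber_int_def by (auto intro: integral_nonneg_AE)

lemma compact_supp_mult_rng:
  assumes "compact_supp (gtop G) F" "continuous_map (unit_top G) euclideanreal v"
  shows "compact_supp (gtop G) (\<lambda>s. v (rng G s) * F s)"
  using compact_supp_mult_right(1)[OF _ assms(1)] continuous_map_compose[OF continuous_rng_unit assms(2)]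
  by (simp add: comp_def)

lemma fiber_int_mult_rng:
  assumes F: "compact_supp (gtop G) F" and v: "continuous_map (unit_top G) euclideanreal v" and x: "x \<in> units G"
  shows "fiber_int (\<lambda>s. v (rng G s) * F s) x = v x * fiber_int F x"
proof -
  interpret R: regular_measure "gtop G" "lam x" using lam_regular[OF x] .
  have "(\<integral>s. v (rng G s) * F s \<partial>lam x) = (\<integral>s. v x * F s \<partial>lam x)"
  proof (rule integral_cong_AE)
    show "(\<lambda>s. v (rng G s) * F s) \<in> borel_measurable (lam x)" "(\<lambda>s. v x * F s) \<in> borel_measurable (lam x)"
      using R.continuous_measurable compact_supp_continuous compact_supp_mult_rng[OF F v]
        compact_supp_const_mult[OF F] by blast+
    show "AE s in lam x. v (rng G s) * F s = v x * F s"
      using AE_fiber[OF x] by eventually_elim (simp add: fiber_def)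
  qed
  then show ?thesis using x by (simp add: fiber_int_def)
qed

end

text \<open>The maps \<open>\<phi>\<close>, \<open>\<psi>\<close> and the weight \<open>w\<close>
  are those delivered by \<open>weighted_composition\<close>; the convolution now enters on top of
  the weighted composition formula.\<close>

locale convolution_isometry = G: haar_composition K G lamG muG nuG + H: haar_composition K H lamH muH nuH
  for K :: "complex set" and G :: "'a top_groupoid" and lamG muG nuG
    and H :: "'b top_groupoid" and lamH muH nuH +
  fixes T :: "('a \<Rightarrow> complex) \<Rightarrow> 'b \<Rightarrow> complex" and \<phi> \<psi> and w :: "'b \<Rightarrow> complex"
  assumes homeo: "homeomorphic_maps (gtop H) (gtop G) \<phi> \<psi>"
    and w_cont: "continuous_map (gtop H) euclidean w" and w_nz: "h \<in> arrows H \<Longrightarrow> w h \<noteq> 0"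
    and T_eq: "\<lbrakk>f \<in> Cc K (gtop G); h \<in> arrows H\<rbrakk> \<Longrightarrow> T f h = w h * f (\<phi> h)"
    and T_surj: "k \<in> Cc K (gtop H) \<Longrightarrow> \<exists>f \<in> Cc K (gtop G). T f = k"
    and T_conv: "\<lbrakk>f \<in> Cc K (gtop G); g \<in> Cc K (gtop G)\<rbrakk> \<Longrightarrow>
      T (convolution G lamG f g) = convolution H lamH (T f) (T g)"
    and T_in: "f \<in> Cc K (gtop G) \<Longrightarrow> T f \<in> Cc K (gtop H)"
    and T_norm: "f \<in> Cc K (gtop G) \<Longrightarrow> L1_norm nuH (T f) = L1_norm nuG f"
begin

section \<open>The point map is a groupoid morphism\<close>

lemma phi_cont: "continuous_map (gtop H) (gtop G) \<phi>" and psi_cont: "continuous_map (gtop G) (gtop H) \<psi>"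
  and psi_phi: "h \<in> arrows H \<Longrightarrow> \<psi> (\<phi> h) = h" and phi_psi: "a \<in> arrows G \<Longrightarrow> \<phi> (\<psi> a) = a"
  using homeo unfolding homeomorphic_maps_def G.topspace_gtop H.topspace_gtop by blast+

lemma phi_arrow: "h \<in> arrows H \<Longrightarrow> \<phi> h \<in> arrows G" and psi_arrow: "a \<in> arrows G \<Longrightarrow> \<psi> a \<in> arrows H"
  using phi_cont psi_cont unfolding continuous_map_def G.topspace_gtop H.topspace_gtop by auto

text \<open>The support of a convolution lies in the product of the supports, and bumps around \<open>a\<close> and
  \<open>b\<close> have a convolution that does not vanish at \<open>ab\<close>; since \<open>T\<close> moves supports by \<open>\<phi>\<close>,
  \<open>\<phi> (ab)\<close> is a limit of products of elements close to \<open>\<phi> a\<close> and \<open>\<phi> b\<close>.\<close>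

lemma phi_hom: "groupoid_hom H G \<phi>"
proof -
  have "(\<phi> a, \<phi> b) \<in> composable G \<and> \<phi> (gmult H a b) = gmult G (\<phi> a) (\<phi> b)"
    if c: "(a, b) \<in> composable H" for a b
  proof (rule ccontr)
    have ab: "a \<in> arrows H" "b \<in> arrows H" "gmult H a b \<in> arrows H"
      using c H.gmult_closed by (auto simp: H.composable_iff)
    \<comment> \<open>Composability and the value of the product are packed into one closed set: a
      failure of either puts the pair \<open>(\<phi> a, \<phi> b)\<close> outside it, and the same
      open box \<open>U \<times> V\<close> refutes both.\<close>
    define B where "B = {z \<in> topspace (subtopology (prod_topology (gtop G) (gtop G)) (composable G)).
      (case z of (s, t) \<Rightarrow> gmult G s t) \<in> {\<phi> (gmult H a b)}}"
    have B_iff: "(s, t) \<in> B \<longleftrightarrow> (s, t) \<in> composable G \<and> gmult G s t = \<phi> (gmult H a b)" for s t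
      unfolding B_def by (auto simp: G.topspace_gtop G.composable_iff)
    assume "\<not> ((\<phi> a, \<phi> b) \<in> composable G \<and> \<phi> (gmult H a b) = gmult G (\<phi> a) (\<phi> b))"
    then have nB: "(\<phi> a, \<phi> b) \<notin> B" using B_iff by auto
    have "closedin (gtop G) {\<phi> (gmult H a b)}"
      using phi_arrow ab G.Hausdorff by (intro closedin_Hausdorff_singleton) (auto simp: G.topspace_gtop)
    then have "closedin (subtopology (prod_topology (gtop G) (gtop G)) (composable G)) B"
      unfolding B_def by (rule closedin_continuous_map_preimage[OF G.continuous_gmult])
    then have "closedin (prod_topology (gtop G) (gtop G)) B"
      using G.composable_closed closedin_closed_subtopology by blast
    then have "openin (prod_topology (gtop G) (gtop G)) (arrows G \<times> arrows G - B)"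
      by (simp add: closedin_def G.topspace_gtop)
    then obtain U V where UV: "openin (gtop G) U" "openin (gtop G) V" "\<phi> a \<in> U" "\<phi> b \<in> V"
        "U \<times> V \<subseteq> arrows G \<times> arrows G - B"
      using nB ab phi_arrow unfolding openin_prod_topology_alt by (metis DiffI SigmaI)
    have bump: "\<exists>u :: 'b \<Rightarrow> real. compact_supp (gtop H) u \<and> (\<forall>s. 0 \<le> u s) \<and> 0 < u h
        \<and> (\<forall>s. u s \<noteq> 0 \<longrightarrow> \<phi> s \<in> W)"
      if W: "openin (gtop G) W" and h: "h \<in> arrows H" "\<phi> h \<in> W" for W h
    proof -
      define P where "P = {s \<in> topspace (gtop H). \<phi> s \<in> W}"
      have o: "openin (gtop H) P"
        unfolding P_def using phi_cont W by (rule openin_continuous_map_preimage)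
      have h': "compactin (gtop H) {h}" "{h} \<subseteq> P"
        using h by (auto simp: H.topspace_gtop P_def)
      obtain u :: "'b \<Rightarrow> real" and N L where u: "compact_supp (gtop H) u" "\<And>y. 0 \<le> u y" "{h} \<subseteq> N"
        "\<And>y. y \<in> N \<Longrightarrow> u y = 1" "L \<subseteq> P" "\<And>y. y \<notin> L \<Longrightarrow> u y = 0"
        using bump_function[OF H.locally_compact H.Hausdorff h'(1) o h'(2)] by metis
      have "0 < u h" using u(3,4) by simp
      moreover have "\<phi> s \<in> W" if "u s \<noteq> 0" for s
        using u(5) u(6)[of s] that unfolding P_def by blast
      ultimately show ?thesis using u(1,2) by blast
    qed
    obtain u :: "'b \<Rightarrow> real" where u: "compact_supp (gtop H) u" "\<And>s. 0 \<le> u s" "0 < u a" "\<And>s. u s \<noteq> 0 \<Longrightarrow> \<phi> s \<in> U"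
      using bump[OF UV(1) ab(1) UV(3)] by blast
    obtain v :: "'b \<Rightarrow> real" where v: "compact_supp (gtop H) v" "\<And>s. 0 \<le> v s" "0 < v b" "\<And>s. v s \<noteq> 0 \<Longrightarrow> \<phi> s \<in> V"
      using bump[OF UV(2) ab(2) UV(4)] by blast
    obtain f where f: "f \<in> Cc K (gtop G)" "T f = (\<lambda>s. complex_of_real (u s))"
      using T_surj[OF H.Cc_G(5)[OF u(1)]] by blast
    obtain g where g: "g \<in> Cc K (gtop G)" "T g = (\<lambda>s. complex_of_real (v s))"
      using T_surj[OF H.Cc_G(5)[OF v(1)]] by blast
    have "T (convolution G lamG f g) (gmult H a b) \<noteq> 0"
      using H.convolution_pos[OF u(1,2) v(1,2) c u(3) v(3)] T_conv[OF f(1) g(1)] f(2) g(2) by simp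
    then have "convolution G lamG f g (\<phi> (gmult H a b)) \<noteq> 0"
      using T_eq[OF G.convolution_in_Cc[OF f(1) g(1)] ab(3)] by auto
    then obtain s where s: "\<phi> (gmult H a b) \<in> arrows G" "s \<in> arrows G" "rng G s = rng G (\<phi> (gmult H a b))"
        "f s \<noteq> 0" "g (gmult G (ginv G s) (\<phi> (gmult H a b))) \<noteq> 0"
      by (rule G.convolution_nonzeroD)
    define t where "t = gmult G (ginv G s) (\<phi> (gmult H a b))"
    have t: "t \<in> arrows G" "(s, t) \<in> B"
      unfolding t_def using s G.gdiv_closed G.gmult_gdiv[of s "\<phi> (gmult H a b)"] by (auto simp: B_iff)
    have "T f (\<psi> s) \<noteq> 0" "T g (\<psi> t) \<noteq> 0"
      using T_eq[OF f(1) psi_arrow[OF s(2)]] T_eq[OF g(1) psi_arrow[OF t(1)]] w_nz psi_arrow s t phi_psi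
      by (auto simp: t_def)
    then have "s \<in> U" "t \<in> V"
      using f(2) g(2) u(4)[of "\<psi> s"] v(4)[of "\<psi> t"] phi_psi s t by auto
    then show False using UV(5) t(2) by blast
  qed
  then show ?thesis
    unfolding groupoid_hom_def using phi_arrow by blast
qed

sublocale phi: groupoid_morphism G H \<phi>
  by unfold_locales (rule phi_hom)

lemma psi_unit:
  assumes "x \<in> units G"
  shows "\<psi> x \<in> units H"
proof -
  have x: "x \<in> arrows G" "rng G x = x" using assms G.unit_arrow G.rng_unit by auto
  then have "\<phi> (rng H (\<psi> x)) = x"
    using phi.hom_rng[OF psi_arrow[OF x(1)]] phi_psi by simp
  then have "\<psi> x = rng H (\<psi> x)"
    using psi_phi[of "rng H (\<psi> x)"] H.rng_in_units[OF psi_arrow[OF x(1)]] H.unit_arrow by auto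
  then show ?thesis using H.rng_in_units[OF psi_arrow[OF x(1)]] by simp
qed

lemma psi_fiber:
  assumes "y \<in> units H" "s \<in> fiber G (\<phi> y)"
  shows "\<psi> s \<in> fiber H y"
proof -
  have s: "s \<in> arrows G" "rng G s = \<phi> y" using assms(2) by (auto simp: fiber_def)
  then have "\<phi> (rng H (\<psi> s)) = \<phi> y"
    using phi.hom_rng[OF psi_arrow[OF s(1)]] phi_psi by simp
  then have "rng H (\<psi> s) = y"
    using psi_phi H.unit_arrow H.rng_in_units[OF psi_arrow[OF s(1)]] assms(1) by metis
  then show ?thesis using psi_arrow s by (simp add: fiber_def)
qed

definition transport :: "('b \<Rightarrow> real) \<Rightarrow> 'a \<Rightarrow> real" where
  "transport F s = (if s \<in> arrows G then F (\<psi> s) else 0)"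

lemma compact_supp_transport:
  assumes "compact_supp (gtop H) F"
  shows "compact_supp (gtop G) (transport F)"
  using compact_supp_homeomorphic[OF assms homeo] by (simp add: transport_def[abs_def] G.topspace_gtop)

lemma transport_phi: "h \<in> arrows H \<Longrightarrow> transport F (\<phi> h) = F h"
  by (simp add: transport_def phi_arrow psi_phi)

lemma transport_nonneg: "(\<And>t. 0 \<le> F t) \<Longrightarrow> 0 \<le> transport F s"
  by (simp add: transport_def)

section \<open>The cocycle identity of the weight\<close>

lemma gdiv_weight_continuous:
  assumes h: "h \<in> fiber H y"
  shows "continuous_map (subtopology (gtop H) (fiber H y)) euclidean (\<lambda>t. w t * w (gmult H (ginv H t) h))"
proof -
  have h': "h \<in> arrows H" "y = rng H h" using h by (auto simp: fiber_def)
  show ?thesis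
    using continuous_map_compose[OF H.continuous_gdiv_fiber[OF h'(1)] w_cont]
      continuous_map_from_subtopology[OF w_cont, of "fiber H y"]
    by (intro continuous_map_mult_algebra) (auto simp: h'(2) comp_def)
qed

text \<open>Testing the convolution identity at \<open>\<phi> h\<close> against a \<open>g\<close> that is \<open>1\<close> wherever it matters.\<close>

lemma weight_integral:
  assumes y: "y \<in> units H" and h: "h \<in> fiber H y" and F: "compact_supp (gtop H) F"
  shows "w h * complex_of_real (\<integral>s. transport F s \<partial>lamG (\<phi> y)) =
    set_lebesgue_integral (lamH y) (fiber H y)
      (\<lambda>t. (w t * w (gmult H (ginv H t) h)) * complex_of_real (F t))"
proof -
  have h': "h \<in> arrows H" "rng H h = y" using h by (auto simp: fiber_def)
  have ph: "\<phi> h \<in> arrows G" "rng G (\<phi> h) = \<phi> y"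
    using phi_arrow[OF h'(1)] phi.hom_rng[OF h'(1)] h'(2) by auto
  have py: "\<phi> y \<in> units G" using phi.hom_unit[OF y] .
  obtain C where C: "compactin (gtop H) C" "\<And>x. x \<notin> C \<Longrightarrow> F x = 0"
    using F compact_suppE by blast
  \<comment> \<open>In the convolution at \<open>\<phi> h\<close> the values of \<open>g\<close>
    matter only at the points \<phi>(t\<inverse>h) with \<open>t\<close> in the fibre and in the
    support of \<open>F\<close>; these lie in a compact set.\<close>
  define Q where "Q = (\<lambda>t. \<phi> (gmult H (ginv H t) h)) ` (fiber H y \<inter> C)"
  have "compactin (subtopology (gtop H) (fiber H y)) (fiber H y \<inter> C)"
    using closed_Int_compactin[OF H.fiber_closed[OF y] C(1)] by (simp add: compactin_subtopology)
  moreover have "continuous_map (subtopology (gtop H) (fiber H y)) (gtop G) (\<lambda>t. \<phi> (gmult H (ginv H t) h))"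
    using continuous_map_compose[OF H.continuous_gdiv_fiber[OF h'(1)] phi_cont] h'(2) by (simp add: comp_def)
  ultimately have Q: "compactin (gtop G) Q"
    unfolding Q_def by (rule image_compactin)
  obtain u :: "'a \<Rightarrow> real" and N where u: "compact_supp (gtop G) u" "Q \<subseteq> N" "\<And>y. y \<in> N \<Longrightarrow> u y = 1"
    using bump_function[OF G.locally_compact G.Hausdorff Q openin_topspace compactin_subset_topspace[OF Q]] by metis
  define f where "f s = complex_of_real (transport F s)" for s
  define g where "g s = complex_of_real (u s)" for s
  have fc: "compact_supp (gtop G) f"
    unfolding f_def[abs_def] by (intro compact_supp_of_real compact_supp_transport F)
  have f: "f \<in> Cc K (gtop G)" and g: "g \<in> Cc K (gtop G)"
    unfolding f_def[abs_def] g_def[abs_def] using G.Cc_G(5) compact_supp_transport[OF F] u(1) by blast+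
  have g1: "g (\<phi> (gmult H (ginv H t) h)) = 1" if "t \<in> fiber H y" "F t \<noteq> 0" for t
  proof -
    have "t \<in> C" using C(2) that(2) by blast
    then have "\<phi> (gmult H (ginv H t) h) \<in> Q"
      unfolding Q_def using that(1) by blast
    then show ?thesis using u(2,3) unfolding g_def by auto
  qed
  have "convolution G lamG f g (\<phi> h) = (\<integral>s. f s \<partial>lamG (\<phi> y))"
    unfolding convolution_def ph(2) using ph(1)
  proof (simp, intro G.fiber_integral[OF py fc])
    fix s assume s: "s \<in> fiber G (\<phi> y)"
    have t: "\<psi> s \<in> fiber H y" using psi_fiber[OF y s] .
    have sa: "s \<in> arrows G" using s by (simp add: fiber_def)
    show "f s * g (gmult G (ginv G s) (\<phi> h)) = f s"
    proof (cases "F (\<psi> s) = 0")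
      case True then show ?thesis using sa by (simp add: f_def transport_def)
    next
      case False
      have "\<phi> (gmult H (ginv H (\<psi> s)) h) = gmult G (ginv G s) (\<phi> h)"
        using phi.hom_gdiv[of "\<psi> s" h] t h' phi_psi[OF sa] by (simp add: fiber_def)
      then show ?thesis using g1[OF t False] by simp
    qed
  qed
  also have "\<dots> = complex_of_real (\<integral>s. transport F s \<partial>lamG (\<phi> y))"
    unfolding f_def by simp
  finally have 1: "T (convolution G lamG f g) h = w h * complex_of_real (\<integral>s. transport F s \<partial>lamG (\<phi> y))"
    using T_eq[OF G.convolution_in_Cc[OF f g] h'(1)] by simp
  have "T (convolution G lamG f g) h = set_lebesgue_integral (lamH y) (fiber H y)
      (\<lambda>t. T f t * T g (gmult H (ginv H t) h))"
    using T_conv[OF f g] h' by (simp add: convolution_def)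
  also have "\<dots> = set_lebesgue_integral (lamH y) (fiber H y)
      (\<lambda>t. (w t * w (gmult H (ginv H t) h)) * complex_of_real (F t))"
    unfolding set_lebesgue_integral_def
  proof (intro Bochner_Integration.integral_cong refl)
    fix t
    have "T f t * T g (gmult H (ginv H t) h) = (w t * w (gmult H (ginv H t) h)) * complex_of_real (F t)"
      if t: "t \<in> fiber H y"
    proof -
      have ta: "t \<in> arrows H" "rng H t = rng H h" using t h' by (auto simp: fiber_def)
      show ?thesis
        using T_eq[OF f ta(1)] T_eq[OF g H.gdiv_closed[OF ta(1) h'(1) ta(2)]] g1[OF t] transport_phi[OF ta(1), of F]
        by (cases "F t = 0") (auto simp: f_def)
    qed
    then show "indicat_real (fiber H y) t *\<^sub>R (T f t * T g (gmult H (ginv H t) h)) =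
      indicat_real (fiber H y) t *\<^sub>R ((w t * w (gmult H (ginv H t) h)) * complex_of_real (F t))"
      by (cases "t \<in> fiber H y") auto
  qed
  finally show ?thesis using 1 by simp
qed

lemma gdiv_unit: "t \<in> fiber H y \<Longrightarrow> gmult H (ginv H t) y = ginv H t"
  using H.gmult_src_id[OF H.ginv_closed, of t] H.src_ginv[of t] by (auto simp: fiber_def)

text \<open>\<open>weight_integral\<close> at \<open>h\<close> and at the unit \<open>y\<close>
  involves the same integral over \<open>G\<close>. Eliminating it shows that \<open>w y\<close>
  times one integrand and \<open>w h\<close> times the other agree against every test function,
  hence pointwise on the fibre; the common factor \<open>w t\<close> cancels.\<close>

lemma weight_gdiv:
  assumes y: "y \<in> units H" and t: "t \<in> fiber H y" and h: "h \<in> fiber H y"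
  shows "w (gmult H (ginv H t) h) * w y = w (ginv H t) * w h"
proof -
  define e1 where "e1 t = w t * w (gmult H (ginv H t) h)" for t
  define e2 where "e2 t = w t * w (gmult H (ginv H t) y)" for t
  have yf: "y \<in> fiber H y" using H.unit_in_fiber[OF y] .
  have c: "continuous_map (subtopology (gtop H) (fiber H y)) euclidean e1"
    "continuous_map (subtopology (gtop H) (fiber H y)) euclidean e2"
    unfolding e1_def[abs_def] e2_def[abs_def] using gdiv_weight_continuous h yf by blast+
  have "e1 t * w y - e2 t * w h = 0"
  proof (rule H.fiber_test_complex[OF y _ _ t])
    show "continuous_map (subtopology (gtop H) (fiber H y)) euclidean (\<lambda>t. e1 t * w y - e2 t * w h)"
      by (intro continuous_map_diff continuous_map_mult_algebra c continuous_map_canonical_const)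
    fix F :: "'b \<Rightarrow> real" assume F: "compact_supp (gtop H) F" "\<And>s. 0 \<le> F s"
    obtain F1 where F1: "compact_supp (gtop H) F1" "\<And>s. s \<in> fiber H y \<Longrightarrow> F1 s = e1 s * complex_of_real (F s)"
      "set_lebesgue_integral (lamH y) (fiber H y) (\<lambda>s. e1 s * complex_of_real (F s)) = (\<integral>s. F1 s \<partial>lamH y)"
      using H.fiber_extension[OF y c(1) compact_supp_of_real[OF F(1)]] by metis
    obtain F2 where F2: "compact_supp (gtop H) F2" "\<And>s. s \<in> fiber H y \<Longrightarrow> F2 s = e2 s * complex_of_real (F s)"
      "set_lebesgue_integral (lamH y) (fiber H y) (\<lambda>s. e2 s * complex_of_real (F s)) = (\<integral>s. F2 s \<partial>lamH y)"
      using H.fiber_extension[OF y c(2) compact_supp_of_real[OF F(1)]] by metis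
    have int: "integrable (lamH y) F1" "integrable (lamH y) F2"
      using regular_measure.compact_supp_integrable[OF H.lam_regular[OF y]] F1(1) F2(1) by blast+
    have cs: "compact_supp (gtop H) (\<lambda>s. w y * F1 s - w h * F2 s)"
      by (intro compact_supp_diff compact_supp_const_mult F1(1) F2(1))
    have "set_lebesgue_integral (lamH y) (fiber H y) (\<lambda>s. (e1 s * w y - e2 s * w h) * complex_of_real (F s))
        = (\<integral>s. w y * F1 s - w h * F2 s \<partial>lamH y)"
      by (rule H.fiber_integral[OF y cs]) (simp add: F1(2) F2(2) algebra_simps)
    also have "\<dots> = w y * (\<integral>s. F1 s \<partial>lamH y) - w h * (\<integral>s. F2 s \<partial>lamH y)"
      using int by simp
    also have "\<dots> = 0"
      using weight_integral[OF y h F(1), folded e1_def] weight_integral[OF y yf F(1), folded e2_def]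
      unfolding F1(3) F2(3) by (metis mult.left_commute right_minus_eq)
    finally show "set_lebesgue_integral (lamH y) (fiber H y)
      (\<lambda>s. (e1 s * w y - e2 s * w h) * complex_of_real (F s)) = 0" .
  qed
  moreover have "w t \<noteq> 0" using w_nz t by (auto simp: fiber_def)
  ultimately show ?thesis
    using gdiv_unit[OF t] by (simp add: e1_def e2_def algebra_simps)
qed

lemma weight_inv:
  assumes t: "t \<in> arrows H"
  shows "w t * w (ginv H t) = w (src H t) * w (rng H t)"
proof -
  have r: "rng H t \<in> units H" using H.rng_in_units[OF t] .
  have "w (src H t) * w (rng H t) = w (ginv H t) * w t"
    using weight_gdiv[OF r, of t t] t by (simp add: fiber_def src_def)
  then show ?thesis by (simp add: mult.commute)
qed

text \<open>Taking h = tk in \<open>weight_gdiv\<close> gives w(k) w(r(t)) = w(t\<inverse>) w(tk).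
  After multiplication by \<open>w t\<close>, \<open>weight_inv\<close> leaves the common nonzero
  factor w(r(t)).\<close>

lemma weight_mult:
  assumes c: "(t, k) \<in> composable H"
  shows "w t * w k = w (src H t) * w (gmult H t k)"
proof -
  have t: "t \<in> arrows H" using c by (simp add: H.composable_iff)
  have r: "rng H t \<in> units H" using H.rng_in_units[OF t] .
  have "w k * w (rng H t) = w (ginv H t) * w (gmult H t k)"
    using weight_gdiv[OF r, of t "gmult H t k"] H.gdiv_gmult[OF c] t H.gmult_closed[OF c] H.rng_gmult[OF c]
    by (simp add: fiber_def)
  then have "w t * w k * w (rng H t) = w t * w (ginv H t) * w (gmult H t k)"
    by (metis mult.assoc)
  also have "\<dots> = w (src H t) * w (gmult H t k) * w (rng H t)"
    using weight_inv[OF t] by (simp add: algebra_simps)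
  finally show ?thesis
    using w_nz[OF H.unit_arrow[OF r]] by simp
qed

section \<open>The density and its positivity\<close>

lemma src_weight_cont: "continuous_map (gtop H) euclidean (\<lambda>t. w (src H t))"
  using continuous_map_compose[OF H.continuous_src w_cont] by (simp add: comp_def)

text \<open>At \<open>h = y\<close> the two weights in \<open>weight_integral\<close> multiply to
  w(t) w(t\<inverse>) = w(s(t)) w(y), so \<open>w y\<close> cancels on both sides.\<close>

lemma src_weight_integral:
  assumes y: "y \<in> units H" and F: "compact_supp (gtop H) F"
  shows "(\<integral>t. w (src H t) * complex_of_real (F t) \<partial>lamH y) = complex_of_real (\<integral>s. transport F s \<partial>lamG (\<phi> y))"
proof -
  have yf: "y \<in> fiber H y" using H.unit_in_fiber[OF y] .
  have cs: "compact_supp (gtop H) (\<lambda>t. w (src H t) * complex_of_real (F t))"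
    by (intro compact_supp_mult_right src_weight_cont compact_supp_of_real F)
  have "w y * complex_of_real (\<integral>s. transport F s \<partial>lamG (\<phi> y)) =
    set_lebesgue_integral (lamH y) (fiber H y)
      (\<lambda>t. (w t * w (gmult H (ginv H t) y)) * complex_of_real (F t))"
    by (rule weight_integral[OF y yf F])
  also have "\<dots> = (\<integral>t. w y * (w (src H t) * complex_of_real (F t)) \<partial>lamH y)"
  proof (rule H.fiber_integral[OF y compact_supp_const_mult[OF cs]])
    fix t assume t: "t \<in> fiber H y"
    then show "(w t * w (gmult H (ginv H t) y)) * complex_of_real (F t)
        = w y * (w (src H t) * complex_of_real (F t))"
      using gdiv_unit[OF t] weight_inv[of t] by (simp add: fiber_def)
  qed
  also have "\<dots> = w y * (\<integral>t. w (src H t) * complex_of_real (F t) \<partial>lamH y)"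
    using regular_measure.compact_supp_integrable[OF H.lam_regular[OF y] cs] by simp
  finally show ?thesis
    using w_nz[OF H.unit_arrow[OF y]] by simp
qed

text \<open>A real density is wanted before w \<circ> s is known to be real;
  \<open>src_weight_real\<close> shows that the real part loses nothing.\<close>

definition \<delta> :: "'b \<Rightarrow> real" where "\<delta> t = Re (w (src H t))"

lemma \<delta>_cont: "continuous_map (gtop H) euclideanreal \<delta>"
  unfolding \<delta>_def[abs_def] by (rule continuous_map_Re[OF src_weight_cont])

lemma \<delta>_integral:
  assumes y: "y \<in> units H" and F: "compact_supp (gtop H) F"
  shows "(\<integral>t. \<delta> t * F t \<partial>lamH y) = (\<integral>s. transport F s \<partial>lamG (\<phi> y))"
    and "(\<integral>t. Im (w (src H t)) * F t \<partial>lamH y) = 0"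
proof -
  have "compact_supp (gtop H) (\<lambda>t. w (src H t) * complex_of_real (F t))"
    by (intro compact_supp_mult_right src_weight_cont compact_supp_of_real F)
  then have int: "integrable (lamH y) (\<lambda>t. w (src H t) * complex_of_real (F t))"
    using regular_measure.compact_supp_integrable[OF H.lam_regular[OF y]] by blast
  show "(\<integral>t. \<delta> t * F t \<partial>lamH y) = (\<integral>s. transport F s \<partial>lamG (\<phi> y))"
    using arg_cong[OF src_weight_integral[OF y F], of Re] integral_Re[OF int] by (simp add: \<delta>_def)
  show "(\<integral>t. Im (w (src H t)) * F t \<partial>lamH y) = 0"
    using arg_cong[OF src_weight_integral[OF y F], of Im] integral_Im[OF int] by simp
qed

text \<open>For real \<open>F\<close> the right side of \<open>src_weight_integral\<close> is real,
  and for \<open>F \<ge> 0\<close> it is nonnegative. Fibre tests thus give zero imaginary and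
  nonnegative real part, and zero is excluded because \<open>w\<close> has no zeros on
  arrows.\<close>

lemma src_weight_real: "t \<in> arrows H \<Longrightarrow> w (src H t) = complex_of_real (\<delta> t)"
  and \<delta>_pos: "t \<in> arrows H \<Longrightarrow> 0 < \<delta> t"
proof -
  assume t: "t \<in> arrows H"
  define y where "y = rng H t"
  have y: "y \<in> units H" and tf: "t \<in> fiber H y"
    using t H.rng_in_units by (auto simp: y_def fiber_def)
  have Im_cont: "continuous_map (gtop H) euclideanreal (\<lambda>t. Im (w (src H t)))"
    by (rule continuous_map_Im[OF src_weight_cont])
  have Im: "Im (w (src H t)) = 0"
  proof (rule H.fiber_test_zero[OF y _ _ tf])
    show "continuous_map (subtopology (gtop H) (fiber H y)) euclideanreal (\<lambda>t. Im (w (src H t)))"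
      by (rule continuous_map_from_subtopology[OF Im_cont])
    fix F :: "'b \<Rightarrow> real" assume F: "compact_supp (gtop H) F"
    show "set_lebesgue_integral (lamH y) (fiber H y) (\<lambda>s. Im (w (src H s)) * F s) = 0"
      using H.fiber_integral[OF y compact_supp_mult_right(1)[OF Im_cont F]] \<delta>_integral(2)[OF y F] by simp
  qed
  have "- \<delta> t \<le> 0"
  proof (rule H.fiber_test_nonpos[OF y _ _ tf])
    show "continuous_map (subtopology (gtop H) (fiber H y)) euclideanreal (\<lambda>t. - \<delta> t)"
      by (rule continuous_map_from_subtopology[OF continuous_map_minus[OF \<delta>_cont]])
    fix F :: "'b \<Rightarrow> real" assume F: "compact_supp (gtop H) F" "\<And>s. 0 \<le> F s"
    have "set_lebesgue_integral (lamH y) (fiber H y) (\<lambda>s. - \<delta> s * F s) = (\<integral>s. - \<delta> s * F s \<partial>lamH y)"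
      by (rule H.fiber_integral[OF y compact_supp_mult_right(1)[OF continuous_map_minus[OF \<delta>_cont] F(1)]]) simp
    also have "\<dots> = - (\<integral>s. transport F s \<partial>lamG (\<phi> y))"
      using \<delta>_integral(1)[OF y F(1)] by simp
    also have "\<dots> \<le> 0"
      using integral_nonneg_AE[of "transport F" "lamG (\<phi> y)"] transport_nonneg[of F, OF F(2)] by simp
    finally show "set_lebesgue_integral (lamH y) (fiber H y) (\<lambda>s. - \<delta> s * F s) \<le> 0" .
  qed
  moreover show r: "w (src H t) = complex_of_real (\<delta> t)"
    using Im by (simp add: \<delta>_def complex_eq_iff)
  moreover have "w (src H t) \<noteq> 0" using w_nz H.src_closed t by blast
  ultimately show "0 < \<delta> t" by (cases "\<delta> t = 0") auto
qed

section \<open>The morphism p and its modulus\<close>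

definition p :: "'b \<Rightarrow> complex" where "p h = w h / w (src H h)"

lemma p_cont: "continuous_map (gtop H) euclidean p"
  unfolding p_def[abs_def]
  by (intro continuous_map_divide_field w_cont src_weight_cont)
    (use w_nz H.src_closed in \<open>auto simp: H.topspace_gtop\<close>)

lemma p_mult:
  assumes c: "(t, k) \<in> composable H"
  shows "p (gmult H t k) = p t * p k"
proof -
  have tk: "t \<in> arrows H" "k \<in> arrows H" using c by (auto simp: H.composable_iff)
  then have nz: "w (src H t) \<noteq> 0" "w (src H k) \<noteq> 0" using w_nz H.src_closed by blast+
  have "w (gmult H t k) = w t * w k / w (src H t)"
    using weight_mult[OF c] nz by (simp add: field_simps)
  then show ?thesis
    using H.src_gmult[OF c] by (simp add: p_def)
qed

lemma p_unit: "y \<in> units H \<Longrightarrow> p y = 1"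
  using w_nz[of y] by (simp add: p_def H.src_unit H.unit_arrow)

abbreviation absp_int :: "('b \<Rightarrow> real) \<Rightarrow> 'b \<Rightarrow> real" where
  "absp_int F \<equiv> H.fiber_int (\<lambda>t. cmod (p t) * F t)"

lemma compact_supp_absp: "compact_supp (gtop H) F \<Longrightarrow> compact_supp (gtop H) (\<lambda>t. cmod (p t) * F t)"
  by (intro compact_supp_mult_right continuous_map_norm p_cont)

text \<open>The isometry, applied to the function on \<open>G\<close> that \<open>T\<close> maps to \<open>p F\<close>, and disintegrated on both
  sides: the density \<open>\<delta>\<close> absorbs the change of Haar system.\<close>

lemma isometry_disintegrated:
  assumes F: "compact_supp (gtop H) F" "\<And>t. 0 \<le> F t"
  shows "(\<integral>\<^sup>+y. ennreal (absp_int F y) \<partial>muH) = (\<integral>\<^sup>+x. ennreal (H.fiber_int F (\<psi> x)) \<partial>muG)"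
proof -
  \<comment> \<open>Since w = p \<delta> on arrows, dividing by \<open>\<delta>\<close> makes
    \<open>T\<close> map the transport of \<open>F'\<close> to p F. The denominator 1 off the arrows
    replaces an unknown value of \<open>\<delta>\<close> where \<open>F\<close> is zero.\<close>
  define F' where "F' t = F t / (if t \<in> arrows H then \<delta> t else 1)" for t
  have F'_pos: "0 \<le> F' t" for t
    using F(2) \<delta>_pos unfolding F'_def by (intro divide_nonneg_nonneg) (auto intro: less_imp_le)
  have "continuous_map (gtop H) euclideanreal (\<lambda>t. 1 / (if t \<in> arrows H then \<delta> t else 1))"
  proof (rule continuous_map_real_divide)
    show "continuous_map (gtop H) euclideanreal (\<lambda>t. if t \<in> arrows H then \<delta> t else 1)"
      by (rule continuous_map_eq[OF \<delta>_cont]) (simp add: H.topspace_gtop)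
  qed (use \<delta>_pos in \<open>force simp: H.topspace_gtop\<close>)+
  from compact_supp_mult_right(2)[OF this F(1)] have F': "compact_supp (gtop H) F'"
    by (simp add: F'_def[abs_def])
  have \<delta>F': "\<delta> t * F' t = F t" if "t \<in> arrows H" for t
    using that \<delta>_pos[OF that] by (simp add: F'_def)
  define f where "f s = complex_of_real (transport F' s)" for s
  have f: "f \<in> Cc K (gtop G)"
    unfolding f_def[abs_def] by (rule G.Cc_G(5)[OF compact_supp_transport[OF F']])
  have Tf: "cmod (T f t) = cmod (p t) * F t" for t
  proof (cases "t \<in> arrows H")
    case True
    have "T f t = w t * complex_of_real (F' t)"
      using T_eq[OF f True] transport_phi[OF True] by (simp add: f_def)
    then show ?thesis
      using True F(2)[of t] \<delta>_pos[OF True] src_weight_real[OF True]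
      by (simp add: F'_def p_def norm_mult norm_divide)
  next
    case False
    then have "T f t = 0" "F t = 0"
      using T_in[OF f] compact_supp_outside[OF F(1)] by (auto simp: Cc_def H.topspace_gtop)
    then show ?thesis by simp
  qed
  have "(\<integral>\<^sup>+y. ennreal (absp_int F y) \<partial>muH) = (\<integral>\<^sup>+y. ennreal (\<integral>t. cmod (p t) * F t \<partial>lamH y) \<partial>muH)"
    by (intro nn_integral_cong) (simp add: H.fiber_int_def H.space_mu)
  also have "\<dots> = (\<integral>\<^sup>+t. ennreal (cmod (p t) * F t) \<partial>nuH)"
    using F by (intro H.nn_integral_composition'[symmetric] compact_supp_absp) auto
  also have "\<dots> = ennreal (L1_norm nuH (T f))"
    unfolding L1_norm_def Tf using F by (intro H.nu.compact_supp_nn_integral compact_supp_absp) auto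
  also have "\<dots> = ennreal (L1_norm nuG f)"
    using T_norm[OF f] by simp
  also have "\<dots> = ennreal (\<integral>s. transport F' s \<partial>nuG)"
    using transport_nonneg[of F', OF F'_pos] by (simp add: L1_norm_def f_def)
  also have "\<dots> = (\<integral>\<^sup>+s. ennreal (transport F' s) \<partial>nuG)"
    by (intro G.nu.compact_supp_nn_integral[symmetric] compact_supp_transport F' transport_nonneg F'_pos)
  also have "\<dots> = (\<integral>\<^sup>+x. ennreal (\<integral>s. transport F' s \<partial>lamG x) \<partial>muG)"
    by (intro G.nn_integral_composition' compact_supp_transport F' transport_nonneg F'_pos)
  also have "\<dots> = (\<integral>\<^sup>+x. ennreal (H.fiber_int F (\<psi> x)) \<partial>muG)"
  proof (intro nn_integral_cong)
    fix x assume "x \<in> space muG"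
    then have x: "x \<in> units G" by (simp add: G.space_mu)
    have "(\<integral>s. transport F' s \<partial>lamG x) = (\<integral>t. \<delta> t * F' t \<partial>lamH (\<psi> x))"
      using \<delta>_integral(1)[OF psi_unit[OF x] F'] phi_psi[OF G.unit_arrow[OF x]] by simp
    also have "\<dots> = (\<integral>t. F t \<partial>lamH (\<psi> x))"
      using regular_measure.space_eq[OF H.lam_regular[OF psi_unit[OF x]]]
      by (intro Bochner_Integration.integral_cong) (auto simp: \<delta>F' H.topspace_gtop)
    finally show "ennreal (\<integral>s. transport F' s \<partial>lamG x) = ennreal (H.fiber_int F (\<psi> x))"
      using psi_unit[OF x] by (simp add: H.fiber_int_def)
  qed
  finally show ?thesis .
qed

text \<open>A function of the range is constant on each fibre and leaves the fibre integral. The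
  free factor \<open>v\<close> is what later localises the isometry at single units.\<close>

lemma isometry_disintegrated_weighted:
  assumes F: "compact_supp (gtop H) F" "\<And>t. 0 \<le> F t"
    and v: "continuous_map (unit_top H) euclideanreal v" "\<And>y. 0 \<le> v y"
  shows "(\<integral>\<^sup>+y. ennreal (v y * absp_int F y) \<partial>muH) = (\<integral>\<^sup>+x. ennreal (v (\<psi> x) * H.fiber_int F (\<psi> x)) \<partial>muG)"
proof -
  define F' where "F' t = v (rng H t) * F t" for t
  have F': "compact_supp (gtop H) F'" "\<And>t. 0 \<le> F' t"
    unfolding F'_def[abs_def] using H.compact_supp_mult_rng[OF F(1) v(1)] F(2) v(2) by auto
  have 1: "absp_int F' y = v y * absp_int F y" if "y \<in> units H" for y
    using H.fiber_int_mult_rng[OF compact_supp_absp[OF F(1)] v(1) that]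
    by (simp add: F'_def mult.left_commute)
  have 2: "H.fiber_int F' (\<psi> x) = v (\<psi> x) * H.fiber_int F (\<psi> x)" if "x \<in> units G" for x
    using H.fiber_int_mult_rng[OF F(1) v(1) psi_unit[OF that]] by (simp add: F'_def[abs_def])
  have "(\<integral>\<^sup>+y. ennreal (v y * absp_int F y) \<partial>muH) = (\<integral>\<^sup>+y. ennreal (absp_int F' y) \<partial>muH)"
    by (intro nn_integral_cong) (simp add: 1 H.space_mu)
  also have "\<dots> = (\<integral>\<^sup>+x. ennreal (H.fiber_int F' (\<psi> x)) \<partial>muG)"
    by (rule isometry_disintegrated[OF F'])
  also have "\<dots> = (\<integral>\<^sup>+x. ennreal (v (\<psi> x) * H.fiber_int F (\<psi> x)) \<partial>muG)"
    by (intro nn_integral_cong) (simp add: 2 G.space_mu)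
  finally show ?thesis .
qed

text \<open>For continuous \<open>d \<ge> 0\<close> on the units, both
  \<open>d * absp_int F1 * fiber_int F2\<close> and \<open>d * absp_int F2 * fiber_int F1\<close>
  have the same \<open>muH\<close>-integral, namely that of
  \<open>d * fiber_int F1 * fiber_int F2\<close> over \<open>muG\<close> after composition with
  \<open>\<psi>\<close>. For \<open>d\<close> the positive part of the difference of the two sides
  this says that d^2 has integral zero.\<close>

lemma absp_int_cross_le:
  assumes F1: "compact_supp (gtop H) F1" "\<And>t. 0 \<le> F1 t" and F2: "compact_supp (gtop H) F2" "\<And>t. 0 \<le> F2 t"
  shows "absp_int F1 y * H.fiber_int F2 y \<le> absp_int F2 y * H.fiber_int F1 y"
proof -
  let ?A1 = "absp_int F1" and ?A2 = "absp_int F2" and ?B1 = "H.fiber_int F1" and ?B2 = "H.fiber_int F2"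
  have cs: "compact_supp (unit_top H) ?A1" "compact_supp (unit_top H) ?A2"
      "compact_supp (unit_top H) ?B1" "compact_supp (unit_top H) ?B2"
    by (intro H.compact_supp_fiber_int compact_supp_absp F1(1) F2(1))+
  note c = cs[THEN compact_supp_continuous]
  have nn: "0 \<le> ?A1 y" "0 \<le> ?A2 y" "0 \<le> ?B1 y" "0 \<le> ?B2 y" for y
    using F1(2) F2(2) by (auto intro!: H.fiber_int_nonneg)
  define d where "d y = max 0 (?A1 y * ?B2 y - ?A2 y * ?B1 y)" for y
  have d: "continuous_map (unit_top H) euclideanreal d" "\<And>y. 0 \<le> d y"
    unfolding d_def[abs_def] by (intro continuous_intros c) auto
  have cs12: "compact_supp (unit_top H) (\<lambda>y. (d y * ?B2 y) * ?A1 y)" "compact_supp (unit_top H) (\<lambda>y. (d y * ?B1 y) * ?A2 y)"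
    by (intro compact_supp_mult_right(1) continuous_map_real_mult c d(1) cs)+
  have "(\<integral>\<^sup>+y. ennreal ((d y * ?B2 y) * ?A1 y) \<partial>muH) = (\<integral>\<^sup>+x. ennreal ((d (\<psi> x) * ?B2 (\<psi> x)) * ?B1 (\<psi> x)) \<partial>muG)"
    using nn d(2) by (intro isometry_disintegrated_weighted F1 continuous_map_real_mult d(1) c) auto
  also have "\<dots> = (\<integral>\<^sup>+x. ennreal ((d (\<psi> x) * ?B1 (\<psi> x)) * ?B2 (\<psi> x)) \<partial>muG)"
    by (simp add: mult.commute mult.left_commute)
  also have "\<dots> = (\<integral>\<^sup>+y. ennreal ((d y * ?B1 y) * ?A2 y) \<partial>muH)"
    using nn d(2) by (intro isometry_disintegrated_weighted[symmetric] F2 continuous_map_real_mult d(1) c) auto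
  finally have "ennreal (\<integral>y. (d y * ?B2 y) * ?A1 y \<partial>muH) = ennreal (\<integral>y. (d y * ?B1 y) * ?A2 y \<partial>muH)"
    using cs12 nn d(2) by (simp add: H.mu.compact_supp_nn_integral)
  then have "(\<integral>y. (d y * ?B2 y) * ?A1 y \<partial>muH) = (\<integral>y. (d y * ?B1 y) * ?A2 y \<partial>muH)"
    using nn d(2) by (subst (asm) ennreal_inj) (auto intro!: integral_nonneg_AE)
  then have zero: "(\<integral>y. (d y * ?B2 y) * ?A1 y - (d y * ?B1 y) * ?A2 y \<partial>muH) = 0"
    using H.mu.compact_supp_integrable[OF cs12(1)] H.mu.compact_supp_integrable[OF cs12(2)] by simp
  have sq: "(d y * ?B2 y) * ?A1 y - (d y * ?B1 y) * ?A2 y = (d y)\<^sup>2" for y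
    by (auto simp: d_def max_def power2_eq_square algebra_simps)
  have "(d y)\<^sup>2 = 0"
    by (rule H.mu.vanishes_if_integral_zero[OF H.mu(2) compact_supp_diff[OF cs12, unfolded sq] _ zero[unfolded sq]])
      simp
  then show ?thesis
    by (simp add: d_def max_def split: if_splits)
qed

text \<open>A unit lies in its own fibre, so a bump over \<open>C\<close> has positive integral over
  the fibre of each unit in \<open>C\<close>. Such fibre integrals serve as divisors.\<close>

lemma unit_bump:
  assumes "compactin (gtop H) C"
  obtains F :: "'b \<Rightarrow> real" where "compact_supp (gtop H) F" "\<And>t. 0 \<le> F t"
    "\<And>y. y \<in> C \<Longrightarrow> y \<in> units H \<Longrightarrow> 0 < H.fiber_int F y"
proof -
  obtain F :: "'b \<Rightarrow> real" and N where F: "compact_supp (gtop H) F" "\<And>y. 0 \<le> F y" "C \<subseteq> N" "\<And>y. y \<in> N \<Longrightarrow> F y = 1"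
    using bump_function[OF H.locally_compact H.Hausdorff assms openin_topspace compactin_subset_topspace[OF assms]]
    by metis
  have "0 < H.fiber_int F y" if y: "y \<in> C" "y \<in> units H" for y
    unfolding H.fiber_int_def using y F H.integral_pos_fiber[OF y(2) F(1) _ H.unit_in_fiber[OF y(2)]]
    by auto
  then show ?thesis using that F by blast
qed

text \<open>By the cross inequalities the ratio \<open>absp_int F / fiber_int F\<close> does not depend on \<open>F\<close>, so
  \<open>\<bar>p\<bar>\<close> is constant on each fibre; at the unit of the fibre it is \<open>1\<close>.\<close>

lemma norm_p:
  assumes h: "h \<in> arrows H"
  shows "cmod (p h) = 1"
proof -
  define y where "y = rng H h"
  have y: "y \<in> units H" "h \<in> fiber H y"
    using h H.rng_in_units by (auto simp: y_def fiber_def)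
  have "compactin (gtop H) {y}"
    using H.unit_arrow[OF y(1)] by (simp add: H.topspace_gtop)
  then obtain F2 :: "'b \<Rightarrow> real" where F2: "compact_supp (gtop H) F2" "\<And>t. 0 \<le> F2 t" "0 < H.fiber_int F2 y"
    using unit_bump[of "{y}"] y(1) by (metis singletonI)
  define \<alpha> where "\<alpha> = absp_int F2 y"
  define \<beta> where "\<beta> = H.fiber_int F2 y"
  have ec: "continuous_map (gtop H) euclideanreal (\<lambda>t. \<beta> * cmod (p t) - \<alpha>)"
    by (intro continuous_intros p_cont)
  have e: "\<beta> * cmod (p t) - \<alpha> = 0" if "t \<in> fiber H y" for t
  proof (rule H.fiber_test_zero[OF y(1) continuous_map_from_subtopology[OF ec] _ that])
    fix F :: "'b \<Rightarrow> real" assume F: "compact_supp (gtop H) F" "\<And>s. 0 \<le> F s"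
    have int: "integrable (lamH y) F" "integrable (lamH y) (\<lambda>t. cmod (p t) * F t)"
      using regular_measure.compact_supp_integrable[OF H.lam_regular[OF y(1)]] F(1) compact_supp_absp[OF F(1)] by blast+
    have "absp_int F y * \<beta> = \<alpha> * H.fiber_int F y"
      using absp_int_cross_le[OF F F2(1,2), of y] absp_int_cross_le[OF F2(1,2) F, of y]
      by (simp add: \<alpha>_def \<beta>_def)
    then have "\<beta> * (\<integral>t. cmod (p t) * F t \<partial>lamH y) - \<alpha> * (\<integral>t. F t \<partial>lamH y) = 0"
      using y(1) by (simp add: H.fiber_int_def mult.commute)
    then have "(\<integral>t. (\<beta> * cmod (p t) - \<alpha>) * F t \<partial>lamH y) = 0"
      using int by (simp add: left_diff_distrib mult.assoc)
    then show "set_lebesgue_integral (lamH y) (fiber H y) (\<lambda>t. (\<beta> * cmod (p t) - \<alpha>) * F t) = 0"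
      using H.fiber_integral[OF y(1) compact_supp_mult_right(1)[OF ec F(1)]] by simp
  qed
  have "\<beta> = \<alpha>"
    using e[OF H.unit_in_fiber[OF y(1)]] p_unit[OF y(1)] by simp
  then show ?thesis
    using e[OF y(2)] F2(3) by (simp add: \<beta>_def)
qed

lemma absp_int_eq: "absp_int F y = H.fiber_int F y"
proof (cases "y \<in> units H")
  case True
  then show ?thesis
    unfolding H.fiber_int_def using norm_p regular_measure.space_eq[OF H.lam_regular[OF True]]
    by (auto intro!: Bochner_Integration.integral_cong simp: H.topspace_gtop)
qed (simp add: H.fiber_int_def)

section \<open>Push-forward of the unit measure, and the Radon-Nikodym derivative\<close>

lemma phi_unit_homeo: "homeomorphic_map (unit_top H) (unit_top G) \<phi>"
proof -
  have "homeomorphic_maps (unit_top H) (unit_top G) \<phi> \<psi>"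
    unfolding homeomorphic_maps_def
  proof (intro conjI)
    show "continuous_map (unit_top H) (unit_top G) \<phi>"
      unfolding unit_top_def continuous_map_in_subtopology
      using continuous_map_from_subtopology[OF phi_cont] phi.hom_unit by (auto simp: H.topspace_gtop)
    show "continuous_map (unit_top G) (unit_top H) \<psi>"
      unfolding unit_top_def continuous_map_in_subtopology
      using continuous_map_from_subtopology[OF psi_cont] psi_unit by (auto simp: G.topspace_gtop)
  qed (auto simp: G.topspace_unit_top H.topspace_unit_top G.unit_arrow H.unit_arrow psi_phi phi_psi)
  then show ?thesis using homeomorphic_map_maps by blast
qed

text \<open>Now that \<open>absp_int\<close> and \<open>fiber_int\<close> coincide, the weighted
  isometry compares the two measures on functions of the form \<open>v * fiber_int F\<close>.
  Composed with \<open>\<phi>\<close>, every compactly supported \<open>u \<ge> 0\<close> takes this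
  form, by division by a fibre integral that is positive on its support.\<close>

lemma muG_eq: "muG = distr muH (borel_of (unit_top G)) \<phi>"
proof (rule regular_measure_eqI)
  show "regular_measure (unit_top G) (distr muH (borel_of (unit_top G)) \<phi>)"
    by (rule H.mu.regular_measure_distr[OF phi_unit_homeo])
  show "regular_measure (unit_top G) muG"
    by (rule G.mu.regular_measure_axioms)
  fix u :: "'a \<Rightarrow> real" assume u: "compact_supp (unit_top G) u" "\<And>x. 0 \<le> u x"
  have pc: "continuous_map (unit_top H) (unit_top G) \<phi>"
    using phi_unit_homeo homeomorphic_imp_continuous_map by blast
  obtain \<psi>' where m: "homeomorphic_maps (unit_top H) (unit_top G) \<phi> \<psi>'"
    using phi_unit_homeo homeomorphic_map_maps by blast
  obtain C where C: "compactin (unit_top G) C" "\<And>x. x \<notin> C \<Longrightarrow> u x = 0"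
    using u(1) compact_suppE by blast
  define C' where "C' = \<psi>' ` C"
  have C': "compactin (unit_top H) C'"
    unfolding C'_def using m C(1) image_compactin unfolding homeomorphic_maps_def by blast
  have outC': "y \<in> C'" if "y \<in> units H" "u (\<phi> y) \<noteq> 0" for y
  proof -
    have "\<phi> y \<in> C" using C(2) that(2) by blast
    moreover have "\<psi>' (\<phi> y) = y"
      using m that(1) unfolding homeomorphic_maps_def by (simp add: H.topspace_unit_top)
    ultimately show ?thesis unfolding C'_def by (metis imageI)
  qed
  have "compactin (gtop H) C'"
    using C' unfolding unit_top_def by (simp add: compactin_subtopology)
  then obtain F :: "'b \<Rightarrow> real" where F: "compact_supp (gtop H) F" "\<And>t. 0 \<le> F t"
    "\<And>y. y \<in> C' \<Longrightarrow> y \<in> units H \<Longrightarrow> 0 < H.fiber_int F y"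
    using unit_bump by metis
  have Bc: "continuous_map (unit_top H) euclideanreal (H.fiber_int F)"
    by (rule compact_supp_continuous[OF H.compact_supp_fiber_int[OF F(1)]])
  have C'u: "C' \<subseteq> units H"
    using compactin_subset_topspace[OF C'] by (simp add: H.topspace_unit_top)
  obtain c where c: "0 < c" "\<And>y. y \<in> C' \<Longrightarrow> c \<le> H.fiber_int F y"
  proof (cases "C' = {}")
    case True then show ?thesis using that[of 1] by simp
  next
    case False
    have "compact (H.fiber_int F ` C')"
      using image_compactin[OF C' Bc] by simp
    then obtain c where "c \<in> H.fiber_int F ` C'" "\<And>b. b \<in> H.fiber_int F ` C' \<Longrightarrow> c \<le> b"
      using compact_attains_inf[of "H.fiber_int F ` C'"] False by blast
    then show ?thesis using that[of c] F(3) C'u by blast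
  qed
  \<comment> \<open>Raising the denominator to at least \<open>c\<close> keeps it positive
    everywhere and changes nothing on \<open>C'\<close>, outside which the numerator
    vanishes.\<close>
  define v where "v y = u (\<phi> y) / max (H.fiber_int F y) c" for y
  have uc: "continuous_map (unit_top H) euclideanreal (\<lambda>y. u (\<phi> y))"
    using continuous_map_compose[OF pc compact_supp_continuous[OF u(1)]] by (simp add: comp_def)
  have v: "continuous_map (unit_top H) euclideanreal v" "\<And>y. 0 \<le> v y"
    unfolding v_def[abs_def] using c(1) u(2)
    by (auto intro!: continuous_map_real_divide continuous_map_real_max uc Bc)
  have vB: "v y * H.fiber_int F y = u (\<phi> y)" if y: "y \<in> units H" for y
  proof (cases "u (\<phi> y) = 0")
    case False
    then have "y \<in> C'" using outC' y by blast
    then show ?thesis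
      using c(1) c(2)[of y] F(3)[of y] y by (simp add: v_def max_def)
  qed (simp add: v_def)
  have "(\<integral>\<^sup>+x. ennreal (u x) \<partial>muG) = (\<integral>\<^sup>+x. ennreal (v (\<psi> x) * H.fiber_int F (\<psi> x)) \<partial>muG)"
    using vB psi_unit by (intro nn_integral_cong) (simp add: G.space_mu phi_psi G.unit_arrow)
  also have "\<dots> = (\<integral>\<^sup>+y. ennreal (v y * H.fiber_int F y) \<partial>muH)"
    using isometry_disintegrated_weighted[OF F(1,2) v] by (simp add: absp_int_eq)
  also have "\<dots> = (\<integral>\<^sup>+y. ennreal (u (\<phi> y)) \<partial>muH)"
    using vB by (intro nn_integral_cong) (simp add: H.space_mu)
  also have "\<dots> = (\<integral>\<^sup>+x. ennreal (u x) \<partial>distr muH (borel_of (unit_top G)) \<phi>)"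
    using continuous_map_measurable[OF pc] continuous_map_borel_measurable[OF compact_supp_continuous[OF u(1)]]
      measurable_cong_sets[OF H.mu.sets_eq refl]
    by (subst nn_integral_distr) auto
  finally show "(\<integral>\<^sup>+x. ennreal (u x) \<partial>muG) = (\<integral>\<^sup>+x. ennreal (u x) \<partial>distr muH (borel_of (unit_top G)) \<phi>)" .
qed

text \<open>\<open>\<delta>_integral\<close> is the density relation for continuous functions with
  compact support; \<open>regular_eq_density\<close> extends it to Borel sets because
  \<open>\<delta>\<close> is positive and the push-forward is regular.\<close>

lemma RN_derivative: "continuous_RN_derivative G lamG H lamH \<phi> (\<lambda>a. \<delta> (\<psi> a))"
  unfolding continuous_RN_derivative_def
proof (intro conjI ballI impI)
  show Dc: "continuous_map (gtop G) euclideanreal (\<lambda>a. \<delta> (\<psi> a))"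
    using continuous_map_compose[OF psi_cont \<delta>_cont] by (simp add: comp_def)
  show "0 \<le> \<delta> (\<psi> a)" if "a \<in> arrows G" for a
    using \<delta>_pos[OF psi_arrow[OF that]] by simp
  fix x E assume x: "x \<in> units G" and E: "E \<in> sets (borel_of (gtop G))"
  have y: "\<psi> x \<in> units H" using psi_unit[OF x] .
  interpret R: regular_measure "gtop H" "lamH (\<psi> x)" using H.lam_regular[OF y] .
  have inv: "inv_into (arrows H) \<phi> x = \<psi> x"
    using psi_phi phi_psi[OF G.unit_arrow[OF x]] psi_arrow[OF G.unit_arrow[OF x]]
    by (metis inv_into_f_f inj_on_inverseI)
  have hm: "homeomorphic_map (gtop H) (gtop G) \<phi>"
    using homeo homeomorphic_map_maps by blast
  have "emeasure (lamG x) E = (\<integral>\<^sup>+a \<in> E. ennreal (\<delta> (\<psi> a)) \<partial>distr (lamH (\<psi> x)) (borel_of (gtop G)) \<phi>)"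
  proof (rule regular_eq_density[OF R.regular_measure_distr[OF hm] G.lam_regular[OF x] Dc _ _ E])
    show "0 < \<delta> (\<psi> a)" if "a \<in> topspace (gtop G)" for a
      using \<delta>_pos psi_arrow that by (simp add: G.topspace_gtop)
    fix F :: "'a \<Rightarrow> real" assume F: "compact_supp (gtop G) F" "\<And>a. 0 \<le> F a"
    define F' where "F' t = (if t \<in> arrows H then F (\<phi> t) else 0)" for t
    have F': "compact_supp (gtop H) F'" "\<And>t. 0 \<le> F' t"
      using compact_supp_homeomorphic[OF F(1) homeomorphic_maps_sym[THEN iffD1, OF homeo]] F(2)
      by (auto simp: F'_def[abs_def] H.topspace_gtop)
    have tr: "transport F' = F"
      using compact_supp_outside[OF F(1)] psi_arrow phi_psi
      by (auto simp: transport_def F'_def fun_eq_iff G.topspace_gtop)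
    have "(\<integral>\<^sup>+a. ennreal (F a) \<partial>lamG x) = ennreal (\<integral>a. F a \<partial>lamG x)"
      by (rule regular_measure.compact_supp_nn_integral[OF G.lam_regular[OF x] F])
    also have "\<dots> = ennreal (\<integral>t. \<delta> t * F' t \<partial>lamH (\<psi> x))"
      using \<delta>_integral(1)[OF y F'(1)] tr phi_psi[OF G.unit_arrow[OF x]] by simp
    also have "\<dots> = (\<integral>\<^sup>+t. ennreal (\<delta> t * F' t) \<partial>lamH (\<psi> x))"
    proof (rule R.compact_supp_nn_integral[symmetric])
      show "compact_supp (gtop H) (\<lambda>t. \<delta> t * F' t)"
        by (rule compact_supp_mult_right(1)[OF \<delta>_cont F'(1)])
      show "0 \<le> \<delta> t * F' t" for t
        using \<delta>_pos[of t] F'(2)[of t] by (cases "t \<in> arrows H") (auto simp: F'_def)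
    qed
    also have "\<dots> = (\<integral>\<^sup>+t. ennreal (\<delta> (\<psi> (\<phi> t)) * F (\<phi> t)) \<partial>lamH (\<psi> x))"
      by (intro nn_integral_cong) (simp add: F'_def R.space_eq H.topspace_gtop psi_phi)
    also have "\<dots> = (\<integral>\<^sup>+a. ennreal (\<delta> (\<psi> a) * F a) \<partial>distr (lamH (\<psi> x)) (borel_of (gtop G)) \<phi>)"
      using continuous_map_measurable[OF phi_cont] measurable_cong_sets[OF R.sets_eq refl]
        continuous_map_borel_measurable[OF Dc] continuous_map_borel_measurable[OF compact_supp_continuous[OF F(1)]]
      by (subst nn_integral_distr) auto
    finally show "(\<integral>\<^sup>+a. ennreal (F a) \<partial>lamG x) =
      (\<integral>\<^sup>+a. ennreal (\<delta> (\<psi> a) * F a) \<partial>distr (lamH (\<psi> x)) (borel_of (gtop G)) \<phi>)" .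
  qed
  then show "emeasure (lamG x) E = (\<integral>\<^sup>+a \<in> E. ennreal (\<delta> (\<psi> a))
      \<partial>distr (lamH (inv_into (arrows H) \<phi> x)) (borel_of (gtop G)) \<phi>)"
    using inv by simp
qed

lemma p_hom: "groupoid_hom H circle_group p"
  unfolding groupoid_hom_def
proof (intro conjI ballI, safe)
  show "p a \<in> arrows circle_group" if "a \<in> arrows H" for a
    using norm_p[OF that] by (simp add: circle_group_def)
  fix a b assume c: "(a, b) \<in> composable H"
  then have ab: "a \<in> arrows H" "b \<in> arrows H" by (auto simp: H.composable_iff)
  then have "p a \<noteq> 0" "p b \<noteq> 0" using norm_p by force+
  then show "(p a, p b) \<in> composable circle_group"
    using norm_p ab by (simp add: composable_def circle_group_def src_def rng_def)
  show "p (gmult H a b) = gmult circle_group (p a) (p b)"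
    using p_mult[OF c] by (simp add: circle_group_def)
qed

lemma p_cont_circle: "continuous_map (gtop H) (gtop circle_group) p"
  using p_cont norm_p by (auto simp: circle_group_def continuous_map_in_subtopology H.topspace_gtop)

lemma T_formula:
  assumes "f \<in> Cc K (gtop G)" "h \<in> arrows H"
  shows "T f h = p h * complex_of_real (\<delta> (\<psi> (\<phi> h))) * f (\<phi> h)"
  using T_eq[OF assms] psi_phi[OF assms(2)] src_weight_real[OF assms(2)] \<delta>_pos[OF assms(2)]
  by (simp add: p_def)

end

theorem theorem3p25:
  fixes K :: "complex set"
    and G :: "'a top_groupoid" and H :: "'b top_groupoid"
    and lamG :: "'a \<Rightarrow> 'a measure" and lamH :: "'b \<Rightarrow> 'b measure"
    and muG nuG :: "'a measure" and muH nuH :: "'b measure"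
    and T :: "('a \<Rightarrow> complex) \<Rightarrow> ('b \<Rightarrow> complex)"
  assumes "K = \<real> \<or> K = UNIV"
    and "lc_hausdorff_groupoid G" and "lc_hausdorff_groupoid H"
    and "haar_system K G lamG" and "fully_supported_haar G lamG"
    and "haar_system K H lamH" and "fully_supported_haar H lamH"
    and "regular_borel_measure (unit_top G) muG" and "fully_supported (unit_top G) muG"
    and "regular_borel_measure (unit_top H) muH" and "fully_supported (unit_top H) muH"
    and "composition_measure G lamG muG nuG"
    and "composition_measure H lamH muH nuH"
    and "Cc_algebra_iso K G lamG H lamH T"
    and "\<forall>f \<in> Cc K (gtop G). L1_norm nuH (T f) = L1_norm nuG f"
  shows "\<exists>\<phi> p D.
           top_groupoid_iso H G \<phi> \<and>
           groupoid_hom H circle_group p \<and>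
           continuous_map (gtop H) (gtop circle_group) p \<and>
           continuous_RN_derivative G lamG H lamH \<phi> D \<and>
           (\<forall>f \<in> Cc K (gtop G). \<forall>h \<in> arrows H.
              T f h = p h * complex_of_real (D (\<phi> h)) * f (\<phi> h)) \<and>
           muG = distr muH (borel_of (unit_top G)) \<phi>"
proof -
  interpret scalar_field K by unfold_locales fact
  interpret lcG: lc_hausdorff_groupoid G by fact
  interpret lcH: lc_hausdorff_groupoid H by fact
  interpret G: haar_composition K G lamG muG nuG by unfold_locales (use assms in blast)+
  interpret H: haar_composition K H lamH muH nuH by unfold_locales (use assms in blast)+
  define S where "S = the_inv_into (Cc K (gtop G)) T"
  have bij: "bij_betw T (Cc K (gtop G)) (Cc K (gtop H))"
    and add: "\<And>f g. f \<in> Cc K (gtop G) \<Longrightarrow> g \<in> Cc K (gtop G) \<Longrightarrow> T (\<lambda>a. f a + g a) = (\<lambda>h. T f h + T g h)"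
    and scale: "\<And>c f. c \<in> K \<Longrightarrow> f \<in> Cc K (gtop G) \<Longrightarrow> T (\<lambda>a. c * f a) = (\<lambda>h. c * T f h)"
    and conv: "\<And>f g. f \<in> Cc K (gtop G) \<Longrightarrow> g \<in> Cc K (gtop G) \<Longrightarrow>
      T (convolution G lamG f g) = convolution H lamH (T f) (T g)"
    using assms(14) unfolding Cc_algebra_iso_def by auto
  have T_in: "T f \<in> Cc K (gtop H)" if "f \<in> Cc K (gtop G)" for f
    using bij that bij_betwE by blast
  have S_in: "S k \<in> Cc K (gtop G)" if "k \<in> Cc K (gtop H)" for k
    using bij that bij_betw_the_inv_into[OF bij] bij_betwE unfolding S_def by blast
  have TS: "T (S k) = k" if "k \<in> Cc K (gtop H)" for k
    using f_the_inv_into_f_bij_betw[OF bij] that unfolding S_def by blast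
  have ST: "S (T f) = f" if "f \<in> Cc K (gtop G)" for f
    using bij that unfolding S_def bij_betw_def by (auto intro: the_inv_into_f_f)
  \<comment> \<open>\<open>T\<close> is isometric for the composed measures on the arrow spaces, and
    these inherit full support by \<open>nu_fully_supported\<close>.\<close>
  interpret I: L1_isometry K "gtop G" nuG "gtop H" nuH T S
    by unfold_locales
      (use G.nu_fully_supported H.nu_fully_supported T_in S_in TS ST add scale assms(15) in auto)
  obtain w where w: "continuous_map (gtop H) euclidean w" "\<And>h. h \<in> topspace (gtop H) \<Longrightarrow> w h \<noteq> 0"
    "\<And>f h. f \<in> Cc K (gtop G) \<Longrightarrow> h \<in> topspace (gtop H) \<Longrightarrow> T f h = w h * f (I.phi h)"
    using I.weighted_composition by metis
  interpret C: convolution_isometry K G lamG muG nuG H lamH muH nuH T I.phi I.psi w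
  proof unfold_locales
    show "\<exists>f \<in> Cc K (gtop G). T f = k" if "k \<in> Cc K (gtop H)" for k
      using S_in TS that by blast
  qed (use I.phi_psi_homeomorphic w conv T_in assms(15) in \<open>auto simp: lcH.topspace_gtop\<close>)
  have "homeomorphic_map (gtop H) (gtop G) I.phi"
    using C.homeo homeomorphic_map_maps by blast
  then have "top_groupoid_iso H G I.phi"
    unfolding top_groupoid_iso_def using C.phi_hom by (intro conjI)
  show ?thesis
  proof (intro exI conjI ballI)
    show "top_groupoid_iso H G I.phi" by fact
    show "groupoid_hom H circle_group C.p" by (rule C.p_hom)
    show "continuous_map (gtop H) (gtop circle_group) C.p" by (rule C.p_cont_circle)
    show "continuous_RN_derivative G lamG H lamH I.phi (\<lambda>a. C.\<delta> (I.psi a))" by (rule C.RN_derivative)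
    show "T f h = C.p h * complex_of_real (C.\<delta> (I.psi (I.phi h))) * f (I.phi h)"
      if "f \<in> Cc K (gtop G)" "h \<in> arrows H" for f h
      using that by (rule C.T_formula)
    show "muG = distr muH (borel_of (unit_top G)) I.phi" by (rule C.muG_eq)
  qed
qed

end
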